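(* For a set of words $W\subseteq\mathfrak A^*$ the following conditions are equivalent: (I) the monoid $S(W)$ is hereditarily finitely based; (II) the set of words $W$ is hereditarily finitely based; (III) $W\not\preceq\{xt_1xyt_2y\}$ and either $W\not\preceq\{xyt_1xt_2y\}$ or $W\not\preceq\{xt_1yt_2xy\}$; (IV) $W$ satisfies one of the following two (dual) conditions: (i) every adjacent pair of occurrences of two non-linear variables $x\ne y$ in each word $\mathbf u\in W$ is of the form $\{{}_{1\mathbf u}x,{}_{1\mathbf u}y\}$ (the first occurrence of $x$ and the first occurrence of $y$ in $\mathbf u$); (ii) every adjacent pair of occurrences of two non-linear variables $x\ne y$ in each word $\mathbf u\in W$ is of the form $\{{}_{last\,\mathbf u}x,{}_{last\,\mathbf u}y\}$ (the last occurrence of $x$ and the last occurrence of $y$ in $\mathbf u$); (V) $S(W)$ is contained either in $\operatorname{var}\{\sigma_1,\sigma_\mu\}$ or in $\operatorname{var}\{\sigma_2,\sigma_\mu\}$.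
   Context: Let $\mathfrak A$ be a countable alphabet whose elements are called variables; elements of the free monoid $\mathfrak A^*$ are called words. "Subword" means contiguous factor. For a set of words $W$, $S(W)$ denotes the Rees quotient of $\mathfrak A^*$ over the ideal consisting of all words that are not subwords of words in $W$. A semigroup is finitely based if all of its identities can be deduced from some finite subset of them; a set of words $W$ is finitely based if $S(W)$ is finitely based. $\operatorname{var} S$ is the variety generated by $S$, and $\operatorname{var}\Sigma$ is the variety defined by the set of identities $\Sigma$. A word $\mathbf u$ is an isoterm for a semigroup $S$ if $S$ satisfies no nontrivial identity $\mathbf u\approx\mathbf v$. For sets of words $W,W'$, $W\preceq W'$ means: for every monoid $S$, if every word in $W$ is an isoterm for $S$, then every word in $W'$ is an isoterm for $S$. A monoid $S$ is hereditarily finitely based if every monoid subvariety of $\operatorname{var} S$ is finitely based. A set of words $W$ is hereditarily finitely based if every set of words $W'$ with $W\preceq W'$ is finitely based. A variable is non-linear in a word if it occurs more than once in it. Two occurrences of variables in $\mathbf u$ are adjacent if they occupy consecutive positions of $\mathbf u$. The identities are: $\sigma_1:\ xyt_1xt_2y\approx yxt_1xt_2y$; $\sigma_\mu:\ xt_1xyt_2y\approx xt_1yxt_2y$; $\sigma_2:\ xt_1yt_2xy\approx xt_1yt_2yx$. Here $x,y,t_1,t_2$ are distinct variables. *)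

theory Defs
  imports "HOL-Algebra.Group" "HOL-Library.Sublist" "HOL-Library.Countable"
    "HOL-Library.Infinite_Typeclass"
begin

text \<open>
  The alphabet is a countably infinite type \<open>'a\<close>; words are lists, so that \<open>[]\<close> is the identity
  of the free monoid. All identities are monoid identities: pairs of possibly empty words, with
  substitutions that may send letters to the empty word.
\<close>

type_synonym 'a identity = "'a list \<times> 'a list"


section \<open>Identities\<close>

definition word_val :: "('b, 'c) monoid_scheme \<Rightarrow> ('a \<Rightarrow> 'b) \<Rightarrow> 'a list \<Rightarrow> 'b" where
  "word_val M \<phi> w = foldr (\<lambda>a m. \<phi> a \<otimes>\<^bsub>M\<^esub> m) w \<one>\<^bsub>M\<^esub>"

definition satisfies :: "('b, 'c) monoid_scheme \<Rightarrow> 'a identity \<Rightarrow> bool" where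
  "satisfies M e \<longleftrightarrow>
     (\<forall>\<phi>. (\<forall>a. \<phi> a \<in> carrier M) \<longrightarrow> word_val M \<phi> (fst e) = word_val M \<phi> (snd e))"

definition isoterm :: "('b, 'c) monoid_scheme \<Rightarrow> 'a list \<Rightarrow> bool" where
  "isoterm M u \<longleftrightarrow> (\<forall>v. satisfies M (u, v) \<longrightarrow> v = u)"

definition identities :: "('b, 'c) monoid_scheme set \<Rightarrow> 'a identity set" where
  "identities K = {e. \<forall>M\<in>K. satisfies M e}"

definition subst_word :: "('a \<Rightarrow> 'a list) \<Rightarrow> 'a list \<Rightarrow> 'a list" where
  "subst_word \<theta> w = concat (map \<theta> w)"

inductive deducible :: "'a identity set \<Rightarrow> 'a list \<Rightarrow> 'a list \<Rightarrow> bool"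
  for \<Sigma> :: "'a identity set" where
  refl: "deducible \<Sigma> u u"
| sym: "deducible \<Sigma> u v \<Longrightarrow> deducible \<Sigma> v u"
| trans: "deducible \<Sigma> u v \<Longrightarrow> deducible \<Sigma> v w \<Longrightarrow> deducible \<Sigma> u w"
| step: "(u, v) \<in> \<Sigma> \<Longrightarrow> deducible \<Sigma> (p @ subst_word \<theta> u @ s) (p @ subst_word \<theta> v @ s)"


section \<open>Quotients of the free monoid\<close>

definition quotient_monoid :: "'a list rel \<Rightarrow> 'a list set monoid" where
  "quotient_monoid \<rho> =
     \<lparr>carrier = UNIV // \<rho>,
      mult = (\<lambda>X Y. \<Union>x\<in>X. \<Union>y\<in>Y. \<rho> `` {x @ y}),
      one = \<rho> `` {[]}\<rparr>"

definition rees_cong :: "'a list set \<Rightarrow> 'a list rel" where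
  "rees_cong I = {(u, v). u = v \<or> u \<in> I \<and> v \<in> I}"

text \<open>The monoid \<open>S(W)\<close>. The predicate \<open>sublist\<close> of the library means contiguous factor.\<close>

definition S_monoid :: "'a list set \<Rightarrow> 'a list set monoid" where
  "S_monoid W = quotient_monoid (rees_cong {u. \<not> (\<exists>w\<in>W. sublist u w)})"

locale word_cong =
  fixes \<rho> :: "'a list rel"
  assumes eqv: "equiv UNIV \<rho>"
    and cong: "(u, u') \<in> \<rho> \<Longrightarrow> (v, v') \<in> \<rho> \<Longrightarrow> (u @ v, u' @ v') \<in> \<rho>"
begin

lemma mult_class:
  "\<rho> `` {u} \<otimes>\<^bsub>quotient_monoid \<rho>\<^esub> \<rho> `` {v} = \<rho> `` {u @ v}"
proof -
  have "\<rho> `` {x @ y} = \<rho> `` {u @ v}" if "x \<in> \<rho> `` {u}" "y \<in> \<rho> `` {v}" for x y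
    using that cong[of u x v y] equiv_class_eq[OF eqv] by fastforce
  moreover have "u \<in> \<rho> `` {u}" "v \<in> \<rho> `` {v}"
    using equiv_class_self[OF eqv] by simp_all
  ultimately have "(\<Union>x\<in>\<rho> `` {u}. \<Union>y\<in>\<rho> `` {v}. \<rho> `` {x @ y}) = \<rho> `` {u @ v}"
    by (intro equalityI UN_least) (blast+)
  then show ?thesis
    by (simp add: quotient_monoid_def)
qed

lemma carrier_class: "X \<in> carrier (quotient_monoid \<rho>) \<longleftrightarrow> (\<exists>u. X = \<rho> `` {u})"
  by (auto simp: quotient_monoid_def quotient_def)

lemma one_class: "\<one>\<^bsub>quotient_monoid \<rho>\<^esub> = \<rho> `` {[]}"
  by (simp add: quotient_monoid_def)

lemma monoid_quotient: "monoid (quotient_monoid \<rho>)"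
  by (rule monoidI) (auto simp only: carrier_class mult_class one_class append_assoc
      append.left_neutral append.right_neutral)

lemma word_val_quotient:
  "word_val (quotient_monoid \<rho>) (\<lambda>a. \<rho> `` {\<theta> a}) w = \<rho> `` {subst_word \<theta> w}"
  by (induction w) (simp_all add: word_val_def subst_word_def mult_class one_class)

lemma satisfies_quotient:
  "satisfies (quotient_monoid \<rho>) (u, v) \<longleftrightarrow> (\<forall>\<theta>. (subst_word \<theta> u, subst_word \<theta> v) \<in> \<rho>)"
proof -
  have "satisfies (quotient_monoid \<rho>) (u, v) \<longleftrightarrow>
      (\<forall>\<theta>. word_val (quotient_monoid \<rho>) (\<lambda>a. \<rho> `` {\<theta> a}) u =
            word_val (quotient_monoid \<rho>) (\<lambda>a. \<rho> `` {\<theta> a}) v)"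
  proof
    assume R: "\<forall>\<theta>. word_val (quotient_monoid \<rho>) (\<lambda>a. \<rho> `` {\<theta> a}) u =
            word_val (quotient_monoid \<rho>) (\<lambda>a. \<rho> `` {\<theta> a}) v"
    show "satisfies (quotient_monoid \<rho>) (u, v)"
      unfolding satisfies_def
    proof (intro allI impI)
      fix \<phi> :: "'a \<Rightarrow> 'a list set"
      assume "\<forall>a. \<phi> a \<in> carrier (quotient_monoid \<rho>)"
      then have "\<forall>a. \<exists>t. \<phi> a = \<rho> `` {t}"
        by (simp only: carrier_class simp_thms)
      then obtain \<theta> where "\<forall>a. \<phi> a = \<rho> `` {\<theta> a}"
        by metis
      then have "\<phi> = (\<lambda>a. \<rho> `` {\<theta> a})"
        by blast
      then show "word_val (quotient_monoid \<rho>) \<phi> (fst (u, v)) =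
          word_val (quotient_monoid \<rho>) \<phi> (snd (u, v))"
        using R by simp
    qed
  next
    have "\<rho> `` {\<theta> a} \<in> carrier (quotient_monoid \<rho>)" for \<theta> and a :: 'a
      unfolding carrier_class by blast
    moreover assume "satisfies (quotient_monoid \<rho>) (u, v)"
    ultimately show "\<forall>\<theta>. word_val (quotient_monoid \<rho>) (\<lambda>a. \<rho> `` {\<theta> a}) u =
        word_val (quotient_monoid \<rho>) (\<lambda>a. \<rho> `` {\<theta> a}) v"
      by (simp add: satisfies_def)
  qed
  then show ?thesis
    by (simp add: word_val_quotient eq_equiv_class_iff[OF eqv])
qed

end

lemma word_cong_rees:
  assumes "\<And>u p s. u \<in> I \<Longrightarrow> p @ u @ s \<in> I"
  shows "word_cong (rees_cong I)"
proof
  show "equiv UNIV (rees_cong I)"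
    by (auto simp: rees_cong_def equiv_def refl_on_def sym_def trans_def)
  fix u u' v v' assume "(u, u') \<in> rees_cong I" "(v, v') \<in> rees_cong I"
  moreover have "x @ y \<in> I" if "x \<in> I \<or> y \<in> I" for x y
    using that assms[of x "[]" y] assms[of y x "[]"] by auto
  ultimately show "(u @ v, u' @ v') \<in> rees_cong I"
    by (auto simp: rees_cong_def)
qed

lemma monoid_S_monoid: "monoid (S_monoid W)"
proof -
  have "sublist u (p @ u @ s)" for u p s :: "'a list"
    by (auto simp: sublist_def)
  then have "word_cong (rees_cong {u. \<not> (\<exists>w\<in>W. sublist u w)})"
    by (intro word_cong_rees) (blast intro: sublist_order.order_trans)
  then show ?thesis
    unfolding S_monoid_def by (rule word_cong.monoid_quotient)
qed

text \<open>
  Classes of monoids, and quantification over all monoids, are rendered with monoids whose elements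
  are sets of words; this includes all quotients of the free monoid. The next lemma shows that
  nothing is lost: any monoid, over any type, has the same identities (hence the same isoterms, and
  the same memberships in varieties) as a monoid of this kind.
\<close>

lemma ex_same_identities:
  fixes M :: "('b, 'c) monoid_scheme"
  assumes "monoid M"
  shows "\<exists>N :: 'a list set monoid. monoid N \<and>
           (\<forall>e :: 'a identity. satisfies N e \<longleftrightarrow> satisfies M e)"
proof -
  interpret monoid M by fact
  define \<rho> where "\<rho> = {e :: 'a identity. satisfies M e}"
  have closed: "word_val M \<phi> w \<in> carrier M" if "\<forall>a. \<phi> a \<in> carrier M" for \<phi> and w :: "'a list"
    using that by (induction w) (auto simp: word_val_def)
  have app: "word_val M \<phi> (u @ v) = word_val M \<phi> u \<otimes>\<^bsub>M\<^esub> word_val M \<phi> v"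
    if "\<forall>a. \<phi> a \<in> carrier M" for \<phi> and u v :: "'a list"
    using that closed[OF that] by (induction u) (auto simp: word_val_def m_assoc)
  have sub: "word_val M \<phi> (subst_word \<theta> w) = word_val M (\<lambda>a. word_val M \<phi> (\<theta> a)) w"
    if "\<forall>a. \<phi> a \<in> carrier M" for \<phi> \<theta> and w :: "'a list"
  proof (induction w)
    case (Cons a w)
    then show ?case
      using app[OF that, of "\<theta> a" "subst_word \<theta> w"] by (simp add: subst_word_def word_val_def)
  qed (simp add: subst_word_def word_val_def)
  interpret word_cong \<rho>
  proof
    show "equiv UNIV \<rho>"
      by (auto simp: \<rho>_def satisfies_def equiv_def refl_on_def sym_def trans_def)
  qed (simp add: \<rho>_def satisfies_def app)
  have "satisfies (quotient_monoid \<rho>) (u, v) \<longleftrightarrow> satisfies M (u, v)" for u v :: "'a list"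
  proof
    assume "satisfies (quotient_monoid \<rho>) (u, v)"
    then have "(subst_word (\<lambda>a. [a]) u, subst_word (\<lambda>a. [a]) v) \<in> \<rho>"
      by (simp add: satisfies_quotient)
    then show "satisfies M (u, v)"
      by (simp add: subst_word_def \<rho>_def)
  next
    assume "satisfies M (u, v)"
    then show "satisfies (quotient_monoid \<rho>) (u, v)"
      by (simp add: satisfies_quotient) (simp add: \<rho>_def satisfies_def sub closed)
  qed
  then show ?thesis
    using monoid_quotient by auto
qed


section \<open>Varieties and the finite basis property\<close>

definition var_of :: "'a identity set \<Rightarrow> 'a list set monoid set" where
  "var_of \<Sigma> = {M. monoid M \<and> (\<forall>e\<in>\<Sigma>. satisfies M e)}"

definition monoid_variety :: "'a list set monoid set \<Rightarrow> bool" where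
  "monoid_variety V \<longleftrightarrow> (\<exists>\<Sigma>. V = var_of \<Sigma>)"

definition var_gen :: "'a list set monoid \<Rightarrow> 'a list set monoid set" where
  "var_gen M = \<Inter>{V. monoid_variety V \<and> M \<in> V}"

definition finitely_based :: "'a list set monoid set \<Rightarrow> bool" where
  "finitely_based K \<longleftrightarrow>
     (\<exists>\<Sigma> :: 'a identity set. finite \<Sigma> \<and> \<Sigma> \<subseteq> identities K \<and>
        (\<forall>(u, v)\<in>identities K. deducible \<Sigma> u v))"

definition hereditarily_finitely_based :: "'a list set monoid \<Rightarrow> bool" where
  "hereditarily_finitely_based M \<longleftrightarrow>
     (\<forall>V. monoid_variety V \<and> V \<subseteq> var_gen M \<longrightarrow> finitely_based V)"


section \<open>Sets of words\<close>

definition word_set_finitely_based :: "'a list set \<Rightarrow> bool" where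
  "word_set_finitely_based W \<longleftrightarrow> finitely_based {S_monoid W}"

definition word_set_le :: "'a list set \<Rightarrow> 'a list set \<Rightarrow> bool" (infix \<open>\<preceq>\<close> 50) where
  "W \<preceq> W' \<longleftrightarrow>
     (\<forall>M :: 'a list set monoid. monoid M \<longrightarrow>
        (\<forall>u\<in>W. isoterm M u) \<longrightarrow> (\<forall>u\<in>W'. isoterm M u))"

lemma word_set_leD:
  fixes M :: "('b, 'c) monoid_scheme" and W :: "'a list set"
  assumes "W \<preceq> W'" "monoid M" "\<forall>u\<in>W. isoterm M u" "u \<in> W'"
  shows "isoterm M u"
proof -
  obtain N :: "'a list set monoid"
    where "monoid N" "\<forall>e :: 'a identity. satisfies N e \<longleftrightarrow> satisfies M e"
    using ex_same_identities[OF assms(2)] by blast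
  moreover from this have "isoterm N w \<longleftrightarrow> isoterm M w" for w :: "'a list"
    by (simp add: isoterm_def)
  ultimately show ?thesis
    using assms unfolding word_set_le_def by blast
qed

definition word_set_hereditarily_finitely_based :: "'a list set \<Rightarrow> bool" where
  "word_set_hereditarily_finitely_based W \<longleftrightarrow>
     (\<forall>W'. W \<preceq> W' \<longrightarrow> word_set_finitely_based W')"


section \<open>Occurrences of letters\<close>

definition nonlinear_in :: "'a \<Rightarrow> 'a list \<Rightarrow> bool" where
  "nonlinear_in x u \<longleftrightarrow> count_list u x > 1"

text \<open>Occurrences of letters in \<open>u\<close> are positions \<open>i < length u\<close>.\<close>

definition first_occurrence :: "'a list \<Rightarrow> nat \<Rightarrow> bool" where
  "first_occurrence u i \<longleftrightarrow> i < length u \<and> (\<forall>j<i. u ! j \<noteq> u ! i)"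

definition last_occurrence :: "'a list \<Rightarrow> nat \<Rightarrow> bool" where
  "last_occurrence u i \<longleftrightarrow> i < length u \<and> (\<forall>j<length u. i < j \<longrightarrow> u ! j \<noteq> u ! i)"

definition adjacent_nonlinear_pair :: "'a list \<Rightarrow> nat \<Rightarrow> bool" where
  "adjacent_nonlinear_pair u i \<longleftrightarrow>
     Suc i < length u \<and> u ! i \<noteq> u ! Suc i \<and>
     nonlinear_in (u ! i) u \<and> nonlinear_in (u ! Suc i) u"

definition adjacent_pairs_first :: "'a list set \<Rightarrow> bool" where
  "adjacent_pairs_first W \<longleftrightarrow>
     (\<forall>u\<in>W. \<forall>i. adjacent_nonlinear_pair u i \<longrightarrow>
        first_occurrence u i \<and> first_occurrence u (Suc i))"

definition adjacent_pairs_last :: "'a list set \<Rightarrow> bool" where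
  "adjacent_pairs_last W \<longleftrightarrow>
     (\<forall>u\<in>W. \<forall>i. adjacent_nonlinear_pair u i \<longrightarrow>
        last_occurrence u i \<and> last_occurrence u (Suc i))"


section \<open>The identities\<close>

definition sigma_1 :: "'a \<Rightarrow> 'a \<Rightarrow> 'a \<Rightarrow> 'a \<Rightarrow> 'a identity" where
  "sigma_1 x y t\<^sub>1 t\<^sub>2 = ([x, y, t\<^sub>1, x, t\<^sub>2, y], [y, x, t\<^sub>1, x, t\<^sub>2, y])"

definition sigma_mu :: "'a \<Rightarrow> 'a \<Rightarrow> 'a \<Rightarrow> 'a \<Rightarrow> 'a identity" where
  "sigma_mu x y t\<^sub>1 t\<^sub>2 = ([x, t\<^sub>1, x, y, t\<^sub>2, y], [x, t\<^sub>1, y, x, t\<^sub>2, y])"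

definition sigma_2 :: "'a \<Rightarrow> 'a \<Rightarrow> 'a \<Rightarrow> 'a \<Rightarrow> 'a identity" where
  "sigma_2 x y t\<^sub>1 t\<^sub>2 = ([x, t\<^sub>1, y, t\<^sub>2, x, y], [x, t\<^sub>1, y, t\<^sub>2, y, x])"

end

theory Submission
  imports Defs "HOL-Library.Infinite_Set"
begin

text \<open>
  The hard implication is that every equational theory \<open>E\<close> containing \<open>\<sigma>\<^sub>1\<close> and \<open>\<sigma>\<^sub>\<mu>\<close> is finitely
  based; the case of \<open>\<sigma>\<^sub>2\<close> is its mirror image. Modulo \<open>\<sigma>\<^sub>1\<close> and \<open>\<sigma>\<^sub>\<mu>\<close> a word is determined by the
  order of the last occurrences of its letters and by the number of occurrences of each letter between
  consecutive linear letters. Hence, unless \<open>E\<close> contains \<open>x y \<approx> y x\<close> or some \<open>x \<approx> x\<^sup>k\<close>, it is generated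
  by identities with a single non-linear letter together with identities that swap two adjacent last
  occurrences. Higman's lemma bounds both families: the swaps that hold form an up-closed set, and for
  the former the exponent sequences that are not lexicographically least in their class do.

  Conversely, \<open>S({x t\<^sub>1 x y t\<^sub>2 y})\<close> and \<open>S({x y t\<^sub>1 x t\<^sub>2 y, x t\<^sub>1 y t\<^sub>2 x y})\<close> are not finitely based: there
  are words \<open>U\<^sub>n\<close> to which a nontrivial identity applies, although every word in fewer than \<open>n\<close> letters
  with an image inside \<open>U\<^sub>n\<close> is an isoterm. If both conditions of (IV) fail, the offending adjacent
  pairs of \<open>W\<close> make one of these two sets consist of isoterms.
\<close>


section \<open>Words and substitutions\<close>

text \<open>Deleting letters is a substitution, so every identity can be restricted to any set of
  letters; both halves rest on this. In the first half the obstacle is the way back: an identity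
  between restrictions to \<open>X\<close> and the linear letters can be applied to a whole word
  only if the letters of \<open>X\<close> in each block can be brought together without disturbing
  the order of last occurrences. This works when they are consecutive in that order, so the repairs
  concern one letter, or two neighbouring last occurrences, at a time. The two exceptional laws are
  those under which the two sides of an identity need not have the same linear letters in the same
  order: under \<open>x \<approx> x^k\<close> all letters are made non-linear, and under
  commutativity the letters separate. In the second half, identities in fewer than \<open>n\<close>
  letters must leave \<open>U_n\<close> fixed. A non-linear letter of a preimage can only stand for
  a single letter, because no two-letter factor occurs twice in \<open>U_n\<close>; hence a gap of
  \<open>n\<close> different letters forces a linear letter in the preimage.\<close>

abbreviation res :: "'a set \<Rightarrow> 'a list \<Rightarrow> 'a list" where
  "res A u \<equiv> filter (\<lambda>c. c \<in> A) u"

lemma subst_word_simps [simp]: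
  "subst_word \<theta> [] = []"
  "subst_word \<theta> (a # u) = \<theta> a @ subst_word \<theta> u"
  "subst_word \<theta> (u @ v) = subst_word \<theta> u @ subst_word \<theta> v"
  by (simp_all add: subst_word_def)

lemma subst_word_cong:
  "(\<And>a. a \<in> set u \<Longrightarrow> \<theta> a = \<theta>' a) \<Longrightarrow> subst_word \<theta> u = subst_word \<theta>' u"
  by (induction u) auto

lemma subst_word_id: "(\<And>a. a \<in> set u \<Longrightarrow> \<theta> a = [a]) \<Longrightarrow> subst_word \<theta> u = u"
  by (induction u) auto

lemma subst_word_comp:
  "subst_word \<theta> (subst_word \<theta>' u) = subst_word (\<lambda>a. subst_word \<theta> (\<theta>' a)) u"
  by (induction u) auto

lemma set_subst_word: "set (subst_word \<theta> u) = (\<Union>a\<in>set u. set (\<theta> a))"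
  by (induction u) auto

lemma rev_subst_word: "rev (subst_word \<theta> u) = subst_word (\<lambda>a. rev (\<theta> a)) (rev u)"
  by (induction u) auto

text \<open>Letters may be replaced by the empty word, since all identities are monoid identities.
  This is why every theory is closed under restriction (\<open>res_mem\<close>).\<close>

lemma res_eq_subst: "res A u = subst_word (\<lambda>a. if a \<in> A then [a] else []) u"
  by (induction u) auto

lemma res_res: "res A (res B u) = res (A \<inter> B) u"
  by (simp add: conj_commute)

lemma res_eq_mono:
  assumes "res B u = res B v" "A \<subseteq> B" shows "res A u = res A v"
proof -
  have "res A w = res A (res B w)" for w
    using assms(2) by (induction w) auto
  then show ?thesis
    using assms(1) by metis
qed

lemma count_list_res: "a \<in> A \<Longrightarrow> count_list (res A u) a = count_list u a"
  by (induction u) auto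

lemma res_id: "set u \<subseteq> A \<Longrightarrow> res A u = u"
  by (induction u) auto

lemma remdups_res: "remdups (res A u) = res A (remdups u)"
  by (simp add: remdups_filter)


section \<open>Order of letters in a list\<close>

text \<open>\<open>subseq [a, b] ys\<close> serves as the relation "some \<open>a\<close> stands
  before some \<open>b\<close>"; on lists without repetitions it is a strict linear order, as the
  next lemmas show.\<close>

lemma subseq_pair_Cons:
  "subseq [a, b] (c # ys) \<longleftrightarrow> a = c \<and> b \<in> set ys \<or> subseq [a, b] ys"
proof -
  have "b \<in> set ys" if "subseq [a, b] ys"
    using list_emb_set[OF that, of b] by auto
  then show ?thesis
    by (auto simp: subseq_singleton_left split: if_splits)
qed

lemma subseq_pair_filter:
  "a \<in> A \<Longrightarrow> b \<in> A \<Longrightarrow> subseq [a, b] (res A ys) \<longleftrightarrow> subseq [a, b] ys"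
  by (induction ys) (auto simp: subseq_pair_Cons simp del: subseq_Cons2_iff)

lemma subseq_pair_set: "subseq [a, b] ys \<Longrightarrow> a \<in> set ys \<and> b \<in> set ys"
  by (induction ys) (auto simp: subseq_pair_Cons simp del: subseq_Cons2_iff)

lemma subseq_pair_total:
  "a \<in> set ys \<Longrightarrow> b \<in> set ys \<Longrightarrow> a \<noteq> b \<Longrightarrow> subseq [a, b] ys \<or> subseq [b, a] ys"
  by (induction ys) (auto simp: subseq_pair_Cons simp del: subseq_Cons2_iff)

lemma subseq_pair_antisym: "distinct ys \<Longrightarrow> subseq [a, b] ys \<Longrightarrow> \<not> subseq [b, a] ys"
  by (induction ys) (auto simp: subseq_pair_Cons simp del: subseq_Cons2_iff dest: subseq_pair_set)

lemma subseq_pair_trans: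
  "distinct ys \<Longrightarrow> subseq [a, b] ys \<Longrightarrow> subseq [b, c] ys \<Longrightarrow> subseq [a, c] ys"
  by (induction ys) (auto simp: subseq_pair_Cons simp del: subseq_Cons2_iff dest: subseq_pair_set)

lemma subseq_pair_append:
  "subseq [a, b] (ys @ zs) \<longleftrightarrow>
     subseq [a, b] ys \<or> subseq [a, b] zs \<or> a \<in> set ys \<and> b \<in> set zs"
  by (induction ys) (auto simp: subseq_pair_Cons simp del: subseq_Cons2_iff dest: subseq_pair_set)

lemma sorted_wrt_pairs_unique:
  "distinct xs \<Longrightarrow> distinct ys \<Longrightarrow> set xs = set ys \<Longrightarrow>
    sorted_wrt (\<lambda>a b. subseq [a, b] ys) xs \<Longrightarrow> xs = ys"
proof (induction ys arbitrary: xs)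
  case (Cons y ys)
  then obtain x xs' where xs: "xs = x # xs'"
    by (cases xs) auto
  have "x = y"
  proof (rule ccontr)
    assume "x \<noteq> y"
    then have "y \<in> set xs'"
      using Cons.prems xs by auto
    then have "subseq [x, y] (y # ys)"
      using Cons.prems xs by auto
    then show False
      using \<open>x \<noteq> y\<close> Cons.prems(2) by (auto simp: subseq_pair_Cons simp del: subseq_Cons2_iff dest: subseq_pair_set)
  qed
  have y: "y \<notin> set xs'" using Cons.prems(1) xs \<open>x = y\<close> by simp
  have "sorted_wrt (\<lambda>a b. subseq [a, b] ys) xs'"
    using Cons.prems(4) y unfolding xs
    by (auto intro: sorted_wrt_mono_rel[rotated] simp: subseq_pair_Cons simp del: subseq_Cons2_iff)
  moreover have "set xs' = set ys"
    using Cons.prems xs \<open>x = y\<close> y by (metis distinct.simps(2) insert_ident list.simps(15))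
  ultimately show ?case
    using Cons xs \<open>x = y\<close> by simp
qed simp

text \<open>By transitivity in \<open>ys\<close>, agreement on neighbours of \<open>xs\<close>
  spreads to all pairs. It is applied to lists of last occurrences and, in
  \<open>rigid_local\<close>, to lists of numbered occurrences.\<close>

lemma distinct_eqI_adjacent:
  assumes "distinct xs" "distinct ys" "set xs = set ys"
    and "\<And>p a b s. xs = p @ a # b # s \<Longrightarrow> subseq [a, b] ys"
  shows "xs = ys"
proof (rule sorted_wrt_pairs_unique[OF assms(1-3)])
  have "successively (\<lambda>a b. subseq [a, b] ys) xs"
    using assms(4)
  proof (induction xs)
    case (Cons x xs)
    have "successively (\<lambda>a b. subseq [a, b] ys) xs"
      using Cons.prems[of "x # _"] by (intro Cons.IH) simp
    then show ?case
      using Cons.prems[of "[]"] by (cases xs) auto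
  qed simp
  moreover have "transp (\<lambda>a b. subseq [a, b] ys)"
    using subseq_pair_trans[OF assms(2)] by (auto simp: transp_def)
  ultimately show "sorted_wrt (\<lambda>a b. subseq [a, b] ys) xs"
    by (simp add: successively_conv_sorted_wrt)
qed


section \<open>Equational theories\<close>

text \<open>The fully invariant congruences of the free monoid.\<close>

locale eq_theory =
  fixes E :: "'a identity set"
  assumes refl_mem: "(u, u) \<in> E"
    and sym_mem: "(u, v) \<in> E \<Longrightarrow> (v, u) \<in> E"
    and trans_mem [trans]: "(u, v) \<in> E \<Longrightarrow> (v, w) \<in> E \<Longrightarrow> (u, w) \<in> E"
    and append_mem: "(u, v) \<in> E \<Longrightarrow> (u', v') \<in> E \<Longrightarrow> (u @ u', v @ v') \<in> E"
    and subst_mem: "(u, v) \<in> E \<Longrightarrow> (subst_word \<theta> u, subst_word \<theta> v) \<in> E"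
begin

lemma context_mem: "(u, v) \<in> E \<Longrightarrow> (p @ u @ s, p @ v @ s) \<in> E"
  using append_mem refl_mem by blast

lemma res_mem: "(u, v) \<in> E \<Longrightarrow> (res A u, res A v) \<in> E"
  unfolding res_eq_subst by (rule subst_mem)

lemma subst_mem_pointwise:
  "(\<And>a. a \<in> set u \<Longrightarrow> (\<theta> a, \<theta>' a) \<in> E) \<Longrightarrow> (subst_word \<theta> u, subst_word \<theta>' u) \<in> E"
  by (induction u) (auto intro: refl_mem append_mem)

end

lemma eq_theory_deducible: "eq_theory {(u, v). deducible \<Sigma> u v}"
proof -
  have ctx: "deducible \<Sigma> (p @ u @ s) (p @ v @ s)" if "deducible \<Sigma> u v" for u v p s
    using that
  proof induction
    case (step u v p' \<theta> s')
    then show ?case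
      using deducible.step[of u v \<Sigma> "p @ p'" \<theta> "s' @ s"] by simp
  qed (blast intro: deducible.intros)+
  show ?thesis
  proof
    fix u v u' v' assume "(u, v) \<in> {(u, v). deducible \<Sigma> u v}" "(u', v') \<in> {(u, v). deducible \<Sigma> u v}"
    then show "(u @ u', v @ v') \<in> {(u, v). deducible \<Sigma> u v}"
      using ctx[of u v "[]" u'] ctx[of u' v' v "[]"] by (auto intro: deducible.trans)
  next
    fix u v and \<theta> :: "'a \<Rightarrow> 'a list"
    assume "(u, v) \<in> {(u, v). deducible \<Sigma> u v}"
    then have "deducible \<Sigma> u v" by simp
    then have "deducible \<Sigma> (subst_word \<theta> u) (subst_word \<theta> v)"
    proof induction
      case (step u v p \<theta>' s)
      then show ?case
        using deducible.step[of u v \<Sigma> "subst_word \<theta> p" "\<lambda>a. subst_word \<theta> (\<theta>' a)" "subst_word \<theta> s"]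
        by (simp add: subst_word_comp)
    qed (blast intro: deducible.intros)+
    then show "(subst_word \<theta> u, subst_word \<theta> v) \<in> {(u, v). deducible \<Sigma> u v}"
      by simp
  qed (auto intro: deducible.intros)
qed

lemma (in eq_theory) deducible_imp_mem:
  assumes "deducible \<Sigma> u v" "\<Sigma> \<subseteq> E" shows "(u, v) \<in> E"
  using assms(1)
  by induction (use assms(2) in \<open>auto intro: refl_mem sym_mem trans_mem context_mem subst_mem\<close>)

lemma deducible_mem: "(u, v) \<in> \<Sigma> \<Longrightarrow> deducible \<Sigma> u v"
  using deducible.step[of u v \<Sigma> "[]" "\<lambda>a. [a]" "[]"] by (simp add: subst_word_id)

lemma eq_theory_rev:
  assumes "eq_theory E" shows "eq_theory {(u, v). (rev u, rev v) \<in> E}"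
proof -
  interpret eq_theory E by fact
  show ?thesis
    by standard (auto simp: rev_subst_word intro: refl_mem sym_mem trans_mem append_mem subst_mem)
qed

lemma deducible_rev:
  assumes "deducible \<Sigma> u v" "\<Sigma>' = (\<lambda>(u, v). (rev u, rev v)) ` \<Sigma>"
  shows "deducible \<Sigma>' (rev u) (rev v)"
  using assms(1)
proof induction
  case (step u v p \<theta> s)
  then have "(rev u, rev v) \<in> \<Sigma>'"
    using assms(2) by force
  from deducible.step[OF this, of "rev s" "\<lambda>a. rev (\<theta> a)" "rev p"] show ?case
    by (simp add: rev_subst_word)
qed (blast intro: deducible.intros)+


section \<open>Equational theories of monoids\<close>

context monoid
begin

lemma word_val_closed: "(\<And>a. \<phi> a \<in> carrier G) \<Longrightarrow> word_val G \<phi> w \<in> carrier G"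
  by (induction w) (auto simp: word_val_def)

lemma word_val_append:
  "(\<And>a. \<phi> a \<in> carrier G) \<Longrightarrow> word_val G \<phi> (u @ v) = word_val G \<phi> u \<otimes> word_val G \<phi> v"
  using word_val_closed[of \<phi>] by (induction u) (auto simp: word_val_def m_assoc)

lemma word_val_subst_word:
  "(\<And>a. \<phi> a \<in> carrier G) \<Longrightarrow>
    word_val G \<phi> (subst_word \<theta> w) = word_val G (\<lambda>a. word_val G \<phi> (\<theta> a)) w"
  by (induction w) (simp_all add: word_val_append, simp_all add: word_val_def)

lemma eq_theory_satisfies: "eq_theory {e. satisfies G e}"
  by standard
    (auto simp: satisfies_def word_val_append word_val_subst_word word_val_closed)

end

lemma eq_theory_identities:
  fixes K :: "('b, 'c) monoid_scheme set"
  assumes "\<And>M. M \<in> K \<Longrightarrow> monoid M"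
  shows "eq_theory (identities K :: 'a identity set)"
proof -
  have E: "eq_theory {e :: 'a identity. satisfies M e}" if "M \<in> K" for M
    using that assms monoid.eq_theory_satisfies by blast
  show ?thesis
    unfolding identities_def
    by standard
      (auto intro: eq_theory.refl_mem[OF E, simplified] eq_theory.sym_mem[OF E, simplified]
        eq_theory.trans_mem[OF E, simplified] eq_theory.append_mem[OF E, simplified]
        eq_theory.subst_mem[OF E, simplified])
qed

section \<open>Last occurrences and block substitutions\<close>

lemma remdups_append_subset: "set P \<subseteq> set Z \<Longrightarrow> remdups (P @ Z) = remdups Z"
  by (induction P) auto

lemma remdups_insert_mem: "a \<in> set Z \<Longrightarrow> remdups (P @ a # Z) = remdups (P @ Z)"
  by (induction P) auto

text \<open>\<open>remdups\<close> keeps last occurrences. If some letter of \<open>P\<close> were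
  absent from \<open>Z\<close>, the first surviving entry would come from \<open>P\<close>, whereas
  \<open>b\<close> does not.\<close>

lemma remdups_append_hd: "remdups (P @ Z) = b # R \<Longrightarrow> b \<notin> set P \<Longrightarrow> set P \<subseteq> set Z"
  by (induction P) (auto split: if_splits)

text \<open>These substitutions undo a restriction: each linear letter gets back letters outside
  \<open>X \<union> L\<close> that stood around it. On words over \<open>X \<union> L\<close>, the
  map \<open>res (X \<union> L)\<close> inverts them.\<close>

definition block_subst :: "'a set \<Rightarrow> 'a set \<Rightarrow> ('a \<Rightarrow> 'a list) \<Rightarrow> bool" where
  "block_subst X L \<theta> \<longleftrightarrow>
     (\<forall>a\<in>X. \<theta> a = [a]) \<and> (\<forall>t\<in>L. res (X \<union> L) (\<theta> t) = [t])"

lemma block_subst_upd: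
  "block_subst X L \<theta> \<Longrightarrow> b \<notin> X \<Longrightarrow> res (X \<union> L) w = [b] \<Longrightarrow> block_subst X L (\<theta>(b := w))"
  by (auto simp: block_subst_def)

lemma subst_word_upd: "b \<notin> set u \<Longrightarrow> subst_word (\<theta>(b := w)) u = subst_word \<theta> u"
  by (intro subst_word_cong) auto

lemma block_substD: "block_subst X L \<theta> \<Longrightarrow> a \<in> X \<Longrightarrow> \<theta> a = [a]"
  by (simp add: block_subst_def)

section \<open>Canonical forms modulo \<open>\<sigma>\<^sub>1\<close> and \<open>\<sigma>\<^sub>\<mu>\<close>\<close>

text \<open>Instantiated twice later on: with the given theory, and with the set of consequences of
  its finite basis.\<close>

locale sigma_theory = eq_theory D for D :: "'a identity set" +
  fixes a0 b0 c0 d0 :: 'a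
  assumes dist: "distinct [a0, b0, c0, d0]"
    and sigma_1_mem: "sigma_1 a0 b0 c0 d0 \<in> D"
    and sigma_mu_mem: "sigma_mu a0 b0 c0 d0 \<in> D"
begin

text \<open>\<open>sigma_1\<close> serves if both letters recur on the right,
  \<open>sigma_mu\<close> if one has occurred on the left and the other recurs on the right; the
  linear letters absorb whatever stands between. Among letters that occur at least twice, the only
  exchange not covered is that of two last occurrences.\<close>

lemma swap:
  assumes "x \<in> set s \<and> y \<in> set s \<or> x \<in> set p \<and> y \<in> set s \<or> y \<in> set p \<and> x \<in> set s"
  shows "(p @ [x, y] @ s, p @ [y, x] @ s) \<in> D"
proof -
  have 1: "(q @ [x, y] @ r @ [x] @ r' @ [y] @ r'', q @ [y, x] @ r @ [x] @ r' @ [y] @ r'') \<in> D"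
    for x y and q r r' r'' :: "'a list"
    using context_mem[OF subst_mem[OF sigma_1_mem[unfolded sigma_1_def],
      of "(\<lambda>_. [])(a0 := [x], b0 := [y], c0 := r, d0 := r')"], of q r''] dist
    by (simp add: fun_upd_def eq_commute)
  have mu: "(q @ [x] @ r @ [x, y] @ r' @ [y] @ r'', q @ [x] @ r @ [y, x] @ r' @ [y] @ r'') \<in> D"
    for x y and q r r' r'' :: "'a list"
    using context_mem[OF subst_mem[OF sigma_mu_mem[unfolded sigma_mu_def],
      of "(\<lambda>_. [])(a0 := [x], b0 := [y], c0 := r, d0 := r')"], of q r''] dist
    by (simp add: fun_upd_def eq_commute)
  consider "x = y" | "x \<noteq> y" "x \<in> set s" "y \<in> set s" | "x \<in> set p" "y \<in> set s"
    | "y \<in> set p" "x \<in> set s"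
    using assms by blast
  then show ?thesis
  proof cases
    case 1
    then show ?thesis by (simp add: refl_mem)
  next
    case 2
    then obtain s1 s2 where s: "s = s1 @ x # s2"
      by (meson split_list)
    show ?thesis
    proof (cases "y \<in> set s2")
      case True
      then obtain s3 s4 where "s2 = s3 @ y # s4"
        by (meson split_list)
      then show ?thesis
        using 1[of p x y s1 s3 s4] s by simp
    next
      case False
      then obtain s3 s4 where "s1 = s3 @ y # s4"
        using 2 s by (metis UnE set_ConsD set_append split_list)
      then show ?thesis
        using sym_mem[OF 1[of p y x s3 s4 s2]] s by simp
    qed
  next
    case 3
    then obtain s1 s2 p1 p2 where "s = s1 @ y # s2" "p = p1 @ x # p2"
      by (meson split_list)
    then show ?thesis
      using mu[of p1 x p2 y s1 s2] by simp
  next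
    case 4
    then obtain s1 s2 p1 p2 where "s = s1 @ x # s2" "p = p1 @ y # p2"
      by (meson split_list)
    then show ?thesis
      using sym_mem[OF mu[of p1 y p2 x s1 s2]] by simp
  qed
qed

text \<open>Each transposition is an instance of \<open>swap\<close>. If this \<open>a\<close> is
  not the last one, it can pass every letter that occurs twice; if it is only known to have an
  earlier occurrence, it can pass letters that recur on the right.\<close>

lemma move_left:
  assumes "a \<notin> set v1"
    and "a \<in> set v2 \<and> (\<forall>b\<in>set v1. 2 \<le> count_list (p @ v1 @ v2) b) \<or>
      a \<in> set p \<and> set v1 \<subseteq> set v2"
  shows "(p @ v1 @ a # v2, p @ a # v1 @ v2) \<in> D"
  using assms
proof (induction v1 arbitrary: v2 rule: rev_induct)
  case (snoc b v1)
  have "b \<in> set v2 \<or> b \<in> set (p @ v1)" if "2 \<le> count_list (p @ (v1 @ [b]) @ v2) b"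
  proof (rule ccontr)
    assume "\<not> ?thesis"
    then have "count_list (p @ (v1 @ [b]) @ v2) b = 1"
      by (simp add: count_list_0_iff)
    then show False using that by simp
  qed
  then have "((p @ v1) @ [b, a] @ v2, (p @ v1) @ [a, b] @ v2) \<in> D"
    using snoc.prems by (intro swap) auto
  then have "(p @ (v1 @ [b]) @ a # v2, p @ v1 @ a # (b # v2)) \<in> D"
    by simp
  also have "(p @ v1 @ a # (b # v2), p @ a # v1 @ (b # v2)) \<in> D"
    by (rule snoc.IH) (use snoc.prems in auto)
  finally show ?case
    by simp
qed (simp add: refl_mem)

text \<open>
  Modulo \<open>\<sigma>\<^sub>1\<close> and \<open>\<sigma>\<^sub>\<mu>\<close> the non-last occurrences move freely between linear letters, so a word is
  determined by the order of its last occurrences, which is what \<open>remdups\<close> keeps, and by the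
  distribution of each letter between the linear ones.
\<close>

lemma canonical_form:
  assumes "\<And>b. b \<in> set u \<Longrightarrow> b \<notin> L \<Longrightarrow> 2 \<le> count_list (p @ u) b"
    and "remdups u = remdups v"
    and "\<And>x. res (insert x L) u = res (insert x L) v"
  shows "(p @ u, p @ v) \<in> D"
  using assms
\<comment> \<open>The first letter of \<open>u\<close> is found at its first occurrence in
  \<open>v\<close> and carried to the front. It then joins the prefix \<open>p\<close>, which
  preserves the counts of the non-linear letters.\<close>
proof (induction u arbitrary: p v)
  case (Cons a u)
  note res_eq = Cons.prems(3)
  have setv: "set v = set (a # u)"
    using Cons.prems(2) by (metis set_remdups)
  have cnt: "count_list v b = count_list (a # u) b" for b
    using count_list_res[of b "insert b L" v] count_list_res[of b "insert b L" "a # u"] res_eq[of b]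
    by simp
  have IH: "((p @ [a]) @ u, (p @ [a]) @ w) \<in> D"
    if "v = v1 @ a # v2" "w = v1 @ v2" "a \<notin> set v1" "set v1 \<inter> L = {}"
      "remdups u = remdups w" for w v1 v2
  proof (rule Cons.IH)
    show "2 \<le> count_list ((p @ [a]) @ u) b" if "b \<in> set u" "b \<notin> L" for b
      using Cons.prems(1)[of b] that by simp
    show "res (insert x L) u = res (insert x L) w" for x
    proof -
      have e: "res (insert x L) (a # u) = res (insert x L) (v1 @ a # v2)"
        using res_eq[of x] that by simp
      show ?thesis
      proof (cases "a \<in> insert x L")
        case True
        have "res (insert x L) v1 = []"
        proof (cases "a = x")
          case True
          then show ?thesis using that by (auto simp: filter_empty_conv)
        next
          case False
          then have "a \<in> L" using True by simp
          show ?thesis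
          proof (cases "res (insert x L) v1")
            case (Cons c cs)
            then have "c = a" "c \<in> set v1"
              using e True by (auto dest: filter_eq_ConsD)
            then show ?thesis using that by simp
          qed
        qed
        then show ?thesis using e True that by simp
      next
        case False
        then show ?thesis using e that by simp
      qed
    qed
    show "remdups u = remdups w" by fact
  qed
  have noL: "set v1 \<inter> L = {}" if "v = v1 @ a # v2" "a \<notin> set v1" for v1 v2
  proof (rule ccontr)
    assume "\<not> ?thesis"
    then obtain b where b: "b \<in> set v1" "b \<in> L" by blast
    have "res (insert a L) (a # u) = res (insert a L) (v1 @ a # v2)"
      using res_eq[of a] that by simp
    moreover obtain c cs where c: "res (insert a L) v1 = c # cs"
      using b by (cases "res (insert a L) v1") (auto simp: filter_empty_conv)
    moreover from c have "c \<in> set v1" by (auto dest: filter_eq_ConsD)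
    ultimately show False using that by simp
  qed
  obtain v1 v2 where v: "v = v1 @ a # v2" "a \<notin> set v1"
    using setv split_list_first[of a v] by auto
  note L = noL[OF v]
  have cnt_a: "count_list v2 a = count_list u a"
    using cnt[of a] v by (simp add: count_list_0_iff[THEN iffD2])
  \<comment> \<open>Either nothing has to move; or \<open>a\<close> is not a last occurrence; or it
    is one and heads \<open>remdups v\<close>, so that every letter of \<open>v1\<close> recurs in
    \<open>v2\<close>. The fourth case is contradictory: the restriction to the first letter of
    \<open>v1\<close> and \<open>L\<close> would begin with two different letters.\<close>
  consider "a \<in> L" "v1 = []" | "a \<in> set u" | "a \<notin> L" "a \<notin> set u" | "a \<in> L" "v1 \<noteq> []" "a \<notin> set u"
    by blast
  then show ?case
  proof cases
    case 1
    have "(a \<in> set u) = (a \<in> set v2)"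
      using cnt_a by (metis count_list_0_iff)
    then have "remdups u = remdups v2"
      using Cons.prems(2) v 1 by (auto split: if_splits)
    then show ?thesis using IH[OF v(1) _ v(2) L] 1 v by simp
  next
    case 2
    then have a: "a \<in> set v2"
      using cnt_a by (metis count_list_0_iff)
    have "(p @ v1 @ a # v2, p @ a # v1 @ v2) \<in> D"
    proof (rule move_left[OF v(2)], rule disjI1, intro conjI ballI a)
      fix b assume b: "b \<in> set v1"
      then have "b \<noteq> a" using v by auto
      have "b \<in> set (a # u)" "b \<notin> L" using b v L setv by auto
      then have "2 \<le> count_list (p @ a # u) b" using Cons.prems(1) by blast
      then have "2 \<le> count_list (p @ v) b" using cnt[of b] by (metis count_list_append)
      then show "2 \<le> count_list (p @ v1 @ v2) b" using \<open>b \<noteq> a\<close> v by simp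
    qed
    moreover have "remdups u = remdups (v1 @ v2)"
      using Cons.prems(2) v 2 a by (simp add: remdups_insert_mem)
    ultimately show ?thesis
      using IH[OF v(1) HOL.refl v(2) L] v by simp (meson sym_mem trans_mem)
  next
    case 3
    then have a: "a \<notin> set v2" "a \<in> set p"
      using cnt_a Cons.prems(1)[of a] by (auto simp: count_list_0_iff[symmetric])
        (metis One_nat_def Suc_n_not_le_n add_0 count_list_0_iff numeral_2_eq_2)
    have r: "remdups (v1 @ (a # v2)) = a # remdups u"
      using Cons.prems(2) v 3 by simp
    then have "set v1 \<subseteq> set v2"
      using remdups_append_hd[OF r v(2)] v(2) by auto
    then have "(p @ v1 @ a # v2, p @ a # v1 @ v2) \<in> D"
      using a by (intro move_left[OF v(2)]) blast
    moreover have "remdups u = remdups (v1 @ v2)"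
      using r \<open>set v1 \<subseteq> set v2\<close> a by (simp add: remdups_append_subset subset_insertI2)
    ultimately show ?thesis
      using IH[OF v(1) HOL.refl v(2) L] v by simp (meson sym_mem trans_mem)
  next
    case 4
    then obtain c cs where v1: "v1 = c # cs" by (cases v1) auto
    have "res (insert c L) (a # u) = res (insert c L) (v1 @ a # v2)"
      using res_eq[of c] v by simp
    then show ?thesis
      using 4 v1 v by simp
  qed
qed (simp add: refl_mem)

text \<open>If no letter of \<open>X\<close> is present, each block can be attached to the linear
  letter that closes it; the letters after the last linear letter form \<open>S\<close>. As
  \<open>res L u\<close> is distinct, each linear letter receives only one block.\<close>

lemma gather_none:
  assumes "distinct (res L u)" "X \<inter> L = {}" "X \<inter> set u = {}"
  shows "\<exists>\<theta> S. set S \<inter> (X \<union> L) = {} \<and> block_subst X L \<theta> \<and>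
     subst_word \<theta> (res (X \<union> L) u) @ S = u"
  using assms
proof (induction u rule: rev_induct)
  case Nil
  show ?case by (intro exI[of _ "\<lambda>a. [a]"] exI[of _ "[]"]) (simp add: block_subst_def)
next
  case (snoc b u)
  have du: "distinct (res L u)" "X \<inter> set u = {}" using snoc.prems by auto
  from snoc.IH[OF this(1) snoc.prems(2) this(2)]
  obtain \<theta> S where *: "set S \<inter> (X \<union> L) = {}" "block_subst X L \<theta>"
    "subst_word \<theta> (res (X \<union> L) u) @ S = u"
    by blast
  show ?case
  proof (cases "b \<in> L")
    case False
    then show ?thesis
      using * snoc.prems by (intro exI[of _ \<theta>] exI[of _ "S @ [b]"]) auto
  next
    case True
    then have b: "b \<notin> set u" "b \<notin> X" using snoc.prems by auto
    have "res (X \<union> L) S = []" using *(1) by (auto simp: filter_empty_conv)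
    then have "block_subst X L (\<theta>(b := S @ [b]))"
      using True b by (intro block_subst_upd[OF *(2)]) auto
    moreover have "subst_word (\<theta>(b := S @ [b])) (res (X \<union> L) (u @ [b])) @ [] = u @ [b]"
      using *(3) b True by (simp add: subst_word_upd)
    moreover have "set [] \<inter> (X \<union> L) = {}"
      by simp
    ultimately show ?thesis
      by blast
  qed
qed

text \<open>Collects all letters of \<open>X\<close> lying in the same block, so that an identity between words
  over \<open>X\<close> and the linear letters can be applied to \<open>u\<close>.\<close>

lemma gather:
  assumes "distinct (res L u)" "X \<inter> L = {}"
    and "remdups u = R1 @ xs @ R2" "set xs \<subseteq> X" "X \<inter> set R1 = {}" "X \<inter> set R2 = {}"
  shows "\<exists>P \<theta> S. set P \<inter> (X \<union> L) = {} \<and> set S \<inter> (X \<union> L) = {} \<and> block_subst X L \<theta> \<and>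
    res (-X) (P @ subst_word \<theta> (res (X \<union> L) u) @ S) = res (-X) u \<and>
    remdups (P @ subst_word \<theta> (res (X \<union> L) u) @ S) = remdups u"
  using assms
proof (induction u arbitrary: R1 xs)
  case Nil
  show ?case
    by (intro exI[of _ "[]"] exI[of _ "\<lambda>a. [a]"]) (simp add: block_subst_def)
next
  case (Cons a u)
  have n0: "set [] \<inter> (X \<union> L) = {}" by simp
  show ?case
  proof (cases "X \<inter> set (a # u) = {}")
    case True
    from gather_none[OF Cons.prems(1,2) this]
    obtain \<theta> S where *: "set S \<inter> (X \<union> L) = {}" "block_subst X L \<theta>"
        "subst_word \<theta> (res (X \<union> L) (a # u)) @ S = a # u"
      by blast
    show ?thesis
      by (intro exI conjI, rule n0, rule *(1), rule *(2), unfold append_Nil *(3), rule HOL.refl, rule HOL.refl)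
  next
    case ne: False
    have set_u: "set (a # u) = set R1 \<union> set xs \<union> set R2"
      using Cons.prems(3) by (metis set_append set_remdups sup_assoc)
    then have xs: "xs \<noteq> []"
      using ne Cons.prems by auto
    have du: "distinct (res L u)" using Cons.prems(1) by (auto split: if_splits)
    show ?thesis
    \<comment> \<open>A letter of \<open>X\<close> passes the collected prefix \<open>P\<close>.
      Only at a last occurrence could this alter \<open>remdups\<close>. If another entry of
      \<open>xs\<close> follows, it is the head of the remaining order and not in \<open>P\<close>,
      so all letters of \<open>P\<close> recur in \<open>Z\<close>. Otherwise no letter of
      \<open>X\<close> is left and \<open>gather_none\<close> applies with an empty prefix.\<close>
    proof (cases "a \<in> X \<and> a \<notin> set u")
      case True
      then have R1: "R1 = []"
        using Cons.prems by (cases R1) auto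
      then obtain ys where ys: "xs = a # ys" "remdups u = ys @ R2"
        using Cons.prems(3) True xs by (cases xs) auto
      have aL: "a \<in> X" "a \<notin> L" "a \<notin> set u" using True Cons.prems(2) by auto
      show ?thesis
      proof (cases ys)
        case Nil
        then have "X \<inter> set u = {}" using ys Cons.prems(6) by (metis append_Nil set_remdups)
        from gather_none[OF du Cons.prems(2) this]
        obtain \<theta> S where *: "set S \<inter> (X \<union> L) = {}" "block_subst X L \<theta>"
            "subst_word \<theta> (res (X \<union> L) u) @ S = u"
          by blast
        have e: "subst_word \<theta> (res (X \<union> L) (a # u)) @ S = a # u"
          using aL *(3) block_substD[OF *(2)] by simp
        show ?thesis
          by (intro exI conjI, rule n0, rule *(1), rule *(2), unfold append_Nil e, rule HOL.refl, rule HOL.refl)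
      next
        case (Cons b zs)
        from Cons.IH[of "[]" ys, OF du Cons.prems(2)] ys Cons.prems(4,6)
        obtain P \<theta> S where *: "set P \<inter> (X \<union> L) = {}" "set S \<inter> (X \<union> L) = {}"
            "block_subst X L \<theta>"
            and r1: "res (-X) (P @ subst_word \<theta> (res (X \<union> L) u) @ S) = res (-X) u"
            and r2: "remdups (P @ subst_word \<theta> (res (X \<union> L) u) @ S) = remdups u"
          by auto
        define Z where "Z = subst_word \<theta> (res (X \<union> L) u) @ S"
        have Z: "subst_word \<theta> (res (X \<union> L) (a # u)) @ S = a # Z"
          using aL block_substD[OF *(3)] by (simp add: Z_def)
        have r1: "res (-X) (P @ Z) = res (-X) u" and r2: "remdups (P @ Z) = remdups u"
          using r1 r2 by (simp_all only: Z_def)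
        have "remdups (P @ Z) = b # zs @ R2" using r2 ys Cons by simp
        moreover have "b \<in> X" using Cons ys Cons.prems(4) by simp
        then have "b \<notin> set P" using *(1) by blast
        ultimately have PZ: "set P \<subseteq> set Z" by (rule remdups_append_hd)
        have "set (P @ Z) = set u" using r2 by (metis set_remdups)
        then have "a \<notin> set Z" using aL(3) by auto
        moreover have "set P \<subseteq> set (a # Z)" using PZ by auto
        ultimately have "remdups (P @ a # Z) = a # remdups u"
          using r2 remdups_append_subset[OF PZ] remdups_append_subset[of P "a # Z"] by simp
        then have n2: "remdups (P @ a # Z) = remdups (a # u)" using aL(3) by simp
        have n1: "res (-X) (P @ a # Z) = res (-X) (a # u)" using r1 aL by simp
        show ?thesis
          by (intro exI conjI, rule *(1), rule *(2), rule *(3), unfold Z, rule n1, rule n2)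
      qed
    next
      case False
      have "\<exists>R1'. remdups u = R1' @ xs @ R2 \<and> X \<inter> set R1' = {}"
      proof (cases "a \<in> set u")
        case True
        then show ?thesis using Cons.prems(3,5) by auto
      next
        case a: False
        then have "a \<notin> X" using False by simp
        have r: "a # remdups u = R1 @ xs @ R2" using Cons.prems(3) a by simp
        show ?thesis
        proof (cases R1)
          case Nil
          then show ?thesis using r \<open>a \<notin> X\<close> xs Cons.prems(4) by (cases xs) auto
        next
          case (Cons c R)
          then show ?thesis using r Cons.prems(5) by auto
        qed
      qed
      then obtain R1' where "remdups u = R1' @ xs @ R2" "X \<inter> set R1' = {}" by blast
      from Cons.IH[OF du Cons.prems(2) this(1) Cons.prems(4) this(2) Cons.prems(6)]
      obtain P \<theta> S where *: "set P \<inter> (X \<union> L) = {}" "set S \<inter> (X \<union> L) = {}"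
          "block_subst X L \<theta>"
          and r1: "res (-X) (P @ subst_word \<theta> (res (X \<union> L) u) @ S) = res (-X) u"
          and r2: "remdups (P @ subst_word \<theta> (res (X \<union> L) u) @ S) = remdups u"
        by blast
      define Z where "Z = subst_word \<theta> (res (X \<union> L) u) @ S"
      have r1: "res (-X) (P @ Z) = res (-X) u" and r2: "remdups (P @ Z) = remdups u"
        using r1 r2 by (simp_all only: Z_def)
      have set_eq: "set (P @ Z) = set u" using r2 by (metis set_remdups)
      consider "a \<in> X" "a \<in> set u" | "a \<in> L" | "a \<notin> X" "a \<notin> L"
        using False by blast
      then show ?thesis
      proof cases
        case 1
        then have "a \<in> set Z" using set_eq *(1) by auto
        then have n2: "remdups (P @ a # Z) = remdups (a # u)"
          using r2 1 by (simp add: remdups_insert_mem)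
        have n1: "res (-X) (P @ a # Z) = res (-X) (a # u)" using r1 1 by simp
        have Z: "subst_word \<theta> (res (X \<union> L) (a # u)) @ S = a # Z"
          using 1 block_substD[OF *(3)] by (simp add: Z_def)
        show ?thesis
          by (intro exI conjI, rule *(1), rule *(2), rule *(3), unfold Z, rule n1, rule n2)
      next
        case 2
        then have a: "a \<notin> set u" "a \<notin> X" using Cons.prems by auto
        \<comment> \<open>The linear letter \<open>a\<close> opens the block whose other letters
          were collected in \<open>P\<close>; they become part of its image and the prefix is empty
          again.\<close>
        have "res (X \<union> L) P = []" using *(1) by (auto simp: filter_empty_conv)
        then have b: "block_subst X L (\<theta>(a := a # P))"
          using 2 a by (intro block_subst_upd[OF *(3)]) auto
        have e: "subst_word (\<theta>(a := a # P)) (res (X \<union> L) (a # u)) @ S = a # P @ Z"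
          using 2 a by (simp add: subst_word_upd Z_def)
        have "remdups (a # P @ Z) = remdups (a # u)"
          using r2 a set_eq by simp
        moreover have "res (-X) (a # P @ Z) = res (-X) (a # u)" using r1 a by simp
        ultimately show ?thesis
          by (intro exI[of _ "[]"] exI[of _ "\<theta>(a := a # P)"] exI[of _ S])
            (simp only: * b e append_Nil, simp)
      next
        case 3
        have e: "(a # P) @ subst_word \<theta> (res (X \<union> L) (a # u)) @ S = a # P @ Z"
          using 3 by (simp add: Z_def)
        have n2: "remdups (a # P @ Z) = remdups (a # u)"
          using r2 set_eq by simp
        have n1: "res (-X) (a # P @ Z) = res (-X) (a # u)" using r1 3 by simp
        have n0: "set (a # P) \<inter> (X \<union> L) = {}" using *(1) 3 by simp
        show ?thesis
          by (intro exI conjI, rule n0, rule *(2), rule *(3), unfold e, rule n1, rule n2)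
      qed
    qed
  qed
qed

end

context sigma_theory
begin

text \<open>By \<open>canonical_form\<close> the word \<open>u\<close> is equivalent to its gathered
  form, which is an image of \<open>res (X \<union> L) u\<close> in a context, so the given identity
  can be applied there. The last conjunct controls side effects: wherever the two sides of the
  identity agree, the order of last occurrences stays as it was.\<close>

lemma exchange:
  assumes cnt: "\<And>b. b \<in> set u \<Longrightarrow> b \<notin> L \<Longrightarrow> 2 \<le> count_list u b"
    and L: "distinct (res L u)" "X \<inter> L = {}"
    and rd: "remdups u = R1 @ xs @ R2" "set xs \<subseteq> X" "X \<inter> set R1 = {}" "X \<inter> set R2 = {}"
    and w': "(res (X \<union> L) u, w') \<in> D" "set w' \<subseteq> X \<union> L" "res L w' = res L u"
  shows "\<exists>u'. (u, u') \<in> D \<and> res (X \<union> L) u' = w' \<and> res (-X) u' = res (-X) u \<and>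
    (\<forall>Q. L \<subseteq> Q \<longrightarrow> res Q w' = res Q (res (X \<union> L) u) \<longrightarrow>
      res Q (remdups u') = res Q (remdups u))"
proof -
  obtain P \<theta> S where P: "set P \<inter> (X \<union> L) = {}" "set S \<inter> (X \<union> L) = {}"
      and \<theta>: "block_subst X L \<theta>"
      and r1: "res (-X) (P @ subst_word \<theta> (res (X \<union> L) u) @ S) = res (-X) u"
      and r2: "remdups (P @ subst_word \<theta> (res (X \<union> L) u) @ S) = remdups u"
    using gather[OF L rd] by blast
  define w where "w = res (X \<union> L) u"
  define f where "f z = P @ subst_word \<theta> z @ S" for z
  have w: "set w \<subseteq> X \<union> L" by (auto simp: w_def)
  have fQ: "res Q (f z) = res Q P @ subst_word (\<lambda>a. res Q (\<theta> a)) (res Q z) @ res Q S"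
    if "set z \<subseteq> X \<union> L" "L \<subseteq> Q" for Q z
  proof -
    have "res Q (subst_word \<theta> z) = subst_word (\<lambda>a. res Q (\<theta> a)) (res Q z)"
      using that \<theta> by (induction z) (auto simp: block_subst_def)
    then show ?thesis by (simp add: f_def)
  qed
  have fXL: "res (X \<union> L) (f z) = z" if "set z \<subseteq> X \<union> L" for z
  proof -
    have "res (X \<union> L) (subst_word \<theta> z) = z"
      using that \<theta> by (induction z) (auto simp: block_subst_def)
    moreover have "res (X \<union> L) P = []" "res (X \<union> L) S = []"
      using P by (auto simp: filter_empty_conv)
    ultimately show ?thesis by (simp add: f_def)
  qed
  have r1: "res (-X) (f w) = res (-X) u" and r2: "remdups (f w) = remdups u"
    using r1 r2 by (simp_all only: f_def w_def)
  have "([] @ u, [] @ f w) \<in> D"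
  proof (rule canonical_form)
    show "2 \<le> count_list ([] @ u) b" if "b \<in> set u" "b \<notin> L" for b
      using cnt[OF that] by simp
    show "remdups u = remdups (f w)" by (rule r2[symmetric])
    show "res (insert x L) u = res (insert x L) (f w)" for x
    proof (cases "x \<in> X")
      case True
      have "res (X \<union> L) u = res (X \<union> L) (f w)"
        using fXL[OF w] by (simp only: w_def)
      then show ?thesis
        by (rule res_eq_mono) (use True in blast)
    next
      case False
      show ?thesis
        by (rule res_eq_mono[OF r1[symmetric]]) (use False L in blast)
    qed
  qed
  then have "(u, f w) \<in> D" by simp
  also have "(f w, f w') \<in> D"
    unfolding f_def by (intro context_mem subst_mem) (use w' in \<open>simp add: w_def\<close>)
  finally have "(u, f w') \<in> D" .
  moreover have eqQ: "res Q (f w') = res Q (f w)" if "L \<subseteq> Q" "res Q w' = res Q w" for Q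
    using fQ[OF w that(1)] fQ[OF w'(2) that(1)] that(2) by simp
  moreover have "res (-X) (f w') = res (-X) u"
  proof -
    have *: "res (-X) z = res L z" if "set z \<subseteq> X \<union> L" for z
      using that L by (intro filter_cong) auto
    have "res (-X) w' = res (-X) w"
      using *[OF w] *[OF w'(2)] w'(3) res_res[of L "X \<union> L" u] by (simp add: w_def Int_absorb2)
    then show ?thesis
      using eqQ[of "-X"] r1 L by auto
  qed
  moreover have "res Q (remdups (f w')) = res Q (remdups u)"
    if "L \<subseteq> Q" "res Q w' = res Q w" for Q
    using eqQ[OF that] r2 by (metis remdups_res)
  ultimately show ?thesis
    using fXL[OF w'(2)] by (intro exI[of _ "f w'"]) (auto simp: w_def)
qed

end

text \<open>The interface to the finite bases: \<open>D\<close> will be the set of consequences of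
  finitely many identities of \<open>E\<close>. The two assumptions are the families to be covered:
  one non-linear letter, or two whose individual distributions agree while their neighbouring last
  occurrences are interchanged.\<close>

locale reduction = sigma_theory D a0 b0 c0 d0 + E: eq_theory E
  for D :: "'a identity set" and a0 b0 c0 d0 and E :: "'a identity set" +
  assumes D_le_E: "D \<subseteq> E"
    and one_letter: "\<lbrakk>x \<notin> L; set z \<subseteq> insert x L; set z' \<subseteq> insert x L; distinct (res L z);
      res L z = res L z'; (z, z') \<in> E\<rbrakk> \<Longrightarrow> (z, z') \<in> D"
    and two_letter: "\<lbrakk>x \<noteq> y; x \<notin> L; y \<notin> L; set w \<subseteq> {x, y} \<union> L; set w' \<subseteq> {x, y} \<union> L;
      distinct (res L w); 2 \<le> count_list w x; 2 \<le> count_list w y;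
      res (insert x L) w = res (insert x L) w'; res (insert y L) w = res (insert y L) w';
      remdups w = F1 @ [x, y] @ F2; set F1 \<subseteq> L; set F2 \<subseteq> L; subseq [y, x] (remdups w');
      (w, w') \<in> E\<rbrakk> \<Longrightarrow> (w, w') \<in> D"
begin

text \<open>\<open>exchange\<close> with \<open>X = {x}\<close> corrects the distribution of one
  letter and leaves the others alone, so the number of incorrectly distributed letters
  decreases.\<close>

lemma equalize_blocks:
  assumes "(u, v) \<in> E" "set u = set v" "distinct (res L v)" "res L u = res L v"
    and "\<And>b. b \<in> set v \<Longrightarrow> b \<notin> L \<Longrightarrow> 2 \<le> count_list u b"
    and cv: "\<And>b. b \<in> set v \<Longrightarrow> b \<notin> L \<Longrightarrow> 2 \<le> count_list v b"
  shows "\<exists>u'. (u, u') \<in> D \<and> set u' = set v \<and> (\<forall>x. res (insert x L) u' = res (insert x L) v)"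
  using assms
proof (induction "card {x \<in> set v. res (insert x L) u \<noteq> res (insert x L) v}"
    arbitrary: u rule: less_induct)
  case less
  show ?case
  proof (cases "\<exists>x\<in>set v. res (insert x L) u \<noteq> res (insert x L) v")
    case False
    have "res (insert x L) u = res (insert x L) v" if "x \<notin> set v" for x
    proof -
      have "res (insert x L) z = res L z" if "set z = set v" for z
        using \<open>x \<notin> set v\<close> that by (intro filter_cong) auto
      then show ?thesis using less.prems by metis
    qed
    then show ?thesis
      using False less.prems by (intro exI[of _ u]) (auto intro: refl_mem)
  next
    case True
    then obtain x where x: "x \<in> set v" "res (insert x L) u \<noteq> res (insert x L) v" by blast
    have xL: "x \<notin> L" using x(2) less.prems(4) by (metis insert_absorb)
    have L: "res L (res (insert x L) z) = res L z" for z
      by (simp add: conj_commute cong: conj_cong)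
    have "(res (insert x L) u, res (insert x L) v) \<in> E"
      by (rule E.res_mem) (rule less.prems)
    then have "(res (insert x L) u, res (insert x L) v) \<in> D"
      using less.prems(3,4) xL by (intro one_letter[of x L]) (auto simp only: L set_filter)
    moreover obtain R1 R2 where R: "remdups u = R1 @ [x] @ R2"
      using x less.prems(2) by (metis append_Cons append_Nil set_remdups split_list)
    moreover have "distinct (remdups u)" by simp
    then have "x \<notin> set R1" "x \<notin> set R2" using R by auto
    moreover have "res L (res (insert x L) v) = res L u"
      using L less.prems(4) by simp
    ultimately obtain u' where u': "(u, u') \<in> D" "res (insert x L) u' = res (insert x L) v"
        "res (-{x}) u' = res (-{x}) u"
      using exchange[of u L "{x}" R1 "[x]" R2 "res (insert x L) v"] less.prems xL by auto
    have cx: "count_list u' x = count_list v x"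
      using u'(2) by (metis count_list_res insertI1)
    have cy: "count_list u' y = count_list u y" if "y \<noteq> x" for y
      using u'(3) that by (metis ComplI count_list_res singletonD)
    have L': "res L u' = res L v"
      using u'(2) by (rule res_eq_mono) auto
    have set_u': "set u' = set v"
    proof (rule Set.set_eqI)
      fix y show "y \<in> set u' \<longleftrightarrow> y \<in> set v"
        using cx cy[of y] less.prems(2) by (metis count_list_0_iff)
    qed
    have other: "res (insert y L) u' = res (insert y L) u" if "y \<noteq> x" for y
      using u'(3) by (rule res_eq_mono) (use that xL in auto)
    define B where "B z = {y \<in> set v. res (insert y L) z \<noteq> res (insert y L) v}" for z
    have "B u' \<subseteq> B u - {x}"
    proof
      fix y assume "y \<in> B u'"
      then have y: "y \<in> set v" "res (insert y L) u' \<noteq> res (insert y L) v"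
        by (simp_all only: B_def mem_Collect_eq not_False_eq_True)
      then have "y \<noteq> x" using u'(2) by metis
      then show "y \<in> B u - {x}"
        using y other[of y] by (simp only: B_def mem_Collect_eq Diff_iff singleton_iff not_False_eq_True)
    qed
    moreover have "x \<in> B u"
      using x by (simp only: B_def mem_Collect_eq not_False_eq_True)
    moreover have "finite (B u)" by (simp add: B_def)
    ultimately have "card (B u') < card (B u)"
      by (intro psubset_card_mono) auto
    then have card: "card {y \<in> set v. res (insert y L) u' \<noteq> res (insert y L) v} <
        card {y \<in> set v. res (insert y L) u \<noteq> res (insert y L) v}"
      by (simp only: B_def)
    have uE: "(u', v) \<in> E"
      using u'(1) less.prems(1) D_le_E by (blast intro: E.sym_mem E.trans_mem)
    have cu': "2 \<le> count_list u' b" if "b \<in> set v" "b \<notin> L" for b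
      using cx cy less.prems(5,6) that by (cases "b = x") auto
    have "\<exists>u''. (u', u'') \<in> D \<and> set u'' = set v \<and>
        (\<forall>x. res (insert x L) u'' = res (insert x L) v)"
      by (rule less.hyps[OF card uE set_u' less.prems(3) L' cu' less.prems(6)])
    then obtain u'' where u'': "(u', u'') \<in> D"
        "set u'' = set v \<and> (\<forall>x. res (insert x L) u'' = res (insert x L) v)"
      by (elim exE conjE) (rule that, assumption, rule conjI)
    show ?thesis
      by (rule exI[of _ u''], rule conjI, rule trans_mem[OF u'(1) u''(1)], rule u''(2))
  qed
qed

text \<open>Bubble sort on last occurrences: if the orders differ, two neighbours are inverted, and
  \<open>exchange\<close> with \<open>X = {x, y}\<close> removes this inversion without creating
  another.\<close>

lemma equalize_last_occurrences:
  assumes "(u, v) \<in> E" "set u = set v" "distinct (res L v)"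
    and "\<And>x. res (insert x L) u = res (insert x L) v"
    and cv: "\<And>b. b \<in> set v \<Longrightarrow> b \<notin> L \<Longrightarrow> 2 \<le> count_list v b"
  shows "(u, v) \<in> D"
  using assms
proof (induction "card {(a, b). subseq [a, b] (remdups u) \<and> \<not> subseq [a, b] (remdups v)}"
    arbitrary: u rule: less_induct)
  case less
  have cu: "count_list u b = count_list v b" for b
    using less.prems(4)[of b] by (metis count_list_res insertI1)
  have rL: "res L u = res L v"
    using less.prems(4) by (rule res_eq_mono) auto
  show ?case
  proof (cases "remdups u = remdups v")
    case True
    then show ?thesis
      using canonical_form[of u L "[]" v] less.prems cu by auto
  next
    case False
    then obtain p x y s where xy: "remdups u = p @ x # y # s" "\<not> subseq [x, y] (remdups v)"
      using distinct_eqI_adjacent[of "remdups u" "remdups v"] less.prems(2) by auto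
    have dist: "distinct (p @ x # y # s)" using xy(1) by (metis distinct_remdups)
    then have "x \<noteq> y" by auto
    have mem: "x \<in> set v" "y \<in> set v"
      using xy(1) less.prems(2) by (metis in_set_conv_decomp set_remdups, 
        metis append_Cons append_assoc append_Nil in_set_conv_decomp set_remdups)
    have "subseq [x, y] (remdups u)"
      by (simp add: xy(1) subseq_pair_append subseq_pair_Cons del: subseq_Cons2_iff)
    \<comment> \<open>The position of a last occurrence relative to the linear letters is visible in
      the distribution of its letter, which already agrees. So an inverted pair consists of two
      non-linear letters.\<close>
    have same: "subseq [x, y] (remdups v)" if "x \<in> insert z L" "y \<in> insert z L" for z
      using \<open>subseq [x, y] (remdups u)\<close> less.prems(4)[of z] subseq_pair_filter[OF that]
      by (metis remdups_res)
    have xyL: "x \<notin> L" "y \<notin> L" using same xy(2) by auto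
    have yx: "subseq [y, x] (remdups v)"
      using subseq_pair_total[of x "remdups v" y] mem \<open>x \<noteq> y\<close> xy(2) by simp
    define X where "X = {x, y}"
    define w where "w = res (X \<union> L) u"
    define w' where "w' = res (X \<union> L) v"
    have zw: "res (insert z L) w = res (insert z L) w'" if "z \<in> X" for z
      using res_res[of "insert z L" "X \<union> L"] less.prems(4)[of z] that
      by (simp add: w_def w'_def Int_absorb2)
    have Lw: "res L w = res L u" "res L w' = res L u"
      using res_res[of L "X \<union> L"] rL by (simp_all add: w_def w'_def Int_absorb2)
    have "(w, w') \<in> D"
    proof (rule two_letter[OF \<open>x \<noteq> y\<close> xyL])
      show "set w \<subseteq> {x, y} \<union> L" "set w' \<subseteq> {x, y} \<union> L" by (auto simp: w_def w'_def X_def)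
      show "distinct (res L w)" using Lw less.prems(3) rL by simp
      show "2 \<le> count_list w x" "2 \<le> count_list w y"
        using less.prems(5) mem xyL cu count_list_res[of _ "X \<union> L" u] by (simp_all add: w_def X_def)
      show "res (insert x L) w = res (insert x L) w'" "res (insert y L) w = res (insert y L) w'"
        using zw by (simp_all add: X_def)
      show "remdups w = res L p @ [x, y] @ res L s"
      proof -
        have "res (X \<union> L) z = res L z" if "x \<notin> set z" "y \<notin> set z" for z
          using that by (intro filter_cong) (auto simp: X_def)
        then show ?thesis
          using dist by (simp only: w_def remdups_res xy(1)) (auto simp: X_def)
      qed
      show "subseq [y, x] (remdups w')"
        using yx subseq_pair_filter[of y "X \<union> L" x "remdups v"]
        by (simp only: w'_def remdups_res) (simp add: X_def)
      show "(w, w') \<in> E" unfolding w_def w'_def by (rule E.res_mem) fact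
    qed auto
    moreover have sub: "set w \<subseteq> X \<union> L" "set w' \<subseteq> X \<union> L" by (auto simp: w_def w'_def)
    ultimately obtain u' where u': "(u, u') \<in> D" "res (X \<union> L) u' = w'" "res (-X) u' = res (-X) u"
        "\<And>Q. L \<subseteq> Q \<Longrightarrow> res Q w' = res Q w \<Longrightarrow> res Q (remdups u') = res Q (remdups u)"
      using exchange[of u L X p "[x, y]" s w'] xy(1) dist Lw less.prems(2,3,5) cu rL xyL
      unfolding w_def by (auto simp: X_def)
    have blocks: "res (insert z L) u' = res (insert z L) v" for z
    proof (cases "z \<in> X")
      case True
      then show ?thesis
        by (intro res_eq_mono[OF u'(2)[unfolded w'_def]]) auto
    next
      case False
      then have "res (insert z L) u' = res (insert z L) u"
        using xyL by (intro res_eq_mono[OF u'(3)]) (auto simp: X_def)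
      then show ?thesis using less.prems(4) by simp
    qed
    have cu': "count_list u' b = count_list v b" for b
      using blocks[of b] by (metis count_list_res insertI1)
    have set_u': "set u' = set v"
      using cu' by (metis count_list_0_iff subsetI subset_antisym)
    have ord_xy: "subseq [a, b] (remdups u') \<longleftrightarrow> subseq [a, b] (remdups v)"
      if "a \<in> X \<union> L" "b \<in> X \<union> L" for a b
      using subseq_pair_filter[OF that] u'(2) w'_def by (metis remdups_res)
    \<comment> \<open>Without \<open>z\<close> the two restricted words show only the distribution
      of the other letter of \<open>X\<close>, on which they agree. Hence only the order of
      \<open>x\<close> and \<open>y\<close> themselves can change.\<close>
    have ord: "subseq [a, b] (remdups u') \<longleftrightarrow> subseq [a, b] (remdups u)"
      if "z \<in> X" "a \<noteq> z" "b \<noteq> z" for a b z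
    proof -
      obtain z' where z': "z' \<in> X" "X - {z} = {z'}" using \<open>z \<in> X\<close> \<open>x \<noteq> y\<close> by (auto simp: X_def)
      have "res (-{z}) q = res (insert z' L) q" if "set q \<subseteq> X \<union> L" for q
        using that z' \<open>z \<in> X\<close> xyL by (intro filter_cong) (auto simp: X_def)
      then have "res (-{z}) w' = res (-{z}) w"
        using zw[OF z'(1)] sub by metis
      then have "res (-{z}) (remdups u') = res (-{z}) (remdups u)"
        using \<open>z \<in> X\<close> xyL by (intro u'(4)) (auto simp: X_def)
      then show ?thesis
        using subseq_pair_filter[of a "-{z}" b] that by (metis ComplI singletonD)
    qed
    have "{(a, b). subseq [a, b] (remdups u') \<and> \<not> subseq [a, b] (remdups v)} \<subseteq>
        {(a, b). subseq [a, b] (remdups u) \<and> \<not> subseq [a, b] (remdups v)} - {(x, y)}"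
    proof clarsimp
      fix a b assume ab: "subseq [a, b] (remdups u')" "\<not> subseq [a, b] (remdups v)"
      then have "\<not> (a \<in> X \<and> b \<in> X)" using ord_xy by blast
      moreover have "a \<noteq> b" using subseq_pair_antisym[of "remdups u'" a b] ab(1) by auto
      ultimately have "\<exists>z\<in>X. a \<noteq> z \<and> b \<noteq> z" using \<open>x \<noteq> y\<close> by (auto simp: X_def)
      then show "subseq [a, b] (remdups u) \<and> (a = x \<longrightarrow> b \<noteq> y)"
        using ord ab(1) \<open>\<not> (a \<in> X \<and> b \<in> X)\<close> by (auto simp: X_def)
    qed
    moreover have "(x, y) \<in> {(a, b). subseq [a, b] (remdups u) \<and> \<not> subseq [a, b] (remdups v)}"
      using \<open>subseq [x, y] (remdups u)\<close> xy(2) by simp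
    ultimately have "{(a, b). subseq [a, b] (remdups u') \<and> \<not> subseq [a, b] (remdups v)} \<subset>
        {(a, b). subseq [a, b] (remdups u) \<and> \<not> subseq [a, b] (remdups v)}"
      by blast
    moreover have "finite {(a, b). subseq [a, b] (remdups u) \<and> \<not> subseq [a, b] (remdups v)}"
      by (rule finite_subset[of _ "set u \<times> set u"]) (auto dest: subseq_pair_set)
    ultimately have card:
      "card {(a, b). subseq [a, b] (remdups u') \<and> \<not> subseq [a, b] (remdups v)} <
        card {(a, b). subseq [a, b] (remdups u) \<and> \<not> subseq [a, b] (remdups v)}"
      by (rule psubset_card_mono[rotated])
    have "(u', v) \<in> E"
      using u'(1) less.prems(1) D_le_E by (blast intro: E.sym_mem E.trans_mem)
    then have "(u', v) \<in> D"
      by (rule less.hyps[OF card _ set_u' less.prems(3) blocks less.prems(5)])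
    with u'(1) show ?thesis by (rule trans_mem)
  qed
qed

theorem same_linear_part:
  assumes "(u, v) \<in> E" "set u = set v" "distinct (res L v)" "res L u = res L v"
    and "\<And>b. b \<in> set v \<Longrightarrow> b \<notin> L \<Longrightarrow> 2 \<le> count_list u b"
    and "\<And>b. b \<in> set v \<Longrightarrow> b \<notin> L \<Longrightarrow> 2 \<le> count_list v b"
  shows "(u, v) \<in> D"
proof -
  have "\<exists>u'. (u, u') \<in> D \<and> set u' = set v \<and> (\<forall>x. res (insert x L) u' = res (insert x L) v)"
    by (rule equalize_blocks[OF assms])
  then obtain u' where u': "(u, u') \<in> D" "set u' = set v"
      and blocks: "\<forall>x. res (insert x L) u' = res (insert x L) v"
    by (elim exE conjE) (rule that)
  have "(u', v) \<in> E"
    using u'(1) assms(1) D_le_E by (blast intro: E.sym_mem E.trans_mem)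
  then have "(u', v) \<in> D"
    by (rule equalize_last_occurrences[OF _ u'(2) assms(3) blocks[rule_format] assms(6)])
  with u'(1) show ?thesis by (rule trans_mem)
qed

end

section \<open>Higman's lemma\<close>

text \<open>For transitive relations this is the notion of a well-quasi-order.\<close>

definition almost_full :: "('b \<Rightarrow> 'b \<Rightarrow> bool) \<Rightarrow> bool" where
  "almost_full r \<longleftrightarrow> (\<forall>f :: nat \<Rightarrow> 'b. \<exists>i j. i < j \<and> r (f i) (f j))"

lemma almost_fullD:
  assumes "almost_full r" shows "\<exists>i j :: nat. i < j \<and> r (f i) (f j)"
  using assms[unfolded almost_full_def] by (rule spec)

lemma almost_full_nat: "almost_full ((\<le>) :: nat \<Rightarrow> nat \<Rightarrow> bool)"
  unfolding almost_full_def
proof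
  fix f :: "nat \<Rightarrow> nat"
  obtain i where "\<And>j. f i \<le> f j"
    using ex_has_least_nat[of "\<lambda>_. True" 0 f] by auto
  then show "\<exists>i j. i < j \<and> f i \<le> f j"
    by (intro exI[of _ i] exI[of _ "Suc i"]) simp
qed

lemma almost_full_comap: "almost_full r \<Longrightarrow> almost_full (\<lambda>x y. r (h x) (h y))"
  unfolding almost_full_def by (rule allI, drule_tac x = "\<lambda>n. h (f n)" in spec)

text \<open>Only finitely many indices have no later term above them, for infinitely many would form
  a sequence without a good pair. Beyond these indices a chain is chosen greedily, and transitivity
  relates all its terms.\<close>

lemma almost_full_chain:
  assumes "almost_full r" "transp r"
  shows "\<exists>g :: nat \<Rightarrow> nat. strict_mono g \<and> (\<forall>i j. i < j \<longrightarrow> r (f (g i)) (f (g j)))"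
proof -
  define T where "T = {i. \<forall>j>i. \<not> r (f i) (f j)}"
  have "finite T"
  proof (rule ccontr)
    assume inf: "infinite T"
    obtain e :: "nat \<Rightarrow> nat" where e: "strict_mono e" "\<And>n. e n \<in> T"
      using infinite_enumerate[OF inf] by blast
    obtain i j where "i < j" "r (f (e i)) (f (e j))"
      using almost_fullD[OF assms(1), of "\<lambda>n. f (e n)"] by blast
    then show False
      using e(2)[of i] strict_monoD[OF e(1)] by (simp add: T_def)
  qed
  then obtain N where "\<forall>i\<in>T. i < N"
    unfolding finite_nat_set_iff_bounded by (rule exE)
  then have N: "i < N" if "i \<in> T" for i
    using that by (rule bspec)
  have next_ex: "\<exists>y\<ge>N. i < y \<and> r (f i) (f y)" if "N \<le> i" for i
  proof -
    have "i \<notin> T" using N[of i] that by (metis not_le)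
    then obtain j where "i < j" "r (f i) (f j)" by (auto simp: T_def)
    then show ?thesis
      using that by (intro exI[of _ j]) simp
  qed
  have "\<exists>g. \<forall>n. N \<le> g n \<and> (g n < g (Suc n) \<and> r (f (g n)) (f (g (Suc n))))"
    by (rule dependent_nat_choice[where P = "\<lambda>_ x. N \<le> x"
          and Q = "\<lambda>_ x y. x < y \<and> r (f x) (f y)"])
      (use next_ex in auto)
  then obtain g where g: "\<And>n. g n < g (Suc n)" "\<And>n. r (f (g n)) (f (g (Suc n)))"
    by blast
  have "r (f (g i)) (f (g j))" if "i < j" for i j
    using that
  proof (induction j)
    case (Suc j)
    then show ?case
      using g(2) transpD[OF assms(2)] by (metis less_SucE)
  qed simp
  then show ?thesis
    using g(1) by (auto simp: strict_mono_Suc_iff)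
qed

lemma almost_full_prod:
  fixes r :: "'a \<Rightarrow> 'a \<Rightarrow> bool" and s :: "'b \<Rightarrow> 'b \<Rightarrow> bool"
  assumes "almost_full r" "transp r" "almost_full s"
  shows "almost_full (\<lambda>p q. r (fst p) (fst q) \<and> s (snd p) (snd q))"
  unfolding almost_full_def
proof
  fix f :: "nat \<Rightarrow> 'a \<times> 'b"
  obtain g :: "nat \<Rightarrow> nat" where g: "strict_mono g"
      "\<And>i j. i < j \<Longrightarrow> r (fst (f (g i))) (fst (f (g j)))"
    using almost_full_chain[OF assms(1,2), of "\<lambda>n. fst (f n)"] by blast
  obtain i j where "i < j" "s (snd (f (g i))) (snd (f (g j)))"
    using almost_fullD[OF assms(3), of "\<lambda>n. snd (f (g n))"] by blast
  then show "\<exists>i j. i < j \<and> r (fst (f i)) (fst (f j)) \<and> s (snd (f i)) (snd (f j))"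
    using g by (intro exI[of _ "g i"] exI[of _ "g j"]) (auto simp: strict_mono_less)
qed

text \<open>Nash-Williams' minimal bad sequence argument.\<close>

lemma almost_full_list_emb:
  fixes r :: "'a \<Rightarrow> 'a \<Rightarrow> bool"
  assumes "almost_full r" "transp r"
  shows "almost_full (list_emb r)"
proof (rule ccontr)
  define bad where "bad f \<longleftrightarrow> (\<forall>i j. i < j \<longrightarrow> \<not> list_emb r (f i) (f j))" for f :: "nat \<Rightarrow> 'a list"
  define ext where "ext f n x \<longleftrightarrow> (\<exists>g. bad g \<and> (\<forall>i<n. g i = f i) \<and> g n = x)" for f n x
  define P where "P f n x \<longleftrightarrow> ext f n x \<and> (\<forall>y. ext f n y \<longrightarrow> length x \<le> length y)" for f n x
  assume "\<not> almost_full (list_emb r)"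
  then obtain h where h: "bad h"
    by (auto simp: almost_full_def bad_def)
  have minimal: "\<exists>x. P f n x" if "\<exists>x. ext f n x" for f n
    using that ex_has_least_nat[of "ext f n" _ length] by (auto simp: P_def)
  have "\<exists>F. \<forall>n. (ext F n (F n)) \<and> P F n (F n)"
  proof -
    \<comment> \<open>The choice of \<open>F n\<close> must be possible for arbitrary earlier
      values, hence the guard that these values extend to a bad sequence. The induction below shows
      that the guard always holds for \<open>F\<close>.\<close>
    have "\<exists>F. \<forall>n. (\<exists>g. bad g \<and> (\<forall>i<n. g i = F i)) \<longrightarrow> P F n (F n)"
    proof (rule dependent_wellorder_choice)
      fix f :: "nat \<Rightarrow> 'a list" and n
      show "\<exists>x. (\<exists>g. bad g \<and> (\<forall>i<n. g i = f i)) \<longrightarrow> P f n x"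
        using minimal[of f n] by (auto simp: ext_def)
    next
      fix x and f g :: "nat \<Rightarrow> 'a list" and n :: nat
      assume "\<And>y. y < n \<Longrightarrow> f y = g y"
      then have "ext f n z = ext g n z" "(\<exists>h. bad h \<and> (\<forall>i<n. h i = f i)) = (\<exists>h. bad h \<and> (\<forall>i<n. h i = g i))" for z
        by (auto simp: ext_def)
      then show "((\<exists>h. bad h \<and> (\<forall>i<n. h i = f i)) \<longrightarrow> P f n x) =
          ((\<exists>h. bad h \<and> (\<forall>i<n. h i = g i)) \<longrightarrow> P g n x)"
        by (simp add: P_def)
    qed
    then obtain F where F: "\<And>n. (\<exists>g. bad g \<and> (\<forall>i<n. g i = F i)) \<Longrightarrow> P F n (F n)"
      by blast
    have "\<exists>g. bad g \<and> (\<forall>i<n. g i = F i)" for n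
    proof (induction n)
      case (Suc n)
      then have "ext F n (F n)" using F P_def by blast
      then show ?case by (auto simp: ext_def less_Suc_eq)
    qed (use h in auto)
    then show ?thesis using F P_def by blast
  qed
  then obtain F where ext: "\<And>n. ext F n (F n)"
      and min: "\<And>n y. ext F n y \<Longrightarrow> length (F n) \<le> length y"
    by (auto simp: P_def)
  have badF: "\<not> list_emb r (F i) (F j)" if "i < j" for i j
  proof -
    obtain g where "bad g" "g i = F i" "g j = F j"
      using ext[of j] \<open>i < j\<close> unfolding ext_def by blast
    then show ?thesis
      using that unfolding bad_def by metis
  qed
  have ne: "F n \<noteq> []" for n
    using badF[of n "Suc n"] by auto
  obtain \<phi> :: "nat \<Rightarrow> nat" where \<phi>: "strict_mono \<phi>"
      "\<And>i j. i < j \<Longrightarrow> r (hd (F (\<phi> i))) (hd (F (\<phi> j)))"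
    using almost_full_chain[OF assms, of "\<lambda>n. hd (F n)"] by blast
  \<comment> \<open>The minimal sequence is followed up to the first index of the chain of heads,
    then by tails along that chain. A good pair of \<open>g\<close> would give one of
    \<open>F\<close>, so \<open>g\<close> is bad, yet its entry at \<open>\<phi> 0\<close> is
    shorter than that of \<open>F\<close>.\<close>
  define g where "g n = (if n < \<phi> 0 then F n else tl (F (\<phi> (n - \<phi> 0))))" for n
  have emb_tl: "list_emb r u (tl (F n)) \<Longrightarrow> list_emb r u (F n)" for u n
    using ne[of n] by (cases "F n") auto
  have "bad g"
    unfolding bad_def
  proof (intro allI impI notI)
    fix i j :: nat assume ij: "i < j" "list_emb r (g i) (g j)"
    consider "j < \<phi> 0" | "i < \<phi> 0" "\<not> j < \<phi> 0" | "\<not> i < \<phi> 0" "\<not> j < \<phi> 0"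
      using ij(1) by linarith
    then show False
    proof cases
      case 1
      then show ?thesis using ij badF by (simp add: g_def)
    next
      case 2
      then have "list_emb r (F i) (F (\<phi> (j - \<phi> 0)))"
        using ij(2) emb_tl by (simp add: g_def)
      moreover have "\<phi> 0 \<le> \<phi> (j - \<phi> 0)"
        using \<phi>(1) by (simp add: strict_mono_less_eq)
      ultimately show ?thesis using badF[of i "\<phi> (j - \<phi> 0)"] 2 by simp
    next
      case 3
      define m n where "m = i - \<phi> 0" and "n = j - \<phi> 0"
      have "m < n" using 3 ij(1) by (simp add: m_def n_def)
      have "list_emb r (hd (F (\<phi> m)) # tl (F (\<phi> m))) (hd (F (\<phi> n)) # tl (F (\<phi> n)))"
        using ij(2) 3 \<phi>(2)[OF \<open>m < n\<close>] by (intro list_emb_Cons2) (simp_all add: g_def m_def n_def)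
      then show ?thesis
        using badF[of "\<phi> m" "\<phi> n"] \<phi>(1) \<open>m < n\<close> ne by (simp add: strict_mono_less)
    qed
  qed
  then have "ext F (\<phi> 0) (g (\<phi> 0))"
    by (auto simp: ext_def g_def)
  from min[OF this] show False
    using ne[of "\<phi> 0"] by (cases "F (\<phi> 0)") (auto simp: g_def)
qed

text \<open>Otherwise elements of \<open>U\<close> could be chosen one after another, none above an
  earlier one.\<close>

lemma almost_full_finite_basis:
  fixes r :: "'a \<Rightarrow> 'a \<Rightarrow> bool"
  assumes "almost_full r"
  shows "\<exists>F. finite F \<and> F \<subseteq> U \<and> (\<forall>u\<in>U. \<exists>f\<in>F. r f u)"
proof (rule ccontr)
  assume no: "\<not> ?thesis"
  have "\<exists>f :: nat \<Rightarrow> 'a. \<forall>n. (\<forall>i<n. f i \<in> U) \<longrightarrow> f n \<in> U \<and> (\<forall>i<n. \<not> r (f i) (f n))"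
  proof (rule dependent_wellorder_choice)
    fix f :: "nat \<Rightarrow> 'a" and n
    show "\<exists>x. (\<forall>i<n. f i \<in> U) \<longrightarrow> x \<in> U \<and> (\<forall>i<n. \<not> r (f i) x)"
    proof (cases "\<forall>i<n. f i \<in> U")
      case True
      then have "\<exists>u\<in>U. \<forall>x\<in>f ` {..<n}. \<not> r x u"
        using no by (metis finite_imageI finite_lessThan image_subsetI lessThan_iff)
      then show ?thesis by auto
    qed auto
  qed auto
  then obtain f :: "nat \<Rightarrow> 'a"
    where f: "\<And>n. (\<forall>i<n. f i \<in> U) \<Longrightarrow> f n \<in> U \<and> (\<forall>i<n. \<not> r (f i) (f n))"
    by blast
  have "f n \<in> U" for n
    by (induction n rule: less_induct) (use f in blast)
  then have "\<not> r (f i) (f n)" if "i < n" for i n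
    using f that by blast
  then show False
    using almost_fullD[OF assms, of f] by blast
qed


section \<open>Words as sequences of blocks\<close>

text \<open>Each block is closed by its own linear letter; a final open block is appended separately
  where it is needed.\<close>

fun block_word :: "(nat \<Rightarrow> 'a) \<Rightarrow> nat \<Rightarrow> 'a list list \<Rightarrow> 'a list" where
  "block_word t k [] = []"
| "block_word t k (b # bs) = b @ t k # block_word t (Suc k) bs"

lemma block_word_snoc:
  "block_word t k (bs @ [b]) = block_word t k bs @ b @ [t (k + length bs)]"
  by (induction bs arbitrary: k) auto

lemma set_block_word:
  "set (block_word t k bs) = (\<Union>b\<in>set bs. set b) \<union> t ` {k..<k + length bs}"
proof (induction bs arbitrary: k)
  case (Cons b bs)
  have "{k..<k + length (b # bs)} = insert k {Suc k..<Suc k + length bs}" by auto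
  then show ?case using Cons by auto
qed simp

lemma ex_block_word:
  assumes "set w \<subseteq> X \<union> range t" "X \<inter> range t = {}" "inj t"
    and "res (range t) w = map t [k..<k + n]"
  shows "\<exists>bs b. w = block_word t k bs @ b \<and> length bs = n \<and> set b \<subseteq> X \<and>
    (\<forall>c\<in>set bs. set c \<subseteq> X)"
  using assms(1,4)
proof (induction w arbitrary: k n)
  case Nil
  then show ?case by (intro exI[of _ "[]"]) auto
next
  case (Cons c w)
  show ?case
  proof (cases "c \<in> range t")
    case True
    then have eq: "c # res (range t) w = map t [k..<k + n]" using Cons.prems(2) by simp
    then obtain m where n: "n = Suc m" by (cases n) auto
    have "[k..<k + n] = k # [Suc k..<Suc k + m]"
      using n by (simp add: upt_conv_Cons)
    then have "c = t k" "res (range t) w = map t [Suc k..<Suc k + m]"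
      using eq by auto
    then obtain bs b where "w = block_word t (Suc k) bs @ b" "length bs = m" "set b \<subseteq> X"
        "\<forall>c\<in>set bs. set c \<subseteq> X"
      using Cons.IH[of "Suc k" m] Cons.prems(1) by auto
    then show ?thesis
      using \<open>c = t k\<close> n by (intro exI[of _ "[] # bs"] exI[of _ b]) simp
  next
    case False
    then obtain bs b where w: "w = block_word t k bs @ b" "length bs = n" "set b \<subseteq> X"
        "\<forall>c\<in>set bs. set c \<subseteq> X"
      using Cons.IH[of k n] Cons.prems by auto
    show ?thesis
    proof (cases bs)
      case Nil
      then show ?thesis
        using w False Cons.prems(1) by (intro exI[of _ "[]"] exI[of _ "c # b"]) auto
    next
      case (Cons b' bs')
      then show ?thesis
        using w False Cons.prems(1) by (intro exI[of _ "(c # b') # bs'"] exI[of _ b]) auto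
    qed
  qed
qed

section \<open>Finite bases\<close>

lemma lex_less_than_total:
  "length xs = length ys \<Longrightarrow> xs \<noteq> ys \<Longrightarrow> (xs, ys) \<in> lex less_than \<or> (ys, xs) \<in> lex less_than"
  for xs ys :: "nat list"
  by (induction xs ys rule: list_induct2) auto

lemma lex_length: "(xs, ys) \<in> lex r \<Longrightarrow> length xs = length ys"
  by (simp add: lex_conv)

definition letter_word :: "'a \<Rightarrow> (nat \<Rightarrow> 'a) \<Rightarrow> nat \<Rightarrow> nat list \<Rightarrow> 'a list" where
  "letter_word x t k es = block_word t k (map (\<lambda>e. replicate e x) es)"

lemma letter_word_simps:
  "letter_word x t k [] = []"
  "letter_word x t k (e # es) = replicate e x @ t k # letter_word x t (Suc k) es"
  by (simp_all add: letter_word_def)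

lemma set_letter_word: "set (letter_word x t k es) \<subseteq> insert x (t ` {k..<k + length es})"
  by (auto simp: letter_word_def set_block_word split: if_splits)

lemma subst_word_replicate: "\<theta> x = [x] \<Longrightarrow> subst_word \<theta> (replicate e x) = replicate e x"
  by (induction e) auto

text \<open>An embedding of exponent sequences is realized by a substitution in a context: surplus
  exponents and skipped entries go into the image of the preceding linear letter, or into
  \<open>P\<close> at the very beginning. A rule that decreases \<open>es\<close> thereby decreases
  \<open>es'\<close>, because the surplus \<open>e' - e\<close> is the same on both sides.\<close>

lemma letter_word_emb:
  assumes "inj t" "x \<notin> range t" "list_emb (\<le>) es es'" "length fs = length es"
  shows "\<exists>P \<theta> gs. \<theta> x = [x] \<and> length gs = length es' \<and>
    letter_word x t k' es' = P @ subst_word \<theta> (letter_word x t k es) \<and>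
    letter_word x t k' gs = P @ subst_word \<theta> (letter_word x t k fs) \<and>
    ((fs, es) \<in> lex less_than \<longrightarrow> (gs, es') \<in> lex less_than)"
  using assms(3,4)
proof (induction es es' arbitrary: fs k k')
  case (list_emb_Nil es')
  then show ?case
    by (intro exI[of _ "letter_word x t k' es'"] exI[of _ "\<lambda>a. [a]"] exI[of _ es'])
      (simp add: letter_word_simps)
next
  case (list_emb_Cons es es' e)
  obtain P \<theta> gs where *: "\<theta> x = [x]" "length gs = length es'"
      "letter_word x t (Suc k') es' = P @ subst_word \<theta> (letter_word x t k es)"
      "letter_word x t (Suc k') gs = P @ subst_word \<theta> (letter_word x t k fs)"
      "(fs, es) \<in> lex less_than \<longrightarrow> (gs, es') \<in> lex less_than"
    using list_emb_Cons.IH[OF list_emb_Cons.prems, of "Suc k'" k] by blast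
  show ?case
    by (rule exI[of _ "replicate e x @ t k' # P"], rule exI[of _ \<theta>], rule exI[of _ "e # gs"])
      (use * in \<open>simp add: letter_word_simps\<close>)
next
  case (list_emb_Cons2 e e' es es')
  then obtain f fs' where fs: "fs = f # fs'" "length fs' = length es"
    by (cases fs) auto
  obtain P \<theta> gs where *: "\<theta> x = [x]" "length gs = length es'"
      "letter_word x t (Suc k') es' = P @ subst_word \<theta> (letter_word x t (Suc k) es)"
      "letter_word x t (Suc k') gs = P @ subst_word \<theta> (letter_word x t (Suc k) fs')"
      "(fs', es) \<in> lex less_than \<longrightarrow> (gs, es') \<in> lex less_than"
    using list_emb_Cons2.IH[OF fs(2), of "Suc k'" "Suc k"] by blast
  let ?\<theta> = "\<theta>(t k := t k' # P)"
  have notin: "t k \<notin> set (letter_word x t (Suc k) hs)" for hs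
  proof -
    have "t k \<notin> insert x (t ` {Suc k..<Suc k + length hs})"
      using assms(1,2) by (auto simp: inj_image_mem_iff)
    then show ?thesis
      using set_letter_word[of x t "Suc k" hs] by blast
  qed
  have x: "?\<theta> x = [x]" using * assms(2) by auto
  have sub: "subst_word ?\<theta> (letter_word x t k (h # hs)) =
      replicate h x @ t k' # P @ subst_word \<theta> (letter_word x t (Suc k) hs)" for h hs
    using subst_word_replicate[of ?\<theta> x, OF x] subst_word_upd[OF notin] by (simp add: letter_word_simps)
  have rep: "replicate e' x = replicate (e' - e) x @ replicate e x"
    using \<open>e \<le> e'\<close> by (simp flip: replicate_add)
  have 1: "letter_word x t k' (e' # es') = replicate (e' - e) x @ subst_word ?\<theta> (letter_word x t k (e # es))"
    unfolding sub by (simp only: rep letter_word_simps *(3) append_assoc)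
  have 2: "letter_word x t k' ((e' - e + f) # gs) = replicate (e' - e) x @ subst_word ?\<theta> (letter_word x t k fs)"
    unfolding fs(1) sub by (simp add: letter_word_simps *(4) replicate_add)
  have 3: "(fs, e # es) \<in> lex less_than \<longrightarrow> ((e' - e + f) # gs, e' # es') \<in> lex less_than"
    using *(2,5) \<open>e \<le> e'\<close> fs by auto
  show ?case
    by (rule exI[of _ "replicate (e' - e) x"], rule exI[of _ ?\<theta>], rule exI[of _ "(e' - e + f) # gs"],
        intro conjI, rule x, simp add: *(2), rule 1, rule 2, rule 3)
qed

text \<open>
  Every exponent sequence is rewritten to the lexicographically least equivalent one. By Higman's
  lemma, finitely many rules detect all sequences that are not least.
\<close>

lemma one_letter_basis:
  assumes "eq_theory E" "inj t" "x \<notin> range t"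
  shows "\<exists>\<Sigma>. finite \<Sigma> \<and> \<Sigma> \<subseteq> E \<and> (\<forall>D es fs. eq_theory D \<longrightarrow> \<Sigma> \<subseteq> D \<longrightarrow> D \<subseteq> E \<longrightarrow>
    length es = length fs \<longrightarrow> (letter_word x t 0 es, letter_word x t 0 fs) \<in> E \<longrightarrow>
    (letter_word x t 0 es, letter_word x t 0 fs) \<in> D)"
proof -
  interpret E: eq_theory E by fact
  let ?w = "letter_word x t 0"
  define smaller where "smaller fs es \<longleftrightarrow> (fs, es) \<in> lex less_than \<and> (?w es, ?w fs) \<in> E" for fs es
  define R where "R = {es. \<exists>fs. smaller fs es}"
  have "almost_full (list_emb ((\<le>) :: nat \<Rightarrow> nat \<Rightarrow> bool))"
    by (rule almost_full_list_emb[OF almost_full_nat]) simp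
  from almost_full_finite_basis[OF this, of R]
  obtain F where F: "finite F" "F \<subseteq> R" "\<forall>es\<in>R. \<exists>gs\<in>F. list_emb (\<le>) gs es"
    by (elim exE conjE) (rule that)
  define nf where "nf es = (SOME fs. smaller fs es)" for es
  have nf: "smaller (nf es) es" if "es \<in> F" for es
  proof -
    have "es \<in> R" using F(2) that by blast
    then obtain fs where "smaller fs es" by (auto simp: R_def)
    then show ?thesis unfolding nf_def by (rule someI)
  qed
  define \<Sigma> where "\<Sigma> = (\<lambda>es. (?w es, ?w (nf es))) ` F"
  show ?thesis
  proof (intro exI conjI allI impI)
    show "finite \<Sigma>" using F by (simp add: \<Sigma>_def)
    show "\<Sigma> \<subseteq> E" using nf by (auto simp: \<Sigma>_def smaller_def)
    fix D es fs
    assume D: "eq_theory D" "\<Sigma> \<subseteq> D" "D \<subseteq> E" and len: "length es = length fs"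
      and mem: "(?w es, ?w fs) \<in> E"
    interpret D: eq_theory D by fact
    \<comment> \<open>\<open>R\<close> is the set of reducible sequences. Each member lies above
      some \<open>hs\<close> in \<open>F\<close>, and the rule for \<open>hs\<close> gives a
      lexicographically smaller sequence of the same length.\<close>
    have reduce: "\<exists>n. length n = length es \<and> n \<notin> R \<and> (?w es, ?w n) \<in> D" for es
    proof (induction es rule: wf_induct_rule[OF wf_lex[OF wf_less_than]])
      case (1 es)
      show ?case
      proof (cases "es \<in> R")
        case False
        then show ?thesis by (intro exI[of _ es]) (simp add: D.refl_mem)
      next
        case True
        then obtain hs where hs: "hs \<in> F" "list_emb (\<le>) hs es" using F(3) by blast
        have s: "(nf hs, hs) \<in> lex less_than" using nf[OF hs(1)] by (simp add: smaller_def)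
        obtain P \<theta> gs where *: "length gs = length es"
            "?w es = P @ subst_word \<theta> (?w hs)" "?w gs = P @ subst_word \<theta> (?w (nf hs))"
            "(gs, es) \<in> lex less_than"
          using letter_word_emb[OF assms(2,3) hs(2) lex_length[OF s], of 0 0] s by blast
        have "(?w hs, ?w (nf hs)) \<in> D" using D(2) hs(1) by (auto simp: \<Sigma>_def)
        then have "(?w es, ?w gs) \<in> D"
          unfolding *(2,3) by (intro D.append_mem D.refl_mem D.subst_mem)
        moreover obtain n where "length n = length gs" "n \<notin> R" "(?w gs, ?w n) \<in> D"
          using 1[OF *(4)] by blast
        ultimately show ?thesis
          using *(1) by (intro exI[of _ n]) (auto intro: D.trans_mem)
      qed
    qed
    obtain m n where m: "length m = length es" "m \<notin> R" "(?w es, ?w m) \<in> D"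
      and n: "length n = length fs" "n \<notin> R" "(?w fs, ?w n) \<in> D"
      using reduce[of es] reduce[of fs] by blast
    have "(?w m, ?w n) \<in> E"
      using m(3) n(3) mem D(3) by (blast intro: E.sym_mem E.trans_mem)
    \<comment> \<open>Two different equivalent sequences of equal length are comparable, so the
      larger one would be reducible.\<close>
    then have "m = n"
      using lex_less_than_total[of m n] m(1,2) n(1,2) len
      by (auto simp: R_def smaller_def intro: E.sym_mem)
    then show "(?w es, ?w fs) \<in> D"
      using m(3) n(3) by (blast intro: D.sym_mem D.trans_mem)
  qed
qed

section \<open>Swaps of adjacent last occurrences\<close>

lemma remdups_last: "x \<notin> set q \<Longrightarrow> \<exists>p'. remdups (p @ x # q) = p' @ x # remdups q"
proof (induction p)
  case Nil
  then show ?case by (intro exI[of _ "[]"]) simp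
next
  case (Cons a p)
  then obtain p' where p': "remdups (p @ x # q) = p' @ x # remdups q" by blast
  show ?case
  proof (cases "a \<in> set (p @ x # q)")
    case True
    then show ?thesis using p' by (intro exI[of _ p']) simp
  next
    case False
    then show ?thesis using p' by (intro exI[of _ "a # p'"]) simp
  qed
qed

lemma subseq_remdups_last:
  assumes "x \<notin> set q" "y \<in> set q" shows "subseq [x, y] (remdups (p @ x # q))"
proof -
  obtain p' where "remdups (p @ x # q) = p' @ x # remdups q"
    using remdups_last[OF assms(1)] by blast
  then show ?thesis
    using assms(2) by (simp add: subseq_pair_append subseq_pair_Cons del: subseq_Cons2_iff)
qed

text \<open>Over \<open>x\<close>, \<open>y\<close> and linear letters, the distributions of single
  letters settle the order of all last occurrences except that of \<open>x\<close> and
  \<open>y\<close>.\<close>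

lemma (in sigma_theory) two_letter_canonical:
  assumes "x \<noteq> y" "set u \<subseteq> {x, y} \<union> L" "set v \<subseteq> {x, y} \<union> L"
    and cnt: "x \<in> L \<or> 2 \<le> count_list u x" "y \<in> L \<or> 2 \<le> count_list u y"
    and rx: "res (insert x L) u = res (insert x L) v" and ry: "res (insert y L) u = res (insert y L) v"
    and xy: "subseq [x, y] (remdups u)" "subseq [x, y] (remdups v)"
  shows "(u, v) \<in> D"
proof -
  have rL: "res L u = res L v" using rx by (rule res_eq_mono) auto
  have blocks: "res (insert z L) u = res (insert z L) v" for z
  proof (cases "z \<in> {x, y}")
    case True
    then show ?thesis using rx ry by auto
  next
    case False
    then have "res (insert z L) w = res L w" if "set w \<subseteq> {x, y} \<union> L" for w
      using that by (intro filter_cong) auto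
    then show ?thesis using assms(2,3) rL by simp
  qed
  have set_eq: "set u = set v"
    using blocks by (metis count_list_res count_list_0_iff insertI1 subsetI subset_antisym)
  have "remdups u = remdups v"
  proof (rule distinct_eqI_adjacent)
    show "set (remdups u) = set (remdups v)" using set_eq by simp
    fix p a b s assume eq: "remdups u = p @ a # b # s"
    have ab: "subseq [a, b] (remdups u)"
      unfolding eq by (simp add: subseq_pair_append subseq_pair_Cons del: subseq_Cons2_iff)
    then have mem: "a \<in> set u" "b \<in> set u"
      by (auto dest: subseq_pair_set)
    then have "a \<noteq> b" using subseq_pair_antisym[of "remdups u" a b] ab by auto
    consider "\<exists>z. a \<in> insert z L \<and> b \<in> insert z L" | "a = x" "b = y" | "a = y" "b = x"
      using mem assms(2) \<open>a \<noteq> b\<close> by blast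
    then show "subseq [a, b] (remdups v)"
    proof cases
      case 1
      then show ?thesis using ab subseq_pair_filter[of a _ b] blocks by (metis remdups_res)
    next
      case 2
      then show ?thesis using xy by simp
    next
      case 3
      then show ?thesis using ab xy subseq_pair_antisym[of "remdups u" x y] by simp
    qed
  qed auto
  moreover have "2 \<le> count_list ([] @ u) b" if "b \<in> set u" "b \<notin> L" for b
    using that cnt assms(2) by auto
  ultimately have "([] @ u, [] @ v) \<in> D"
    using blocks by (intro canonical_form)
  then show ?thesis by simp
qed

text \<open>Blocks are compared by letter counts, since modulo \<open>sigma_1\<close> and
  \<open>sigma_mu\<close> the order inside a block matters for last occurrences only.\<close>

definition count_le :: "'a set \<Rightarrow> 'a list \<Rightarrow> 'a list \<Rightarrow> bool" where
  "count_le X b b' \<longleftrightarrow> (\<forall>z\<in>X. count_list b z \<le> count_list b' z)"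

lemma almost_full_count_le: "almost_full (count_le {x, y})"
proof -
  have "almost_full (\<lambda>p q :: nat \<times> nat. fst p \<le> fst q \<and> snd p \<le> snd q)"
    by (intro almost_full_prod almost_full_nat) (auto intro: transpI)
  from almost_full_comap[OF this, of "\<lambda>b. (count_list b x, count_list b y)"]
  show ?thesis by (simp add: count_le_def[abs_def])
qed

lemma transp_count_le: "transp (count_le X)"
  by (rule transpI) (auto simp: count_le_def intro: order_trans)

lemma count_list_replicate: "count_list (replicate n a) b = (if a = b then n else 0)"
  by (induction n) auto

lemma res_block:
  assumes "set b \<subseteq> X" "X \<inter> T = {}" "z \<in> X"
  shows "res (insert z T) b = replicate (count_list b z) z"
  using assms by (induction b) auto

text \<open>The analogue of \<open>letter_word_emb\<close> for two letters. Missing letters are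
  supplied in front of each block by a word \<open>c\<close>, so the image matches the larger word
  only in the distributions of \<open>x\<close> and of \<open>y\<close> separately, which is all
  that \<open>two_letter_canonical\<close> asks for.\<close>

lemma block_word_emb:
  assumes t: "inj t" "x \<notin> range t" "y \<notin> range t" and xy: "x \<noteq> y"
    and "list_emb (count_le {x, y}) bs bs'" "count_le {x, y} b b'"
    and "\<forall>c\<in>set bs. set c \<subseteq> {x, y}" "\<forall>c\<in>set bs'. set c \<subseteq> {x, y}"
    and b: "set b \<subseteq> {x, y}" "set b' \<subseteq> {x, y}"
  shows "\<exists>P \<theta>. \<theta> x = [x] \<and> \<theta> y = [y] \<and>
    set (P @ subst_word \<theta> (block_word t k bs @ b)) \<subseteq> {x, y} \<union> range t \<and>
    (\<forall>z\<in>{x, y}. res (insert z (range t)) (P @ subst_word \<theta> (block_word t k bs @ b)) =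
      res (insert z (range t)) (block_word t k' bs' @ b'))"
  using assms(5,7,8)
proof (induction bs bs' arbitrary: k k')
  case (list_emb_Nil bs')
  have pad: "\<exists>c. set c \<subseteq> {x, y} \<and> (\<forall>z\<in>{x, y}. count_list (c @ b) z = count_list b' z)"
    using assms(6) xy
    by (intro exI[of _ "replicate (count_list b' x - count_list b x) x @
        replicate (count_list b' y - count_list b y) y"])
      (auto simp: count_le_def count_list_replicate)
  then obtain c where c: "set c \<subseteq> {x, y}" "\<forall>z\<in>{x, y}. count_list (c @ b) z = count_list b' z"
    by blast
  have "res (insert z (range t)) (c @ b) = res (insert z (range t)) b'" if "z \<in> {x, y}" for z
    using res_block[of "c @ b" "{x, y}" "range t" z] res_block[of b' "{x, y}" "range t" z] b c t that
    by auto
  moreover have "set (block_word t k' bs') \<subseteq> {x, y} \<union> range t"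
    using list_emb_Nil by (auto simp: set_block_word)
  ultimately show ?case
    using b c subst_word_id[of b "\<lambda>a. [a]"]
    by (intro exI[of _ "block_word t k' bs' @ c"] exI[of _ "\<lambda>a. [a]"]) auto
next
  case (list_emb_Cons bs bs' b1)
  have pre: "\<forall>c\<in>set bs'. set c \<subseteq> {x, y}" using list_emb_Cons.prems by simp
  obtain P \<theta> where *: "\<theta> x = [x]" "\<theta> y = [y]"
      "set (P @ subst_word \<theta> (block_word t k bs @ b)) \<subseteq> {x, y} \<union> range t"
      "\<forall>z\<in>{x, y}. res (insert z (range t)) (P @ subst_word \<theta> (block_word t k bs @ b)) =
        res (insert z (range t)) (block_word t (Suc k') bs' @ b')"
    using list_emb_Cons.IH[OF list_emb_Cons.prems(1) pre, of k "Suc k'"] by blast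
  show ?case
    by (rule exI[of _ "b1 @ t k' # P"], rule exI[of _ \<theta>])
      (use * list_emb_Cons.prems(2) in auto)
next
  case (list_emb_Cons2 b1 b2 bs bs')
  have pre: "\<forall>c\<in>set bs. set c \<subseteq> {x, y}" "\<forall>c\<in>set bs'. set c \<subseteq> {x, y}"
    and b12: "set b1 \<subseteq> {x, y}" "set b2 \<subseteq> {x, y}"
    using list_emb_Cons2.prems by auto
  obtain P \<theta> where *: "\<theta> x = [x]" "\<theta> y = [y]"
      "set (P @ subst_word \<theta> (block_word t (Suc k) bs @ b)) \<subseteq> {x, y} \<union> range t"
      "\<forall>z\<in>{x, y}. res (insert z (range t)) (P @ subst_word \<theta> (block_word t (Suc k) bs @ b)) =
        res (insert z (range t)) (block_word t (Suc k') bs' @ b')"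
    using list_emb_Cons2.IH[OF pre, of "Suc k" "Suc k'"] by blast
  obtain c where c: "set c \<subseteq> {x, y}" "\<forall>z\<in>{x, y}. count_list (c @ b1) z = count_list b2 z"
  proof
    show "set (replicate (count_list b2 x - count_list b1 x) x @
        replicate (count_list b2 y - count_list b1 y) y) \<subseteq> {x, y}" by auto
    show "\<forall>z\<in>{x, y}. count_list ((replicate (count_list b2 x - count_list b1 x) x @
        replicate (count_list b2 y - count_list b1 y) y) @ b1) z = count_list b2 z"
      using list_emb_Cons2.hyps(1) xy by (auto simp: count_le_def count_list_replicate)
  qed
  have cb: "res (insert z (range t)) (c @ b1) = res (insert z (range t)) b2" if "z \<in> {x, y}" for z
    using res_block[of "c @ b1" "{x, y}" "range t" z] res_block[of b2 "{x, y}" "range t" z] b12 c t that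
    by auto
  let ?\<theta> = "\<theta>(t k := t k' # P)"
  have \<theta>xy: "?\<theta> x = [x]" "?\<theta> y = [y]" using * t by auto
  have "t k \<notin> set (block_word t (Suc k) bs @ b)"
  proof -
    have "t k \<notin> {x, y}" using t by auto
    moreover have "t k \<notin> t ` {Suc k..<Suc k + length bs}"
      using t(1) by (auto simp: inj_image_mem_iff)
    ultimately show ?thesis using pre b by (auto simp: set_block_word)
  qed
  then have "subst_word ?\<theta> (block_word t (Suc k) bs @ b) = subst_word \<theta> (block_word t (Suc k) bs @ b)"
    by (rule subst_word_upd)
  moreover have "subst_word ?\<theta> b1 = b1"
    using b12 \<theta>xy by (intro subst_word_id) auto
  ultimately have e: "c @ subst_word ?\<theta> (block_word t k (b1 # bs) @ b) =
      (c @ b1) @ t k' # (P @ subst_word \<theta> (block_word t (Suc k) bs @ b))"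
    by simp
  have 1: "set (c @ subst_word ?\<theta> (block_word t k (b1 # bs) @ b)) \<subseteq> {x, y} \<union> range t"
    unfolding e using c b12 *(3) by auto
  have 2: "\<forall>z\<in>{x, y}. res (insert z (range t)) (c @ subst_word ?\<theta> (block_word t k (b1 # bs) @ b)) =
      res (insert z (range t)) (block_word t k' (b2 # bs') @ b')"
  proof
    fix z assume z: "z \<in> {x, y}"
    have "res (insert z (range t)) (c @ subst_word ?\<theta> (block_word t k (b1 # bs) @ b)) =
        res (insert z (range t)) (c @ b1) @ t k' #
          res (insert z (range t)) (P @ subst_word \<theta> (block_word t (Suc k) bs @ b))"
      unfolding e by simp
    also have "\<dots> = res (insert z (range t)) b2 @ t k' #
        res (insert z (range t)) (block_word t (Suc k') bs' @ b')"
      using cb[OF z] bspec[OF *(4) z] by (simp only:)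
    also have "\<dots> = res (insert z (range t)) (block_word t k' (b2 # bs') @ b')"
      by simp
    finally show "res (insert z (range t)) (c @ subst_word ?\<theta> (block_word t k (b1 # bs) @ b)) =
      res (insert z (range t)) (block_word t k' (b2 # bs') @ b')" .
  qed
  show ?case
    by (rule exI[of _ c], rule exI[of _ ?\<theta>], intro conjI, rule \<theta>xy(1), rule \<theta>xy(2), rule 1, rule 2)
qed

text \<open>This makes the valid swaps an up-closed set. The image \<open>A\<close> of the smaller
  word and the larger word \<open>A'\<close> have the same distributions; followed by the same pair
  of last occurrences they are equivalent, since \<open>x\<close> and \<open>y\<close> occur in
  \<open>A\<close> and so at least twice altogether.\<close>

lemma (in sigma_theory) swap_emb:
  assumes t: "inj t" "x \<notin> range t" "y \<notin> range t" and xy: "x \<noteq> y"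
    and emb: "list_emb (count_le {x, y}) bs bs'" "count_le {x, y} b b'"
    and sets: "\<forall>c\<in>set bs. set c \<subseteq> {x, y}" "\<forall>c\<in>set bs'. set c \<subseteq> {x, y}"
      "set b \<subseteq> {x, y}" "set b' \<subseteq> {x, y}"
    and mem: "x \<in> set (block_word t 0 bs @ b)" "y \<in> set (block_word t 0 bs @ b)"
    and D: "(block_word t 0 bs @ b @ [x, y], block_word t 0 bs @ b @ [y, x]) \<in> D"
  shows "(block_word t 0 bs' @ b' @ [x, y], block_word t 0 bs' @ b' @ [y, x]) \<in> D"
proof -
  obtain P \<theta> where \<theta>: "\<theta> x = [x]" "\<theta> y = [y]"
    and sP: "set (P @ subst_word \<theta> (block_word t 0 bs @ b)) \<subseteq> {x, y} \<union> range t"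
    and rP: "\<forall>z\<in>{x, y}. res (insert z (range t)) (P @ subst_word \<theta> (block_word t 0 bs @ b)) =
      res (insert z (range t)) (block_word t 0 bs' @ b')"
    using block_word_emb[OF t xy emb sets(1,2,3,4), of 0 0] by blast
  define A where "A = P @ subst_word \<theta> (block_word t 0 bs @ b)"
  define A' where "A' = block_word t 0 bs' @ b'"
  have sA: "set A \<subseteq> {x, y} \<union> range t" using sP by (simp only: A_def)
  have sA': "set A' \<subseteq> {x, y} \<union> range t"
    using sets by (auto simp: A'_def set_block_word)
  have r: "res (insert z (range t)) A = res (insert z (range t)) A'" if "z \<in> {x, y}" for z
    using bspec[OF rP that] by (simp only: A_def A'_def)
  have "z \<in> set A" if "z \<in> set (block_word t 0 bs @ b)" "\<theta> z = [z]" for z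
    unfolding A_def set_append[of P] set_subst_word by (rule UnI2, rule UN_I[OF that(1)]) (simp add: that)
  then have "x \<in> set A" "y \<in> set A"
    using mem \<theta> by blast+
  then have cA: "count_list A x \<noteq> 0" "count_list A y \<noteq> 0"
    by (simp_all add: count_list_0_iff)
  have canon: "(A @ [u, v], A' @ [u, v]) \<in> D" if "u \<noteq> v" "{u, v} = {x, y}" for u v
  proof (rule two_letter_canonical[OF that(1)])
    show "set (A @ [u, v]) \<subseteq> {u, v} \<union> range t" "set (A' @ [u, v]) \<subseteq> {u, v} \<union> range t"
      using sA sA' that by auto
    have "count_list A u \<noteq> 0" "count_list A v \<noteq> 0"
      using cA that by (metis insert_iff singletonD)+
    then show "u \<in> range t \<or> 2 \<le> count_list (A @ [u, v]) u" "v \<in> range t \<or> 2 \<le> count_list (A @ [u, v]) v"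
      by auto
    have "u \<in> {x, y}" "v \<in> {x, y}" using that by auto
    then show "res (insert u (range t)) (A @ [u, v]) = res (insert u (range t)) (A' @ [u, v])"
      "res (insert v (range t)) (A @ [u, v]) = res (insert v (range t)) (A' @ [u, v])"
      using r[of u] r[of v] by (simp_all only: filter_append)
    show "subseq [u, v] (remdups (A @ [u, v]))" "subseq [u, v] (remdups (A' @ [u, v]))"
      using subseq_remdups_last[of u "[v]" v] that(1) by simp_all
  qed
  have "subst_word \<theta> (block_word t 0 bs @ b @ [u, v]) = subst_word \<theta> (block_word t 0 bs @ b) @ [u, v]"
    if "{u, v} = {x, y}" for u v
    using \<theta> that by (auto simp: doubleton_eq_iff)
  then have "(A @ [x, y], A @ [y, x]) \<in> D"
    using context_mem[OF subst_mem[OF D, of \<theta>], of P "[]"]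
    by (simp only: A_def append_assoc append_Nil2 insert_commute simp_thms)
  then have "(A' @ [x, y], A @ [y, x]) \<in> D"
    by (rule trans_mem[OF sym_mem[OF canon[OF xy HOL.refl]]])
  then have "(A' @ [x, y], A' @ [y, x]) \<in> D"
    using canon[of y x] xy by (auto intro: trans_mem)
  then show ?thesis by (simp add: A'_def)
qed

text \<open>The theory \<open>D\<close> is quantified after the finite set because it will later be
  the set of consequences of a basis containing that set.\<close>

lemma two_letter_basis:
  assumes "eq_theory E" and t: "inj t" "x \<notin> range t" "y \<notin> range t" and xy: "x \<noteq> y"
  shows "\<exists>\<Sigma>. finite \<Sigma> \<and> \<Sigma> \<subseteq> E \<and> (\<forall>D a0 b0 c0 d0 bs b. sigma_theory D a0 b0 c0 d0 \<longrightarrow> \<Sigma> \<subseteq> D \<longrightarrow>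
    (\<forall>c\<in>set bs. set c \<subseteq> {x, y}) \<longrightarrow> set b \<subseteq> {x, y} \<longrightarrow> {x, y} \<subseteq> set (block_word t 0 bs @ b) \<longrightarrow>
    (block_word t 0 bs @ b @ [x, y], block_word t 0 bs @ b @ [y, x]) \<in> E \<longrightarrow>
    (block_word t 0 bs @ b @ [x, y], block_word t 0 bs @ b @ [y, x]) \<in> D)"
proof -
  define e where "e p = (block_word t 0 (fst p) @ snd p @ [x, y], block_word t 0 (fst p) @ snd p @ [y, x])" for p
  define U where "U = {p. (\<forall>c\<in>set (fst p). set c \<subseteq> {x, y}) \<and> set (snd p) \<subseteq> {x, y} \<and>
    {x, y} \<subseteq> set (block_word t 0 (fst p) @ snd p) \<and> e p \<in> E}"
  have "almost_full (list_emb (count_le {x, y}))"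
    by (intro almost_full_list_emb almost_full_count_le transp_count_le)
  moreover have "transp (list_emb (count_le {x, y}))"
    by (rule transpI, rule list_emb_trans) (auto intro: transpD[OF transp_count_le])
  ultimately have "almost_full (\<lambda>p q. list_emb (count_le {x, y}) (fst p) (fst q) \<and> count_le {x, y} (snd p) (snd q))"
    by (rule almost_full_prod) (rule almost_full_count_le)
  from almost_full_finite_basis[OF this, of U]
  obtain F where F: "finite F" "F \<subseteq> U" "\<forall>u\<in>U. \<exists>f\<in>F. list_emb (count_le {x, y}) (fst f) (fst u) \<and>
      count_le {x, y} (snd f) (snd u)"
    by (elim exE conjE) (rule that)
  show ?thesis
  proof (intro exI conjI allI impI)
    show "finite (e ` F)" using F by simp
    show "e ` F \<subseteq> E" using F by (auto simp: U_def)
    fix D a0 b0 c0 d0 bs b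
    assume "sigma_theory D a0 b0 c0 d0" and "e ` F \<subseteq> D"
      and sets: "\<forall>c\<in>set bs. set c \<subseteq> {x, y}" "set b \<subseteq> {x, y}"
      and "{x, y} \<subseteq> set (block_word t 0 bs @ b)"
      and "(block_word t 0 bs @ b @ [x, y], block_word t 0 bs @ b @ [y, x]) \<in> E"
    then interpret sigma_theory D a0 b0 c0 d0 by simp
    have "(bs, b) \<in> U"
      unfolding U_def e_def mem_Collect_eq fst_conv snd_conv by (intro conjI) fact+
    then obtain cs c where f: "(cs, c) \<in> F" "list_emb (count_le {x, y}) cs bs" "count_le {x, y} c b"
      using F(3) by (metis fst_conv prod.collapse snd_conv)
    then have u: "(cs, c) \<in> U" and "e (cs, c) \<in> D" using F(2) \<open>e ` F \<subseteq> D\<close> by auto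
    then have "(block_word t 0 cs @ c @ [x, y], block_word t 0 cs @ c @ [y, x]) \<in> D"
      by (simp add: e_def)
    then show "(block_word t 0 bs @ b @ [x, y], block_word t 0 bs @ b @ [y, x]) \<in> D"
      using u sets by (intro swap_emb[OF t xy f(2,3)]) (auto simp: U_def)
  qed
qed


section \<open>Renaming letters\<close>

lemma (in eq_theory) map_mem: "(u, v) \<in> E \<Longrightarrow> (map p u, map p v) \<in> E"
proof -
  have "map p w = subst_word (\<lambda>a. [p a]) w" for w by (induction w) auto
  then show "(u, v) \<in> E \<Longrightarrow> (map p u, map p v) \<in> E" using subst_mem by metis
qed

lemma (in eq_theory) map_memD:
  assumes "(map p u, map p v) \<in> E" "inj_on p A" "set u \<subseteq> A" "set v \<subseteq> A"
  shows "(u, v) \<in> E"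
proof -
  have "map (inv_into A p) (map p w) = w" if "set w \<subseteq> A" for w
    using that assms(2) by (induction w) auto
  then show ?thesis using map_mem[OF assms(1), of "inv_into A p"] assms(3,4) by metis
qed

lemma ex_renaming:
  assumes "distinct ts" "X \<inter> set ts = {}" "inj_on q X" "q ` X \<inter> range t = {}" "inj t"
  shows "\<exists>p. (\<forall>a\<in>X. p a = q a) \<and> map p ts = map t [0..<length ts] \<and> inj_on p (X \<union> set ts)"
  using assms(1,2)
proof (induction ts rule: rev_induct)
  case Nil
  then show ?case using assms(3) by (intro exI[of _ q]) auto
next
  case (snoc a ts)
  then obtain p where p: "\<forall>a\<in>X. p a = q a" "map p ts = map t [0..<length ts]" "inj_on p (X \<union> set ts)"
    by auto
  have "p ` set ts = t ` {0..<length ts}"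
    using p(2) by (metis image_set set_upt)
  moreover have "p ` X = q ` X" using p(1) by simp
  ultimately have new: "t (length ts) \<notin> p ` (X \<union> set ts)"
  proof -
    assume "p ` set ts = t ` {0..<length ts}" "p ` X = q ` X"
    then have "p ` (X \<union> set ts) = q ` X \<union> t ` {0..<length ts}"
      by (simp add: image_Un)
    moreover have "t (length ts) \<notin> q ` X" using assms(4) by blast
    moreover have "t (length ts) \<notin> t ` {0..<length ts}"
      using assms(5) by (simp add: inj_image_mem_iff)
    ultimately show ?thesis by blast
  qed
  have a: "a \<notin> X \<union> set ts" using snoc.prems by auto
  define p' where "p' = p(a := t (length ts))"
  have p': "p' a = t (length ts)" "p' b = p b" if "b \<in> X \<union> set ts" for b
    using a that by (auto simp: p'_def)
  have p'a: "p' a = t (length ts)" by (simp add: p'_def)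
  have "inj_on p' (insert a (X \<union> set ts))"
  proof -
    have "inj_on p' (X \<union> set ts)" using inj_on_cong[of "X \<union> set ts" p' p] p(3) p'(2) by blast
    moreover have "p' ` (X \<union> set ts) = p ` (X \<union> set ts)" using p'(2) by (rule image_cong[OF HOL.refl])
    moreover have "X \<union> set ts - {a} = X \<union> set ts" using a by blast
    ultimately show ?thesis using new p'a by (simp only: inj_on_insert simp_thms)
  qed
  moreover have "map p' (ts @ [a]) = map t [0..<length (ts @ [a])]"
  proof -
    have "map p' ts = map p ts" using p'(2) by (intro map_cong) auto
    then show ?thesis using p(2) p'a by simp
  qed
  ultimately show ?case
    using p(1) p'(2) by (intro exI[of _ p']) auto
qed

lemma res_range_map:
  assumes "set w \<subseteq> X \<union> L" "p ` X \<inter> range t = {}" "X \<inter> L = {}" "map p (res L w) = map t ks"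
  shows "res (range t) (map p w) = map t ks"
proof -
  have "p c \<in> range t" if "c \<in> set w" "c \<in> L" for c
  proof -
    have "p c \<in> set (map p (res L w))" using that by simp
    then show ?thesis unfolding assms(4) by auto
  qed
  then have "filter (\<lambda>c. p c \<in> range t) w = res L w"
    using assms(1-3) by (intro filter_cong) auto
  then show ?thesis using assms(4) by (simp add: filter_map o_def)
qed

lemma map_replicate_length: "\<forall>c\<in>set bs. set c \<subseteq> {x} \<Longrightarrow> map (\<lambda>e. replicate e x) (map length bs) = bs"
proof (induction bs)
  case (Cons b bs)
  then have "replicate (length b) x = b" by (intro replicate_length_same) auto
  then show ?case using Cons by simp
qed simp

lemma distinct_count_list: "(\<And>a. a \<in> set u \<Longrightarrow> count_list u a = 1) \<Longrightarrow> distinct u"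
proof (induction u)
  case (Cons a u)
  have "a \<notin> set u" using Cons.prems[of a] by (simp add: count_list_0_iff)
  moreover have "count_list u b = 1" if "b \<in> set u" for b
    using Cons.prems[of b] that \<open>a \<notin> set u\<close> by (auto split: if_splits)
  ultimately show ?case using Cons.IH by simp
qed simp

lemma res_pair_distinct: "distinct q \<Longrightarrow> subseq [a, b] q \<Longrightarrow> res {a, b} q = [a, b]"
proof (induction q)
  case (Cons c q)
  show ?case
  proof (cases "subseq [a, b] q")
    case True
    then have "c \<noteq> a" "c \<noteq> b" using Cons.prems by (auto dest: subseq_pair_set)
    then show ?thesis using Cons True by simp
  next
    case False
    then have "c = a" "b \<in> set q" using Cons.prems by (auto simp: subseq_pair_Cons simp del: subseq_Cons2_iff)
    moreover have "res {a, b} q = [b]" if "a \<notin> set q" "distinct q" "b \<in> set q"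
      using that by (induction q) (auto simp: filter_empty_conv)
    ultimately show ?thesis using Cons.prems by simp
  qed
qed simp

lemma res_singleton: "res {a} u = replicate (count_list u a) a"
  by (induction u) auto

text \<open>The finite basis speaks about fixed letters; an injective renaming carries arbitrary
  letters to them and back.\<close>

lemma one_letter_transfer:
  assumes "eq_theory D" "eq_theory E" and t: "inj t" "x \<notin> range t"
    and basis: "\<And>es fs. length es = length fs \<Longrightarrow> (letter_word x t 0 es, letter_word x t 0 fs) \<in> E \<Longrightarrow>
      (letter_word x t 0 es, letter_word x t 0 fs) \<in> D"
    and z: "a \<notin> L" "set z \<subseteq> insert a L" "set z' \<subseteq> insert a L" "distinct (res L z)"
      "res L z = res L z'" "(z, z') \<in> E"
  shows "(z, z') \<in> D"
proof -
  interpret D: eq_theory D by fact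
  interpret E: eq_theory E by fact
  define ts where "ts = res L z"
  define n where "n = length ts"
  have "\<exists>p. (\<forall>b\<in>{a}. p b = x) \<and> map p ts = map t [0..<length ts] \<and> inj_on p ({a} \<union> set ts)"
    using z(1,4) t by (intro ex_renaming) (auto simp: ts_def)
  then obtain p where p: "p a = x" "map p ts = map t [0..<n]" "inj_on p ({a} \<union> set ts)"
    by (auto simp: n_def)
  have range_p: "p c \<in> range t" if "c \<in> set ts" for c
  proof -
    have "p c \<in> set (map p ts)" using that by simp
    then show ?thesis unfolding p(2) by auto
  qed
  \<comment> \<open>The additional letter \<open>t n\<close> closes the final block, so that the
    word becomes a \<open>letter_word\<close>. Restriction to \<open>-{t n}\<close> removes it
    afterwards.\<close>
  have word: "\<exists>es. length es = Suc n \<and> map p w @ [t n] = letter_word x t 0 es"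
    if w: "set w \<subseteq> insert a L" "res L w = ts" for w
  proof -
    have sw: "set w \<subseteq> {a} \<union> set ts" using w by auto
    have "set (map p w) \<subseteq> {x} \<union> range t" using sw p(1) range_p by auto
    moreover have "res (range t) (map p w) = map t [0..<0 + n]"
      by (rule res_range_map[of w "{a}" L]) (use w p t z(1) in auto)
    ultimately obtain bs b where b: "map p w = block_word t 0 bs @ b" "length bs = n" "set b \<subseteq> {x}"
        "\<forall>c\<in>set bs. set c \<subseteq> {x}"
      using ex_block_word[of "map p w" "{x}" t 0 n] t by auto
    have "letter_word x t 0 (map length (bs @ [b])) = block_word t 0 (bs @ [b])"
      unfolding letter_word_def using b by (subst map_replicate_length) auto
    then show ?thesis
      using b by (intro exI[of _ "map length (bs @ [b])"]) (simp add: block_word_snoc)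
  qed
  obtain es where es: "length es = Suc n" "map p z @ [t n] = letter_word x t 0 es"
    using word[of z] z by (auto simp: ts_def)
  obtain fs where fs: "length fs = Suc n" "map p z' @ [t n] = letter_word x t 0 fs"
    using word[of z'] z by (auto simp: ts_def)
  have "(map p z @ [t n], map p z' @ [t n]) \<in> E"
    by (intro E.append_mem E.map_mem E.refl_mem z)
  then have "(map p z @ [t n], map p z' @ [t n]) \<in> D"
    unfolding es(2) fs(2) using es(1) fs(1) by (intro basis) auto
  then have "(res (-{t n}) (map p z @ [t n]), res (-{t n}) (map p z' @ [t n])) \<in> D"
    by (rule D.res_mem)
  moreover have "res (-{t n}) (map p w @ [t n]) = map p w" if w: "set w \<subseteq> insert a L" "res L w = ts" for w
  proof -
    have sw: "set w \<subseteq> {a} \<union> set ts" using w by auto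
    have "t n \<notin> set (map p ts)" unfolding p(2) using t(1) by (auto dest: injD)
    moreover have "t n \<noteq> x" using t(2) by auto
    moreover have "set (map p w) \<subseteq> insert x (set (map p ts))" using sw p(1) by auto
    ultimately have "t n \<notin> set (map p w)" by blast
    then have "res (-{t n}) (map p w) = map p w" by (intro res_id) auto
    then show ?thesis by simp
  qed
  ultimately have "(map p z, map p z') \<in> D"
    using z by (simp add: ts_def)
  then show ?thesis
  proof (rule D.map_memD[OF _ p(3)])
    show "set z \<subseteq> {a} \<union> set ts" using z(2) by (auto simp: ts_def)
    show "set z' \<subseteq> {a} \<union> set ts" unfolding ts_def z(5) using z(3) by auto
  qed
qed

text \<open>Both sides are first normalized to \<open>W @ [a, b] @ s\<close> and
  \<open>W @ [b, a] @ s\<close>, where \<open>s\<close> consists of linear letters. Deleting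
  \<open>s\<close> leaves a swap at the end of a word, which after renaming is of the form that the
  basis covers.\<close>

lemma (in sigma_theory) two_letter_transfer:
  assumes "eq_theory E" "D \<subseteq> E" and t: "inj t" "x \<notin> range t" "y \<notin> range t" and xy: "x \<noteq> y"
    and basis: "\<And>bs b. \<forall>c\<in>set bs. set c \<subseteq> {x, y} \<Longrightarrow> set b \<subseteq> {x, y} \<Longrightarrow>
      {x, y} \<subseteq> set (block_word t 0 bs @ b) \<Longrightarrow>
      (block_word t 0 bs @ b @ [x, y], block_word t 0 bs @ b @ [y, x]) \<in> E \<Longrightarrow>
      (block_word t 0 bs @ b @ [x, y], block_word t 0 bs @ b @ [y, x]) \<in> D"
    and ab: "a \<noteq> b" "a \<notin> L" "b \<notin> L" and sets: "set w \<subseteq> {a, b} \<union> L" "set w' \<subseteq> {a, b} \<union> L"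
    and L: "distinct (res L w)" and cnt: "2 \<le> count_list w a" "2 \<le> count_list w b"
    and ra: "res (insert a L) w = res (insert a L) w'" and rb: "res (insert b L) w = res (insert b L) w'"
    and rd: "remdups w = F1 @ [a, b] @ F2" "set F1 \<subseteq> L" "set F2 \<subseteq> L"
    and rd': "subseq [b, a] (remdups w')" and wE: "(w, w') \<in> E"
  shows "(w, w') \<in> D"
proof -
  interpret E: eq_theory E by fact
  have dist: "distinct (F1 @ [a, b] @ F2)" using rd(1) by (metis distinct_remdups)
  have sub_ab: "subseq [a, b] (remdups w)"
    unfolding rd(1) by (simp add: subseq_pair_append subseq_pair_Cons del: subseq_Cons2_iff)
  have "b \<in> set w" using cnt(2) by (metis count_list_0_iff not_numeral_le_zero)
  then obtain A s where w: "w = A @ b # s" "b \<notin> set s"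
    by (meson split_list_last)
  have as: "a \<notin> set s"
  proof
    assume "a \<in> set s"
    then have "subseq [b, a] (remdups w)" using subseq_remdups_last[OF w(2)] w(1) by simp
    then show False using sub_ab subseq_pair_antisym[of "remdups w" a b] by simp
  qed
  have "a \<in> set A"
  proof -
    have "a \<in> set w" using cnt(1) by (metis count_list_0_iff not_numeral_le_zero)
    then show ?thesis using w as ab by auto
  qed
  then obtain A1 A2 where A: "A = A1 @ a # A2" "a \<notin> set A2"
    by (meson split_list_last)
  \<comment> \<open>Another letter between the last \<open>a\<close> and the last \<open>b\<close>
    would be linear and hence stand between them in \<open>remdups w\<close>, where they are
    neighbours.\<close>
  have A2: "set A2 \<subseteq> {b}"
  proof
    fix c assume c: "c \<in> set A2"
    show "c \<in> {b}"
    proof (rule ccontr)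
      assume "c \<notin> {b}"
      then have c': "c \<noteq> b" "c \<noteq> a" "c \<in> L" using c A w sets by auto
      have "c \<in> set (A2 @ b # s)" using c by simp
      then have 1: "subseq [a, c] (remdups w)"
        using subseq_remdups_last[of a "A2 @ b # s" c A1] w A as ab by simp
      obtain B1 B2 where B: "A2 = B1 @ c # B2" "c \<notin> set B2"
        using c by (meson split_list_last)
      have "res L w = res L (A1 @ a # B1) @ c # res L (B2 @ [b]) @ res L s"
        unfolding w A B using c' by simp
      then have "c \<notin> set (res L s)" using L by auto
      then have "c \<notin> set s" using c'(3) by simp
      then have 2: "subseq [c, b] (remdups w)"
        using subseq_remdups_last[of c "B2 @ b # s" b "A1 @ a # B1"] w A B c' by simp
      have "c \<in> set F2" using 1 dist c' unfolding rd(1)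
        by (auto simp: subseq_pair_append subseq_pair_Cons simp del: subseq_Cons2_iff dest: subseq_pair_set)
      moreover have "c \<in> set F1" using 2 dist c' unfolding rd(1)
        by (auto simp: subseq_pair_append subseq_pair_Cons simp del: subseq_Cons2_iff dest: subseq_pair_set)
      ultimately show False using dist by auto
    qed
  qed
  define W where "W = A1 @ A2"
  have sL: "set s \<subseteq> L" using sets w as by auto
  have cW: "a \<in> set W" "b \<in> set W"
  proof -
    have z: "count_list q c = 0" if "c \<notin> set q" for q and c :: 'a using that by (simp add: count_list_0_iff)
    have "count_list A1 a \<noteq> 0" "count_list (A1 @ A2) b \<noteq> 0"
      using cnt w A as ab z[of a A2] z[of a s] z[of b s] by auto
    then show "a \<in> set W" "b \<in> set W" unfolding W_def by (auto simp: count_list_0_iff)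
  qed
  then have cW': "count_list W a \<noteq> 0" "count_list W b \<noteq> 0" by (simp_all add: count_list_0_iff)
  have sW: "set W \<subseteq> {a, b} \<union> L" using sets w A by (auto simp: W_def)
  have ra': "res (insert a L) w = res (insert a L) (W @ [a, b] @ s)"
    "res (insert a L) w = res (insert a L) (W @ [b, a] @ s)"
  proof -
    have "res (insert a L) A2 = []" using A2 ab by (auto simp: filter_empty_conv)
    then show "res (insert a L) w = res (insert a L) (W @ [a, b] @ s)"
      "res (insert a L) w = res (insert a L) (W @ [b, a] @ s)"
      unfolding w A W_def using ab by auto
  qed
  have rb': "res (insert b L) w = res (insert b L) (W @ [a, b] @ s)"
    "res (insert b L) w = res (insert b L) (W @ [b, a] @ s)"
    unfolding w A W_def using ab by auto
  have 1: "(w, W @ [a, b] @ s) \<in> D"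
  proof (rule two_letter_canonical[OF ab(1) sets(1) _ _ _ ra'(1) rb'(1) sub_ab])
    show "set (W @ [a, b] @ s) \<subseteq> {a, b} \<union> L" using sW sL by auto
    show "subseq [a, b] (remdups (W @ [a, b] @ s))"
      using subseq_remdups_last[of a "b # s" b W] as ab by simp
  qed (use cnt in auto)
  have 2: "(w', W @ [b, a] @ s) \<in> D"
  proof (rule two_letter_canonical[OF ab(1)[symmetric] _ _ _ _ _ _ rd'])
    show "set w' \<subseteq> {b, a} \<union> L" using sets by auto
    show "set (W @ [b, a] @ s) \<subseteq> {b, a} \<union> L" using sW sL by auto
    show "subseq [b, a] (remdups (W @ [b, a] @ s))"
      using subseq_remdups_last[of b "a # s" a W] w(2) ab by simp
    have "count_list w' a = count_list w a" "count_list w' b = count_list w b"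
      using ra rb by (metis count_list_res insertI1)+
    then show "b \<in> L \<or> 2 \<le> count_list w' b" "a \<in> L \<or> 2 \<le> count_list w' a"
      using cnt by simp_all
    show "res (insert b L) w' = res (insert b L) (W @ [b, a] @ s)" by (rule HOL.trans[OF rb[symmetric] rb'(2)])
    show "res (insert a L) w' = res (insert a L) (W @ [b, a] @ s)" by (rule HOL.trans[OF ra[symmetric] ra'(2)])
  qed
  have E1: "(W @ [a, b] @ s, W @ [b, a] @ s) \<in> E"
    using 1 2 assms(2) wE by (meson E.sym_mem E.trans_mem subsetD)
  \<comment> \<open>No letter of \<open>s\<close> occurs in \<open>W\<close>, so restricting to the
    complement of \<open>set s\<close> deletes exactly the suffix.\<close>
  have E2: "(W @ [a, b], W @ [b, a]) \<in> E"
  proof -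
    have "set W \<inter> set s = {}"
    proof -
      have "c \<notin> set W" if "c \<in> set s" for c
        using that sL L w A ab as by (auto simp: W_def)
      then show ?thesis by blast
    qed
    then have "res (- set s) W = W" by (intro res_id) auto
    moreover have "res (- set s) s = []" by (auto simp: filter_empty_conv)
    ultimately show ?thesis
      using E.res_mem[OF E1, of "- set s"] as w(2) by simp
  qed
  define ts where "ts = res L W"
  define n where "n = length ts"
  have "distinct ts" using L ab unfolding w A W_def ts_def by auto
  then have "\<exists>p. (\<forall>c\<in>{a, b}. p c = (if c = a then x else y)) \<and> map p ts = map t [0..<length ts] \<and>
      inj_on p ({a, b} \<union> set ts)"
    using ab t xy by (intro ex_renaming) (auto simp: ts_def)
  then obtain p where p: "p a = x" "p b = y" "map p ts = map t [0..<n]" "inj_on p ({a, b} \<union> set ts)"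
    using ab by (auto simp: n_def)
  have sW': "set W \<subseteq> {a, b} \<union> set ts" using sW by (auto simp: ts_def)
  have "p c \<in> range t" if "c \<in> set ts" for c
  proof -
    have "p c \<in> set (map p ts)" using that by simp
    then show ?thesis unfolding p(3) by auto
  qed
  then have "set (map p W) \<subseteq> {x, y} \<union> range t" using sW' p(1,2) by auto
  moreover have "res (range t) (map p W) = map t [0..<0 + n]"
    by (rule res_range_map[of W "{a, b}" L]) (use sW p t ab in \<open>auto simp: ts_def\<close>)
  ultimately obtain bs c where b: "map p W = block_word t 0 bs @ c" "set c \<subseteq> {x, y}"
      "\<forall>c\<in>set bs. set c \<subseteq> {x, y}"
    using ex_block_word[of "map p W" "{x, y}" t 0 n] t by auto
  have e: "map p (W @ [a, b]) = block_word t 0 bs @ c @ [x, y]"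
      "map p (W @ [b, a]) = block_word t 0 bs @ c @ [y, x]"
    using b(1) p by simp_all
  have "(map p (W @ [a, b]), map p (W @ [b, a])) \<in> E" by (rule E.map_mem[OF E2])
  moreover have "p a \<in> set (map p W)" "p b \<in> set (map p W)" using cW by simp_all
  then have "{x, y} \<subseteq> set (block_word t 0 bs @ c)" using p b(1) by simp
  ultimately have "(map p (W @ [a, b]), map p (W @ [b, a])) \<in> D"
    unfolding e using b by (intro basis) auto
  then have "(W @ [a, b], W @ [b, a]) \<in> D"
    by (rule map_memD[OF _ p(4)]) (use sW' in auto)
  then have "((W @ [a, b]) @ s, (W @ [b, a]) @ s) \<in> D"
    by (rule append_mem[OF _ refl_mem])
  then have "(W @ [a, b] @ s, W @ [b, a] @ s) \<in> D" by simp
  then show ?thesis using 1 2 by (meson sym_mem trans_mem)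
qed

text \<open>Under commutativity a word can be sorted letter by letter, so an identity follows from
  its restrictions to single letters.\<close>

lemma (in eq_theory) commutative_mem:
  assumes comm: "\<And>u v. (u @ v, v @ u) \<in> E"
    and letters: "\<And>a. (res {a} u, res {a} v) \<in> E"
  shows "(u, v) \<in> E"
proof -
  have split: "(res (insert a S) w, res {a} w @ res S w) \<in> E" if "a \<notin> S" for a S w
  proof (induction w)
    case (Cons c w)
    show ?case
    proof (cases "c \<in> S")
      case False
      then show ?thesis using append_mem[OF refl_mem[of "[c]"] Cons] Cons by auto
    next
      case True
      then have "c \<noteq> a" using that by auto
      have "([c] @ res (insert a S) w, [c] @ (res {a} w @ res S w)) \<in> E"
        by (intro append_mem refl_mem Cons)
      also have "([c] @ (res {a} w @ res S w), (res {a} w @ [c]) @ res S w) \<in> E"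
        using append_mem[OF comm[of "[c]" "res {a} w"] refl_mem[of "res S w"]] by simp
      finally show ?thesis using True \<open>c \<noteq> a\<close> by simp
    qed
  qed (simp add: refl_mem)
  have "(res S u, res S v) \<in> E" if "finite S" for S
    using that
  proof induction
    case (insert a S)
    have "(res (insert a S) u, res {a} u @ res S u) \<in> E" by (rule split) fact
    also have "(res {a} u @ res S u, res {a} v @ res S v) \<in> E"
      by (intro append_mem letters insert)
    also have "(res {a} v @ res S v, res (insert a S) v) \<in> E" by (rule sym_mem[OF split]) fact
    finally show ?case .
  qed (simp add: refl_mem)
  from this[of "set u \<union> set v"] show ?thesis by (simp add: res_id)
qed

theorem sigma_theory_finitely_based:
  fixes E :: "'a::infinite identity set"
  assumes "sigma_theory E a0 b0 c0 d0"
  shows "\<exists>\<Sigma>. finite \<Sigma> \<and> \<Sigma> \<subseteq> E \<and> (\<forall>(u, v)\<in>E. deducible \<Sigma> u v)"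
proof -
  interpret E: sigma_theory E a0 b0 c0 d0 by fact
  obtain f :: "nat \<Rightarrow> 'a" where f: "inj f"
    using infinite_countable_subset[OF infinite_UNIV] by blast
  define x y t where "x = f 0" and "y = f 1" and "t n = f (n + 2)" for n
  have t: "inj t" "x \<notin> range t" "y \<notin> range t" and xy: "x \<noteq> y"
    using f by (auto simp: x_def y_def t_def inj_def)
  have E: "eq_theory E" by (rule E.eq_theory_axioms)
  obtain SA where SA: "finite SA" "SA \<subseteq> E"
    "\<And>D es fs. eq_theory D \<Longrightarrow> SA \<subseteq> D \<Longrightarrow> D \<subseteq> E \<Longrightarrow>
    length es = length fs \<Longrightarrow> (letter_word x t 0 es, letter_word x t 0 fs) \<in> E \<Longrightarrow>
    (letter_word x t 0 es, letter_word x t 0 fs) \<in> D"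
    using one_letter_basis[OF E t(1,2)] by blast
  obtain SB where SB: "finite SB" "SB \<subseteq> E"
    "\<And>D a0 b0 c0 d0 bs b. sigma_theory D a0 b0 c0 d0 \<Longrightarrow> SB \<subseteq> D \<Longrightarrow>
    \<forall>c\<in>set bs. set c \<subseteq> {x, y} \<Longrightarrow> set b \<subseteq> {x, y} \<Longrightarrow> {x, y} \<subseteq> set (block_word t 0 bs @ b) \<Longrightarrow>
    (block_word t 0 bs @ b @ [x, y], block_word t 0 bs @ b @ [y, x]) \<in> E \<Longrightarrow>
    (block_word t 0 bs @ b @ [x, y], block_word t 0 bs @ b @ [y, x]) \<in> D"
    using two_letter_basis[OF E t xy] by blast
  \<comment> \<open>If no such exponent exists, \<open>k\<close> is arbitrary; the intersection with
    \<open>E\<close> in the next definition keeps the basis inside \<open>E\<close> in any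
    case.\<close>
  define k where "k = (SOME k. 2 \<le> k \<and> ([x], replicate k x) \<in> E)"
  define \<Sigma> where "\<Sigma> = {sigma_1 a0 b0 c0 d0, sigma_mu a0 b0 c0 d0} \<union> SA \<union> SB \<union>
    ({([x, y], [y, x]), ([x], replicate k x)} \<inter> E)"
  define D where "D = {(u, v). deducible \<Sigma> u v}"
  have fin: "finite \<Sigma>" using SA SB by (simp add: \<Sigma>_def)
  have \<Sigma>E: "\<Sigma> \<subseteq> E" using SA SB E.sigma_1_mem E.sigma_mu_mem by (auto simp: \<Sigma>_def)
  have DE: "D \<subseteq> E" using E.deducible_imp_mem[OF _ \<Sigma>E] by (auto simp: D_def)
  have \<Sigma>D: "\<Sigma> \<subseteq> D" by (auto simp: D_def intro: deducible_mem)
  have D: "eq_theory D" unfolding D_def by (rule eq_theory_deducible)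
  have DS: "sigma_theory D a0 b0 c0 d0"
    using D \<Sigma>D E.dist by (auto simp: sigma_theory_def sigma_theory_axioms_def \<Sigma>_def)
  interpret D: sigma_theory D a0 b0 c0 d0 by (rule DS)
  have SAD: "SA \<subseteq> D" and SBD: "SB \<subseteq> D" using \<Sigma>D by (auto simp: \<Sigma>_def)
  have one: "(z, z') \<in> D" if "a \<notin> L" "set z \<subseteq> insert a L" "set z' \<subseteq> insert a L" "distinct (res L z)"
      "res L z = res L z'" "(z, z') \<in> E" for a L z z'
    by (rule one_letter_transfer[OF D E t(1,2) SA(3)[OF D SAD DE] that])
  interpret R: reduction D a0 b0 c0 d0 E
  proof
    fix a L z z' assume "a \<notin> L" "set z \<subseteq> insert a L" "set z' \<subseteq> insert a L" "distinct (res L z)"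
      "res L z = res L z'" "(z, z') \<in> E"
    then show "(z, z') \<in> D" by (rule one)
  next
    fix a b L w w' F1 F2
    assume asm: "a \<noteq> b" "a \<notin> L" "b \<notin> L" "set w \<subseteq> {a, b} \<union> L" "set w' \<subseteq> {a, b} \<union> L"
      "distinct (res L w)" "2 \<le> count_list w a" "2 \<le> count_list w b"
      "res (insert a L) w = res (insert a L) w'" "res (insert b L) w = res (insert b L) w'"
      "remdups w = F1 @ [a, b] @ F2" "set F1 \<subseteq> L" "set F2 \<subseteq> L" "subseq [b, a] (remdups w')"
      "(w, w') \<in> E"
    show "(w, w') \<in> D"
      by (rule D.two_letter_transfer[OF E DE t xy SB(3)[OF DS SBD] asm])
  qed (rule DE)
  have "(u, v) \<in> D" if uv: "(u, v) \<in> E" for u v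
  proof (cases "([x, y], [y, x]) \<in> E")
    case True
    then have "([x, y], [y, x]) \<in> D" using \<Sigma>D by (auto simp: \<Sigma>_def)
    from D.subst_mem[OF this, of "\<lambda>c. if c = x then _ else _"]
    have "(p @ q, q @ p) \<in> D" for p q
      using xy by auto
    moreover have "(res {a} u, res {a} v) \<in> D" for a
      using E.res_mem[OF uv, of "{a}"] by (intro one[of a "{}"]) auto
    ultimately show ?thesis by (rule D.commutative_mem)
  next
    case noncomm: False
    have comm: False if "([a, b], [b, a]) \<in> E" "a \<noteq> b" for a b
      using noncomm E.subst_mem[OF that(1), of "\<lambda>c. if c = a then [x] else [y]"] that(2) by simp
    have power: "(replicate m x, replicate n x) \<in> E" if "(replicate m a, replicate n a) \<in> E" for m n a
      using E.map_mem[OF that, of "\<lambda>_. x"] by (simp add: map_replicate_const)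
    \<comment> \<open>An identity that loses a letter yields \<open>a^m \<approx> 1\<close>. Then
      \<open>s\<close> is equal to 1 and contains both \<open>x\<close> and \<open>y\<close>, so
      \<open>swap\<close> in front of it would give \<open>x y \<approx> y x\<close>.\<close>
    have sub: "set u \<subseteq> set v" if uv: "(u, v) \<in> E" for u v
    proof
      fix a assume "a \<in> set u"
      show "a \<in> set v"
      proof (rule ccontr)
        assume "a \<notin> set v"
        define m where "m = count_list u a"
        have m: "m \<noteq> 0" using \<open>a \<in> set u\<close> by (simp add: m_def count_list_0_iff)
        have "count_list v a = 0" using \<open>a \<notin> set v\<close> by (simp add: count_list_0_iff)
        then have "(replicate m a, []) \<in> E"
          using E.res_mem[OF uv, of "{a}"] unfolding res_singleton m_def by simp
        then have one: "(replicate m c, []) \<in> E" for c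
          using E.map_mem[of "replicate m a" "[]" "\<lambda>_. c"] by (simp add: map_replicate_const)
        define s where "s = replicate m x @ replicate m y"
        have s: "(s, []) \<in> E"
          using E.append_mem[OF one[of x] one[of y]] by (simp add: s_def)
        have "([x, y] @ s, [y, x] @ s) \<in> E"
          using E.swap[of x s y "[]"] m by (simp add: s_def)
        moreover have "(w @ s, w) \<in> E" for w
          using E.append_mem[OF E.refl_mem[of w] s] by simp
        ultimately have "([x, y], [y, x]) \<in> E"
          by (meson E.sym_mem E.trans_mem)
        then show False using noncomm by simp
      qed
    qed
    have set_eq: "set u = set v"
      using sub[OF uv] sub[OF E.sym_mem[OF uv]] by blast
    show ?thesis
    proof (cases "\<exists>k\<ge>2. ([x], replicate k x) \<in> E")
      case True
      then have k: "2 \<le> k" "([x], replicate k x) \<in> E"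
        unfolding k_def by (metis (mono_tags, lifting) someI_ex)+
      then have "([x], replicate k x) \<in> D" using \<Sigma>D by (auto simp: \<Sigma>_def)
      then have kD: "([a], replicate k a) \<in> D" for a
        using D.map_mem[of "[x]" "replicate k x" "\<lambda>_. a"] by (simp add: map_replicate_const)
      \<comment> \<open>Replacing each letter by its \<open>k\<close>-th power leaves no linear
        letters, so the reduction applies with \<open>L = {}\<close>.\<close>
      define g where "g w = subst_word (\<lambda>a. replicate k a) w" for w :: "'a list"
      have gD: "(w, g w) \<in> D" for w
        using D.subst_mem_pointwise[of w "\<lambda>a. [a]" "\<lambda>a. replicate k a"] kD
        by (simp add: g_def subst_word_id)
      have cg: "2 \<le> count_list (g w) b" if "b \<in> set (g w)" for w b
      proof -
        have "b \<in> set w" using that by (auto simp: g_def set_subst_word split: if_splits)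
        then have "k \<le> count_list (g w) b"
          by (induction w) (auto simp: g_def count_list_replicate)
        then show ?thesis using k(1) by simp
      qed
      have "(g u, g v) \<in> E" unfolding g_def by (rule E.subst_mem[OF uv])
      moreover have sg: "set (g u) = set (g v)" using set_eq by (simp add: g_def set_subst_word)
      ultimately have "(g u, g v) \<in> D"
        by (rule R.same_linear_part[of _ _ "{}"]) (use cg sg in auto)
      then show ?thesis using gD by (meson D.sym_mem D.trans_mem)
    next
      case False
      \<comment> \<open>A letter that is linear on one side only would give
        \<open>x \<approx> x^k\<close> with \<open>k \<ge> 2\<close>, which is excluded
        here.\<close>
      have lin: "count_list v a = 1" if uv: "(u, v) \<in> E" and c: "count_list u a = 1" for u v a
      proof -
        have "a \<in> set u" using c by (metis count_list_0_iff zero_neq_one)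
        then have "count_list v a \<noteq> 0" using sub[OF uv] by (auto simp: count_list_0_iff)
        moreover have "(replicate 1 a, replicate (count_list v a) a) \<in> E"
          using E.res_mem[OF uv, of "{a}"] c unfolding res_singleton by simp
        then have "(replicate 1 x, replicate (count_list v a) x) \<in> E"
          by (rule power)
        then have "\<not> 2 \<le> count_list v a" using False by auto
        ultimately show ?thesis by simp
      qed
      define L where "L = {a. count_list u a = 1}"
      have lin_iff: "count_list v a = 1 \<longleftrightarrow> a \<in> L" for a
        using lin[OF uv] lin[OF E.sym_mem[OF uv]] by (auto simp: L_def)
      have dv: "distinct (res L v)"
        by (rule distinct_count_list) (use lin_iff in \<open>auto simp: count_list_res\<close>)
      have du: "distinct (res L u)"
      proof (rule distinct_count_list)
        fix a assume "a \<in> set (res L u)"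
        then have a: "a \<in> L" by simp
        then show "count_list (res L u) a = 1"
          unfolding count_list_res[OF a] by (simp add: L_def)
      qed
      have "res L u = res L v"
      proof (rule distinct_eqI_adjacent[OF du dv])
        show "set (res L u) = set (res L v)" using set_eq by simp
        fix p a b s assume eq: "res L u = p @ a # b # s"
        have ab: "subseq [a, b] (res L u)"
          unfolding eq by (simp add: subseq_pair_append subseq_pair_Cons del: subseq_Cons2_iff)
        then have mem: "a \<in> L" "b \<in> L" "a \<in> set v" "b \<in> set v"
          using subseq_pair_set[OF ab] set_eq by auto
        have "a \<noteq> b" using du eq by auto
        \<comment> \<open>Two linear letters in different orders would give commutativity by
          restriction to these letters.\<close>
        show "subseq [a, b] (res L v)"
        proof (rule ccontr)
          assume "\<not> ?thesis"
          then have ba: "subseq [b, a] (res L v)"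
            using subseq_pair_total[of a "res L v" b] mem \<open>a \<noteq> b\<close> by auto
          have *: "res {a, b} w = res {a, b} (res L w)" for w
            using mem by (simp, intro filter_cong) auto
          have "res {a, b} u = [a, b]" using res_pair_distinct[OF du ab] *[of u] by metis
          moreover have "res {a, b} v = [b, a]"
            using res_pair_distinct[OF dv ba] *[of v] by (metis insert_commute)
          ultimately show False
            using E.res_mem[OF uv, of "{a, b}"] comm \<open>a \<noteq> b\<close> by metis
        qed
      qed
      moreover have "2 \<le> count_list u b" if "b \<in> set v" "b \<notin> L" for b
      proof -
        have "count_list u b \<noteq> 0" using that(1) set_eq by (simp add: count_list_0_iff)
        moreover have "count_list u b \<noteq> 1" using that(2) by (simp add: L_def)
        ultimately show ?thesis by linarith
      qed
      moreover have "2 \<le> count_list v b" if "b \<in> set v" "b \<notin> L" for b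
      proof -
        have "count_list v b \<noteq> 0" using that(1) by (simp add: count_list_0_iff)
        moreover have "count_list v b \<noteq> 1" using that(2) lin_iff by simp
        ultimately show ?thesis by linarith
      qed
      ultimately show ?thesis
        by (intro R.same_linear_part[OF uv set_eq dv])
    qed
  qed
  then show ?thesis
    using fin \<Sigma>E by (intro exI[of _ \<Sigma>]) (auto simp: D_def)
qed

section \<open>Isoterms\<close>

text \<open>Each letter is paired with the number of its earlier occurrences, \<open>p\<close> being
  the reversed prefix already read. This makes the entries distinct, so that words with repetitions
  come within reach of \<open>distinct_eqI_adjacent\<close>.\<close>

fun occ :: "'a list \<Rightarrow> 'a list \<Rightarrow> ('a \<times> nat) list" where
  "occ p [] = []"
| "occ p (a # u) = (a, count_list p a) # occ (a # p) u"

lemma map_fst_occ: "map fst (occ p u) = u"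
  by (induction u arbitrary: p) auto

lemma set_occ: "set (occ p u) = {(a, k). count_list p a \<le> k \<and> k < count_list p a + count_list u a}"
  by (induction u arbitrary: p) (auto split: if_splits)

lemma distinct_occ: "distinct (occ p u)"
  by (induction u arbitrary: p) (auto simp: set_occ)

lemma res_occ:
  "(\<And>a. a \<in> A \<Longrightarrow> count_list p a = count_list p' a) \<Longrightarrow>
    res {q. fst q \<in> A} (occ p u) = occ p' (res A u)"
proof (induction u arbitrary: p p')
  case (Cons a u)
  have "res {q. fst q \<in> A} (occ (a # p) u) = occ (if a \<in> A then a # p' else p') (res A u)"
    by (rule Cons.IH) (use Cons.prems in auto)
  then show ?case using Cons.prems[of a] by simp
qed simp

text \<open>Isoterms relative to a theory; for the identities of a monoid these are its isoterms
  (\<open>rigid_identities\<close>).\<close>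

definition rigid :: "'a identity set \<Rightarrow> 'a list \<Rightarrow> bool" where
  "rigid E u \<longleftrightarrow> (\<forall>v. (u, v) \<in> E \<longrightarrow> v = u)"

lemma rigidD: "rigid E u \<Longrightarrow> (u, v) \<in> E \<Longrightarrow> v = u"
  by (simp add: rigid_def)

context eq_theory
begin

lemma rigid_factor: "rigid E (p @ u @ s) \<Longrightarrow> rigid E u"
  using context_mem by (fastforce simp: rigid_def)

lemma rigid_Nil: "rigid E u \<Longrightarrow> rigid E []"
  using rigid_factor[of "[]" "[]" u] by simp

text \<open>A new letter would survive a restriction that empties \<open>u\<close>; but the empty
  word is a factor of the isoterm \<open>w\<close>, hence an isoterm.\<close>

lemma rigid_set:
  assumes "rigid E w" "(u, v) \<in> E" shows "set v \<subseteq> set u"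
proof
  fix c assume c: "c \<in> set v"
  show "c \<in> set u"
  proof (rule ccontr)
    assume "c \<notin> set u"
    then have "res {c} u = []" by (auto simp: filter_empty_conv)
    then have "([], res {c} v) \<in> E" using res_mem[OF assms(2), of "{c}"] by simp
    then have "res {c} v = []" using rigidD[OF rigid_Nil[OF assms(1)]] by blast
    then show False using c by (auto simp: filter_empty_conv)
  qed
qed

lemma rigid_map:
  assumes "rigid E u" "inj_on p (set u)"
  shows "rigid E (map p u)"
  unfolding rigid_def
proof (intro allI impI)
  fix v assume v: "(map p u, v) \<in> E"
  let ?q = "inv_into (set u) p"
  have sub: "set v \<subseteq> p ` set u" using rigid_set[OF assms(1) v] by simp
  have "map ?q (map p u) = u"
    using assms(2) by (simp add: map_idI)
  then have "map ?q v = u"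
    using rigidD[OF assms(1)] map_mem[OF v, of ?q] by simp
  moreover have "map p (map ?q v) = v"
    using sub by (simp add: map_idI f_inv_into_f subset_iff)
  ultimately show "v = map p u" by metis
qed

text \<open>Isoterm restrictions fix the number of occurrences of each letter and the order of each
  adjacent pair of numbered occurrences, and these determine the word.\<close>

lemma rigid_local:
  assumes nil: "rigid E []"
    and letters: "\<And>a. a \<in> set u \<Longrightarrow> \<exists>A. a \<in> A \<and> rigid E (res A u)"
    and adj: "\<And>p a b s. u = p @ a # b # s \<Longrightarrow> \<exists>A. a \<in> A \<and> b \<in> A \<and> rigid E (res A u)"
  shows "rigid E u"
  unfolding rigid_def
proof (intro allI impI)
  fix v assume v: "(u, v) \<in> E"
  have eq: "res A v = res A u" if "rigid E (res A u)" for A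
    using rigidD[OF that res_mem[OF v]] .
  have cnt: "count_list v c = count_list u c" for c
  proof (cases "c \<in> set u")
    case True
    then show ?thesis using letters eq by (metis count_list_res)
  next
    case False
    then have "c \<notin> set v" using rigid_set[OF nil v] by blast
    then show ?thesis using False by (simp add: count_list_0_iff)
  qed
  have "occ [] u = occ [] v"
  proof (rule distinct_eqI_adjacent[OF distinct_occ distinct_occ])
    show "set (occ [] u) = set (occ [] v)" by (simp add: set_occ cnt)
    fix P q r S assume occ: "occ [] u = P @ q # r # S"
    have "u = map fst (occ [] u)" by (rule map_fst_occ[symmetric])
    also have "\<dots> = map fst P @ fst q # fst r # map fst S" unfolding occ by simp
    finally have "\<exists>A. fst q \<in> A \<and> fst r \<in> A \<and> rigid E (res A u)" by (rule adj)
    then obtain A where A: "fst q \<in> A" "fst r \<in> A" "rigid E (res A u)" by blast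
    have "subseq [q, r] (occ [] u)"
      unfolding occ by (simp add: subseq_pair_append subseq_pair_Cons del: subseq_Cons2_iff)
    then have "subseq [q, r] (res {q. fst q \<in> A} (occ [] u))"
      by (rule iffD2[OF subseq_pair_filter, rotated -1]) (use A in auto)
    also have "res {q. fst q \<in> A} (occ [] u) = res {q. fst q \<in> A} (occ [] v)"
      using res_occ[of A "[]" "[]"] eq[OF A(3)] by metis
    finally show "subseq [q, r] (occ [] v)"
      by (rule iffD1[OF subseq_pair_filter, rotated -1]) (use A in auto)
  qed
  then show "v = u" by (metis map_fst_occ)
qed

end

lemma res_ConsE:
  assumes "res A v = a # r"
  obtains w v' where "v = w @ a # v'" "set w \<inter> A = {}" "res A v' = r"
  using filter_eq_ConsD[OF assms] by blast

lemma res_eq3E: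
  assumes "res A v = [a, b, c]"
  obtains w0 w1 w2 w3 where "v = w0 @ a # w1 @ b # w2 @ c # w3"
    "set (w0 @ w1 @ w2 @ w3) \<inter> A = {}"
proof -
  obtain w0 v0 where 0: "v = w0 @ a # v0" "set w0 \<inter> A = {}" "res A v0 = [b, c]"
    using assms by (rule res_ConsE)
  obtain w1 v1 where 1: "v0 = w1 @ b # v1" "set w1 \<inter> A = {}" "res A v1 = [c]"
    using 0(3) by (rule res_ConsE)
  obtain w2 w3 where 2: "v1 = w2 @ c # w3" "set w2 \<inter> A = {}" "res A w3 = []"
    using 1(3) by (rule res_ConsE)
  have "set w3 \<inter> A = {}" using 2(3) by (auto simp: filter_empty_conv)
  then show thesis using that[of w0 w1 w2 w3] 0 1 2 by auto
qed

lemma res_eq4E: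
  assumes "res A v = [a, b, c, d]"
  obtains w0 w1 w2 w3 w4 where "v = w0 @ a # w1 @ b # w2 @ c # w3 @ d # w4"
    "set (w0 @ w1 @ w2 @ w3 @ w4) \<inter> A = {}"
proof -
  obtain w0 v0 where 0: "v = w0 @ a # v0" "set w0 \<inter> A = {}" "res A v0 = [b, c, d]"
    using assms by (rule res_ConsE)
  obtain w1 w2 w3 w4 where "v0 = w1 @ b # w2 @ c # w3 @ d # w4"
      "set (w1 @ w2 @ w3 @ w4) \<inter> A = {}"
    using 0(3) by (rule res_eq3E)
  then show thesis using that[of w0 w1 w2 w3 w4] 0 by auto
qed

lemma split_two_eq:
  assumes "A @ t # B @ s # C = A' @ t # B' @ s # C'" "{t, s} \<inter> set (A @ B @ C) = {}" "t \<noteq> s"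
  shows "A = A' \<and> B = B' \<and> C = C'"
proof -
  have "A = A' \<and> B @ s # C = B' @ s # C'"
    using append_Cons_eq_iff[of t A "B @ s # C"] assms by auto
  moreover have "B = B' \<and> C = C'" if "B @ s # C = B' @ s # C'"
    using append_Cons_eq_iff[of s B C] assms that by auto
  ultimately show ?thesis by blast
qed

text \<open>The isoterm \<open>x t x\<close> is the common ground of all arguments about isoterms:
  it is available for both sets that are not finitely based, and an adjacent pair of different
  non-linear letters in an isoterm implies it (\<open>xtx_rigid_of_adjacent\<close>).\<close>

locale xtx_theory = eq_theory E for E :: "'a identity set" +
  fixes x0 t0 :: 'a
  assumes xt: "x0 \<noteq> t0" and xtx0: "rigid E [x0, t0, x0]"
begin

lemma xtx: "a \<noteq> b \<Longrightarrow> rigid E [a, b, a]"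
  using rigid_map[OF xtx0, of "(\<lambda>_. a)(t0 := b)"] xt by (auto simp: inj_on_def)

lemma nil: "rigid E []"
  using xtx0 by (rule rigid_Nil)

lemma pair: "a \<noteq> b \<Longrightarrow> rigid E [a, b]"
  using rigid_factor[of "[]" "[a, b]" "[a]"] xtx[of a b] by simp

lemma single: "rigid E [a]"
  using rigid_factor[of "[]" "[x0]" "[t0, x0]"] xtx0 rigid_map[of "[x0]" "\<lambda>_. a"] by simp

lemma atsa:
  assumes "distinct [a, t, s]" shows "rigid E [a, t, s, a]"
proof (rule rigid_local[OF nil])
  have r: "res {a, t} [a, t, s, a] = [a, t, a]" "res {a, s} [a, t, s, a] = [a, s, a]"
    "res {t, s} [a, t, s, a] = [t, s]" using assms by auto
  have R: "rigid E (res {a, t} [a, t, s, a])" "rigid E (res {a, s} [a, t, s, a])"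
    "rigid E (res {t, s} [a, t, s, a])"
    unfolding r using assms xtx pair by auto
  show "\<exists>A. c \<in> A \<and> rigid E (res A [a, t, s, a])" if "c \<in> set [a, t, s, a]" for c
  proof -
    from that consider "c \<in> {a, t}" | "c \<in> {a, s}" by auto
    then show ?thesis by cases (rule exI, rule conjI, assumption, rule R)+
  qed
  show "\<exists>A. c \<in> A \<and> d \<in> A \<and> rigid E (res A [a, t, s, a])" if "[a, t, s, a] = p @ c # d # q" for p c d q
  proof -
    from that consider "c \<in> {a, t}" "d \<in> {a, t}" | "c \<in> {t, s}" "d \<in> {t, s}"
      | "c \<in> {a, s}" "d \<in> {a, s}"
      by (auto simp: Cons_eq_append_conv)
    then show ?thesis by cases (rule exI, intro conjI, assumption, assumption, rule R)+
  qed
qed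

text \<open>\<open>rigid_local\<close> does not suffice, as the restriction \<open>a b b\<close> is
  not known to be an isoterm. The restrictions to \<open>b, t\<close> and \<open>a, t\<close> leave
  two places for \<open>a\<close>; the wrong one would give \<open>a b b \<approx> b a b\<close>,
  although \<open>b a b\<close> is an isoterm. The next lemma is the mirror image.\<close>

lemma abtb:
  assumes "distinct [a, b, t]" shows "rigid E [a, b, t, b]"
  unfolding rigid_def
proof (intro allI impI)
  fix v assume v: "([a, b, t, b], v) \<in> E"
  have "res {b, t} v = [b, t, b]"
    using res_mem[OF v, of "{b, t}"] assms by (intro rigidD[OF xtx]) auto
  then obtain w0 w1 w2 w3 where v1: "v = w0 @ b # w1 @ t # w2 @ b # w3"
      and w: "set (w0 @ w1 @ w2 @ w3) \<inter> {b, t} = {}"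
    by (rule res_eq3E)
  have "set v \<subseteq> {a, b, t}" using rigid_set[OF nil v] by auto
  then have w': "\<forall>c\<in>set (w0 @ w1 @ w2 @ w3). c = a" using w v1 by auto
  have "res {a, t} v = [a, t]"
    using res_mem[OF v, of "{a, t}"] assms by (intro rigidD[OF pair]) auto
  then have "w0 @ w1 @ [t] @ w2 @ w3 = [a, t]"
    using w w' assms unfolding v1 by (auto simp: res_id)
  then have ww: "w0 @ w1 = [a]" "w2 = []" "w3 = []"
    using w w' assms by (auto simp: append_eq_Cons_conv Cons_eq_append_conv)
  have "w1 = []"
  proof (rule ccontr)
    assume "w1 \<noteq> []"
    then have "w0 = []" "w1 = [a]" using ww(1) by (auto simp: append_eq_Cons_conv)
    then have "([a, b, b], [b, a, b]) \<in> E"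
      using res_mem[OF v, of "{a, b}"] assms ww v1 by auto
    then have "([b, a, b], [a, b, b]) \<in> E" by (rule sym_mem)
    then show False using rigidD[OF xtx[of b a]] assms by auto
  qed
  then show "v = [a, b, t, b]" using ww v1 by simp
qed

lemma btba:
  assumes "distinct [a, b, t]" shows "rigid E [b, t, b, a]"
  unfolding rigid_def
proof (intro allI impI)
  fix v assume v: "([b, t, b, a], v) \<in> E"
  have "res {b, t} v = [b, t, b]"
    using res_mem[OF v, of "{b, t}"] assms by (intro rigidD[OF xtx]) auto
  then obtain w0 w1 w2 w3 where v1: "v = w0 @ b # w1 @ t # w2 @ b # w3"
      and w: "set (w0 @ w1 @ w2 @ w3) \<inter> {b, t} = {}"
    by (rule res_eq3E)
  have "set v \<subseteq> {a, b, t}" using rigid_set[OF nil v] by auto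
  then have w': "\<forall>c\<in>set (w0 @ w1 @ w2 @ w3). c = a" using w v1 by auto
  have "res {a, t} v = [t, a]"
    using res_mem[OF v, of "{a, t}"] assms by (intro rigidD[OF pair]) auto
  then have "w0 @ w1 @ [t] @ w2 @ w3 = [t, a]"
    using w w' assms unfolding v1 by (auto simp: res_id)
  then have ww: "w2 @ w3 = [a]" "w0 = []" "w1 = []"
    using w w' assms by (auto simp: append_eq_Cons_conv Cons_eq_append_conv)
  have "w2 = []"
  proof (rule ccontr)
    assume "w2 \<noteq> []"
    then have "w3 = []" "w2 = [a]" using ww(1) by (auto simp: append_eq_Cons_conv)
    then have "([b, b, a], [b, a, b]) \<in> E"
      using res_mem[OF v, of "{a, b}"] assms ww v1 by auto
    then have "([b, a, b], [b, b, a]) \<in> E" by (rule sym_mem)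
    then show False using rigidD[OF xtx[of b a]] assms by auto
  qed
  then show "v = [b, t, b, a]" using ww v1 by simp
qed

text \<open>Restriction to \<open>x, t, s\<close> fixes \<open>x t x s\<close>, restriction to
  \<open>y, t, s\<close> fixes \<open>t y s y\<close>; free is only the order of \<open>x\<close>
  and \<open>y\<close> between \<open>t\<close> and \<open>s\<close>. Thus the word is an isoterm as
  soon as \<open>sigma_mu\<close> fails. The next two lemmas do the same for \<open>sigma_1\<close>
  and \<open>sigma_2\<close>.\<close>

lemma sigma_mu_partner:
  assumes d: "distinct [x, y, t, s]" and v: "(u, v) \<in> E"
    and u: "u = [x, t, x, y, s, y] \<or> u = [x, t, y, x, s, y]"
  shows "v = [x, t, x, y, s, y] \<or> v = [x, t, y, x, s, y]"
proof -
  have "res {x, t, s} v = [x, t, x, s]"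
    using res_mem[OF v, of "{x, t, s}"] u d by (intro rigidD[OF btba]) auto
  then obtain w0 w1 w2 w3 w4 where v1: "v = w0 @ x # w1 @ t # w2 @ x # w3 @ s # w4"
      and w: "set (w0 @ w1 @ w2 @ w3 @ w4) \<inter> {x, t, s} = {}"
    by (rule res_eq4E)
  have "set v \<subseteq> {x, y, t, s}" using rigid_set[OF nil v] u by auto
  then have w': "\<forall>c\<in>set (w0 @ w1 @ w2 @ w3 @ w4). c = y" using w v1 by auto
  have "res {y, t, s} v = [t, y, s, y]"
    using res_mem[OF v, of "{y, t, s}"] u d by (intro rigidD[OF abtb]) auto
  moreover have "res {y, t, s} v = w0 @ w1 @ [t] @ (w2 @ w3) @ [s] @ w4"
    using w' d unfolding v1 by (auto simp: res_id)
  ultimately have "(w0 @ w1) @ t # (w2 @ w3) @ s # w4 = [] @ t # [y] @ s # [y]"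
    by simp
  then have "w0 @ w1 = [] \<and> w2 @ w3 = [y] \<and> w4 = [y]"
    by (rule split_two_eq) (use w d in auto)
  then show ?thesis
    unfolding v1 by (auto simp: append_eq_Cons_conv)
qed

lemma sigma_1_partner:
  assumes d: "distinct [x, y, t, s]" and v: "(u, v) \<in> E"
    and u: "u = [x, y, t, x, s, y] \<or> u = [y, x, t, x, s, y]"
  shows "v = [x, y, t, x, s, y] \<or> v = [y, x, t, x, s, y]"
proof -
  have "res {x, t, s} v = [x, t, x, s]"
    using res_mem[OF v, of "{x, t, s}"] u d by (intro rigidD[OF btba]) auto
  then obtain w0 w1 w2 w3 w4 where v1: "v = w0 @ x # w1 @ t # w2 @ x # w3 @ s # w4"
      and w: "set (w0 @ w1 @ w2 @ w3 @ w4) \<inter> {x, t, s} = {}"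
    by (rule res_eq4E)
  have "set v \<subseteq> {x, y, t, s}" using rigid_set[OF nil v] u by auto
  then have w': "\<forall>c\<in>set (w0 @ w1 @ w2 @ w3 @ w4). c = y" using w v1 by auto
  have "res {y, t, s} v = [y, t, s, y]"
    using res_mem[OF v, of "{y, t, s}"] u d by (intro rigidD[OF atsa]) auto
  moreover have "res {y, t, s} v = (w0 @ w1) @ [t] @ (w2 @ w3) @ [s] @ w4"
    using w' d unfolding v1 by (auto simp: res_id)
  ultimately have "(w0 @ w1) @ t # (w2 @ w3) @ s # w4 = [y] @ t # [] @ s # [y]"
    by simp
  then have "w0 @ w1 = [y] \<and> w2 @ w3 = [] \<and> w4 = [y]"
    by (rule split_two_eq) (use w d in auto)
  then show ?thesis
    unfolding v1 by (auto simp: append_eq_Cons_conv)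
qed

lemma sigma_2_partner:
  assumes d: "distinct [x, y, t, s]" and v: "(u, v) \<in> E"
    and u: "u = [x, t, y, s, x, y] \<or> u = [x, t, y, s, y, x]"
  shows "v = [x, t, y, s, x, y] \<or> v = [x, t, y, s, y, x]"
proof -
  have "res {x, t, s} v = [x, t, s, x]"
    using res_mem[OF v, of "{x, t, s}"] u d by (intro rigidD[OF atsa]) auto
  then obtain w0 w1 w2 w3 w4 where v1: "v = w0 @ x # w1 @ t # w2 @ s # w3 @ x # w4"
      and w: "set (w0 @ w1 @ w2 @ w3 @ w4) \<inter> {x, t, s} = {}"
    by (rule res_eq4E)
  have "set v \<subseteq> {x, y, t, s}" using rigid_set[OF nil v] u by auto
  then have w': "\<forall>c\<in>set (w0 @ w1 @ w2 @ w3 @ w4). c = y" using w v1 by auto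
  have "res {y, t, s} v = [t, y, s, y]"
    using res_mem[OF v, of "{y, t, s}"] u d by (intro rigidD[OF abtb]) auto
  moreover have "res {y, t, s} v = (w0 @ w1) @ [t] @ w2 @ [s] @ (w3 @ w4)"
    using w' d unfolding v1 by (auto simp: res_id)
  ultimately have "(w0 @ w1) @ t # w2 @ s # (w3 @ w4) = [] @ t # [y] @ s # [y]"
    by simp
  then have "w0 @ w1 = [] \<and> w2 = [y] \<and> w3 @ w4 = [y]"
    by (rule split_two_eq) (use w d in auto)
  then show ?thesis
    unfolding v1 by (auto simp: append_eq_Cons_conv)
qed

end

section \<open>Words whose repeated letters are separated by linear letters\<close>

lemma res_none: "set w \<inter> A = {} \<Longrightarrow> res A w = []"
  by (auto simp: filter_empty_conv)

lemma res_gap3: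
  "{a, b, c} \<subseteq> A \<Longrightarrow> set (w0 @ w1 @ w2 @ w3) \<inter> A = {} \<Longrightarrow>
    res A (w0 @ a # w1 @ b # w2 @ c # w3) = [a, b, c]"
  by (simp add: res_none Int_Un_distrib2)

lemma res_gap4:
  "{a, b, c, d} \<subseteq> A \<Longrightarrow> set (w0 @ w1 @ w2 @ w3 @ w4) \<inter> A = {} \<Longrightarrow>
    res A (w0 @ a # w1 @ b # w2 @ c # w3 @ d # w4) = [a, b, c, d]"
  by (simp add: res_none Int_Un_distrib2)

lemma res_gap6:
  "{a, b, c, d, e, f} \<subseteq> A \<Longrightarrow> set (w0 @ w1 @ w2 @ w3 @ w4 @ w5 @ w6) \<inter> A = {} \<Longrightarrow>
    res A (w0 @ a # w1 @ b # w2 @ c # w3 @ d # w4 @ e # w5 @ f # w6) = [a, b, c, d, e, f]"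
  by (simp add: res_none Int_Un_distrib2)

lemma count_list_le_oneD: "u = q @ a # r \<Longrightarrow> count_list u a \<le> 1 \<Longrightarrow> a \<notin> set (q @ r)"
  by (simp add: count_list_0_iff)

lemma count_list_le_twoD:
  assumes "u = q0 @ a # q1 @ a # q2" "count_list u a \<le> 2" shows "a \<notin> set (q0 @ q1 @ q2)"
proof -
  have "count_list (q0 @ q1 @ q2) a = 0" using assms by simp
  then show ?thesis by (rule count_list_0_iff[THEN iffD1])
qed

lemma two_le_count_listE:
  assumes "2 \<le> count_list u a"
  obtains q0 q1 q2 where "u = q0 @ a # q1 @ a # q2"
proof -
  have "a \<in> set u" using assms by (metis count_list_0_iff not_numeral_le_zero)
  then obtain q r where u: "u = q @ a # r" "a \<notin> set q" by (meson split_list_first)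
  then have "count_list r a \<noteq> 0" using assms by auto
  then have "a \<in> set r" by (simp add: count_list_0_iff)
  then obtain q1 q2 where "r = q1 @ a # q2" by (meson split_list)
  then show thesis using u that by simp
qed

lemma count_list_subst_word_le: "c \<in> set (\<theta> a) \<Longrightarrow> count_list u a \<le> count_list (subst_word \<theta> u) c"
proof (induction u)
  case (Cons b u)
  have "count_list (\<theta> a) c \<noteq> 0" using Cons.prems by (simp add: count_list_0_iff)
  then show ?case using Cons by auto
qed simp

context xtx_theory
begin

text \<open>By \<open>rigid_local\<close> only adjacent pairs matter. Those with a linear letter
  restrict to words of the forms \<open>a b\<close>, \<open>x t x\<close>, \<open>a b t b\<close> or
  \<open>b t b a\<close>, so the hypothesis \<open>two\<close> concerns only pairs of non-linear
  letters.\<close>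

lemma rigid_separated:
  assumes cnt: "\<And>a. count_list u a \<le> 2"
    and sep: "\<And>q0 q1 q2 a. u = q0 @ a # q1 @ a # q2 \<Longrightarrow> \<exists>t\<in>set q1. count_list u t = 1"
    and two: "\<And>q a b r. u = q @ a # b # r \<Longrightarrow> count_list u a = 2 \<Longrightarrow> count_list u b = 2 \<Longrightarrow>
      a \<noteq> b \<Longrightarrow> \<exists>A. a \<in> A \<and> b \<in> A \<and> rigid E (res A u)"
  shows "rigid E u"
proof (rule rigid_local[OF nil])
  have split: "\<exists>q11 t q12. q1 = q11 @ t # q12 \<and> count_list u t = 1" if "u = q0 @ a # q1 @ a # q2" for q0 q1 q2 a
    using sep[OF that] by (meson split_list)
  have cnt12: "count_list u a = 1 \<or> count_list u a = 2" if "a \<in> set u" for a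
  proof -
    have "count_list u a \<noteq> 0" using that by (simp add: count_list_0_iff)
    then show ?thesis using cnt[of a] by linarith
  qed
  fix a assume a: "a \<in> set u"
  show "\<exists>A. a \<in> A \<and> rigid E (res A u)"
  proof (cases "count_list u a = 1")
    case True
    then have "res {a} u = [a]" unfolding res_singleton by simp
    then show ?thesis using single by (intro exI[of _ "{a}"]) simp
  next
    case False
    then have "2 \<le> count_list u a" using cnt12[OF a] by simp
    then obtain q0 q1 q2 where u: "u = q0 @ a # q1 @ a # q2" by (rule two_le_count_listE)
    obtain q11 t q12 where t: "q1 = q11 @ t # q12" "count_list u t = 1" using split[OF u] by blast
    have a: "a \<notin> set (q0 @ q1 @ q2)" by (rule count_list_le_twoD[OF u cnt])
    have u': "u = (q0 @ a # q11) @ t # (q12 @ a # q2)" using u t(1) by simp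
    have "t \<notin> set ((q0 @ a # q11) @ (q12 @ a # q2))"
      by (rule count_list_le_oneD[OF u']) (simp add: t(2))
    then have "res {a, t} (q0 @ a # q11 @ t # q12 @ a # q2) = [a, t, a]" "a \<noteq> t"
      using a unfolding t(1) by (intro res_gap3, auto)
    then have "rigid E (res {a, t} u)" using u' xtx[of a t] by simp
    then show ?thesis by (intro exI[of _ "{a, t}"]) simp
  qed
next
  have split: "\<exists>q11 t q12. q1 = q11 @ t # q12 \<and> count_list u t = 1" if "u = q0 @ a # q1 @ a # q2" for q0 q1 q2 a
    using sep[OF that] by (meson split_list)
  have cnt12: "count_list u a = 1 \<or> count_list u a = 2" if "a \<in> set u" for a
  proof -
    have "count_list u a \<noteq> 0" using that by (simp add: count_list_0_iff)
    then show ?thesis using cnt[of a] by linarith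
  qed
  fix q a b r assume u: "u = q @ a # b # r"
  have ab: "a \<noteq> b"
  proof
    assume "a = b"
    then have "u = q @ a # [] @ a # r" using u by simp
    from sep[OF this] show False by simp
  qed
  have other: "\<exists>q1 q2. q = q1 @ c # q2" if "c \<in> set q" for c
    using that by (meson split_list)
  consider "count_list u a = 2" "count_list u b = 2" | "count_list u a = 1" "count_list u b = 1"
    | "count_list u a = 1" "count_list u b = 2" | "count_list u a = 2" "count_list u b = 1"
    using cnt12[of a] cnt12[of b] u by auto
  then show "\<exists>A. a \<in> A \<and> b \<in> A \<and> rigid E (res A u)"
  proof cases
    case 1
    then show ?thesis using two[OF u] ab by blast
  next
    case 2
    have u': "u = (q @ [a]) @ b # r" using u by simp
    have "a \<notin> set (q @ b # r)" by (rule count_list_le_oneD[OF u]) (simp add: 2)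
    moreover have "b \<notin> set ((q @ [a]) @ r)" by (rule count_list_le_oneD[OF u']) (simp add: 2)
    ultimately have "set q \<inter> {a, b} = {}" "set r \<inter> {a, b} = {}" by auto
    then have "res {a, b} q = []" "res {a, b} r = []" by (simp_all only: res_none)
    then have "res {a, b} u = [a, b]" using u by simp
    then show ?thesis using pair[OF ab] by (intro exI[of _ "{a, b}"]) simp
  next
    case 3
    have a: "a \<notin> set (q @ b # r)" using count_list_le_oneD[OF u] 3 by simp
    show ?thesis
    proof (cases "b \<in> set q")
      case True
      then obtain q1 q2 where q: "q = q1 @ b # q2" using other by blast
      have u': "u = q1 @ b # (q2 @ [a]) @ b # r" using u q by simp
      have "b \<notin> set (q1 @ (q2 @ [a]) @ r)" by (rule count_list_le_twoD[OF u' cnt])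
      then have "res {a, b} (q1 @ b # q2 @ a # [] @ b # r) = [b, a, b]"
        using a q by (intro res_gap3) auto
      then have "rigid E (res {a, b} u)" using u' xtx[of b a] ab by simp
      then show ?thesis by (intro exI[of _ "{a, b}"]) simp
    next
      case False
      have "2 \<le> count_list u b" using 3 by simp
      then have "count_list r b \<noteq> 0" using u False ab count_list_0_iff[of q b] by auto
      then obtain r1 r2 where r: "r = r1 @ b # r2" by (auto simp: count_list_0_iff dest: split_list)
      have u': "u = (q @ [a]) @ b # r1 @ b # r2" using u r by simp
      obtain r11 t r12 where t: "r1 = r11 @ t # r12" "count_list u t = 1" using split[OF u'] by blast
      have b: "b \<notin> set ((q @ [a]) @ r1 @ r2)" using count_list_le_twoD[OF u' cnt] .
      have u'': "u = (q @ a # b # r11) @ t # (r12 @ b # r2)" using u' t by simp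
      have "t \<notin> set ((q @ a # b # r11) @ (r12 @ b # r2))"
        by (rule count_list_le_oneD[OF u'']) (simp add: t)
      then have "res {a, b, t} (q @ a # [] @ b # r11 @ t # r12 @ b # r2) = [a, b, t, b]" "distinct [a, b, t]"
        using a b ab unfolding r t(1) by (intro res_gap4, auto)
      then have "rigid E (res {a, b, t} u)" using u'' abtb[of a b t] by simp
      then show ?thesis by (intro exI[of _ "{a, b, t}"]) simp
    qed
  next
    case 4
    have ub: "u = (q @ [a]) @ b # r" using u by simp
    have b: "b \<notin> set ((q @ [a]) @ r)" by (rule count_list_le_oneD[OF ub]) (simp add: 4)
    show ?thesis
    proof (cases "a \<in> set q")
      case False
      have "2 \<le> count_list u a" using 4 by simp
      then have "count_list r a \<noteq> 0" using u False ab count_list_0_iff[of q a] by auto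
      then obtain r1 r2 where r: "r = r1 @ a # r2" by (auto simp: count_list_0_iff dest: split_list)
      have u': "u = q @ a # (b # r1) @ a # r2" using u r by simp
      have "a \<notin> set (q @ (b # r1) @ r2)" by (rule count_list_le_twoD[OF u' cnt])
      then have "res {a, b} (q @ a # [] @ b # r1 @ a # r2) = [a, b, a]"
        using b r by (intro res_gap3) auto
      then have "rigid E (res {a, b} u)" using u' xtx[of a b] ab by simp
      then show ?thesis by (intro exI[of _ "{a, b}"]) simp
    next
      case True
      then obtain q1 q2 where q: "q = q1 @ a # q2" using other by blast
      have u': "u = q1 @ a # q2 @ a # (b # r)" using u q by simp
      obtain q21 t q22 where t: "q2 = q21 @ t # q22" "count_list u t = 1" using split[OF u'] by blast
      have a: "a \<notin> set (q1 @ q2 @ (b # r))" using count_list_le_twoD[OF u' cnt] .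
      have u'': "u = (q1 @ a # q21) @ t # (q22 @ a # b # r)" using u' t by simp
      have "t \<notin> set ((q1 @ a # q21) @ (q22 @ a # b # r))"
        by (rule count_list_le_oneD[OF u'']) (simp add: t)
      then have "res {a, b, t} (q1 @ a # q21 @ t # q22 @ a # [] @ b # r) = [a, t, a, b]" "distinct [b, a, t]"
        using a b ab unfolding q t(1) by (intro res_gap4, auto)
      then have "rigid E (res {a, b, t} u)" using u'' btba[of b a t] by simp
      then show ?thesis by (intro exI[of _ "{a, b, t}"]) simp
    qed
  qed
qed

end

text \<open>The form in which "a linear letter lies in between" is inherited by preimages: a word
  over fewer than \<open>n\<close> letters must contain a linear letter if its image is such a
  \<open>w\<close> (see \<open>linear_letter\<close>).\<close>

definition separated :: "'a list \<Rightarrow> nat \<Rightarrow> 'a list \<Rightarrow> bool" where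
  "separated U n w \<longleftrightarrow> (\<exists>d\<in>set w. count_list U d = 1) \<or> n \<le> card (set w)"

locale preimage =
  fixes U u p s :: "'a list" and \<theta> :: "'a \<Rightarrow> 'a list" and n :: nat
  assumes U: "U = p @ subst_word \<theta> u @ s"
    and nonempty: "a \<in> set u \<Longrightarrow> \<theta> a \<noteq> []"
    and card_less: "card (set u) < n"
    and count_U: "count_list U c \<le> 2"
    and unique_pair: "U = q @ c # d # r \<Longrightarrow> U = q' @ c # d # r' \<Longrightarrow> q = q'"
begin

lemma count_le: "c \<in> set (\<theta> a) \<Longrightarrow> count_list u a \<le> count_list U c"
  using count_list_subst_word_le[of c \<theta> a u] by (simp add: U)

lemma count_u: "a \<in> set u \<Longrightarrow> count_list u a \<le> 2"
  using nonempty[of a] count_le[of "hd (\<theta> a)" a] count_U[of "hd (\<theta> a)"] by (simp add: order_trans)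

text \<open>If a repeated letter had an image of length at least two, the same two-letter factor
  would occur at two positions of \<open>U\<close>.\<close>

lemma nonlinear_letter:
  assumes "2 \<le> count_list u a"
  obtains c where "\<theta> a = [c]" "count_list U c = 2"
proof -
  obtain u0 u1 u2 where u: "u = u0 @ a # u1 @ a # u2" using assms by (rule two_le_count_listE)
  then obtain c cs where c: "\<theta> a = c # cs" using nonempty[of a] by (cases "\<theta> a") auto
  have "cs = []"
  proof (rule ccontr)
    assume "cs \<noteq> []"
    then obtain d ds where "cs = d # ds" by (cases cs) auto
    then have "U = (p @ subst_word \<theta> u0) @ c # d # (ds @ subst_word \<theta> (u1 @ a # u2) @ s)"
      "U = (p @ subst_word \<theta> (u0 @ a # u1)) @ c # d # (ds @ subst_word \<theta> u2 @ s)"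
      using U u c by simp_all
    then have "p @ subst_word \<theta> u0 = p @ subst_word \<theta> (u0 @ a # u1)" by (rule unique_pair)
    then show False using c by simp
  qed
  moreover have "count_list U c = 2"
    using count_le[of c a] assms c count_U[of c] by simp
  ultimately show thesis using that c by simp
qed

text \<open>If all letters of \<open>u1\<close> were non-linear, each would stand for one repeated
  letter of \<open>U\<close>; the image would have no linear letter and at most
  \<open>card (set u)\<close>, hence fewer than \<open>n\<close>, different letters.\<close>

lemma linear_letter:
  assumes "set u1 \<subseteq> set u" "separated U n (subst_word \<theta> u1)"
  shows "\<exists>e\<in>set u1. count_list u e = 1"
proof (rule ccontr)
  assume no: "\<not> ?thesis"
  have ge2: "2 \<le> count_list u e" if "e \<in> set u1" for e
  proof -
    have "count_list u e \<noteq> 0" using that assms(1) by (auto simp: count_list_0_iff)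
    moreover have "count_list u e \<noteq> 1" using no that by blast
    ultimately show ?thesis by linarith
  qed
  from assms(2) show False
    unfolding separated_def
  proof
    assume "\<exists>d\<in>set (subst_word \<theta> u1). count_list U d = 1"
    then obtain d e where "e \<in> set u1" "d \<in> set (\<theta> e)" "count_list U d = 1"
      by (auto simp: set_subst_word)
    then show False using count_le[of d e] ge2[of e] by simp
  next
    assume n: "n \<le> card (set (subst_word \<theta> u1))"
    have "\<theta> e = [hd (\<theta> e)]" if "e \<in> set u1" for e
      using nonlinear_letter[OF ge2[OF that]] by (metis list.sel(1))
    then have "set (\<theta> e) = {hd (\<theta> e)}" if "e \<in> set u1" for e
      using that by (metis list.simps(15) empty_set)
    then have "set (subst_word \<theta> u1) = (\<lambda>e. hd (\<theta> e)) ` set u1"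
      by (auto simp: set_subst_word)
    then have "card (set (subst_word \<theta> u1)) \<le> card (set u1)" by (simp add: card_image_le)
    also have "\<dots> \<le> card (set u)" using assms(1) by (simp add: card_mono)
    finally show False using n card_less by simp
  qed
qed

lemma separated_occurrences:
  assumes "\<And>q0 q1 q2 c. U = q0 @ c # q1 @ c # q2 \<Longrightarrow> separated U n q1"
    and u: "u = q0 @ a # q1 @ a # q2"
  shows "\<exists>t\<in>set q1. count_list u t = 1"
proof (rule linear_letter)
  show "set q1 \<subseteq> set u" using u by auto
  have "2 \<le> count_list u a" using u by simp
  then obtain c where "\<theta> a = [c]" by (rule nonlinear_letter)
  then have "U = (p @ subst_word \<theta> q0) @ c # subst_word \<theta> q1 @ c # (subst_word \<theta> q2 @ s)"
    using U u by simp
  then show "separated U n (subst_word \<theta> q1)" by (rule assms(1))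
qed

text \<open>Both occurrences of \<open>c\<close> in \<open>U\<close> already stem from
  \<open>a\<close>, so first occurrences correspond to first occurrences.\<close>

lemma occurs_before_iff:
  assumes "u = q @ a # r" "2 \<le> count_list u a" "\<theta> a = [c]"
  shows "c \<in> set (p @ subst_word \<theta> q) \<longleftrightarrow> a \<in> set q"
proof
  assume c: "c \<in> set (p @ subst_word \<theta> q)"
  show "a \<in> set q"
  proof (rule ccontr)
    assume "a \<notin> set q"
    then have "count_list q a = 0" by (simp add: count_list_0_iff)
    then have "count_list r a \<noteq> 0" using assms by simp
    then have "a \<in> set r" by (simp add: count_list_0_iff)
    then have "c \<in> set (subst_word \<theta> r @ s)"
      using assms(3) by (auto simp: set_subst_word intro!: bexI[of _ a])
    then have "count_list (p @ subst_word \<theta> q) c \<noteq> 0" "count_list (subst_word \<theta> r @ s) c \<noteq> 0"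
      using c by (simp_all only: count_list_0_iff not_not)
    moreover have "count_list U c = count_list (p @ subst_word \<theta> q) c + 1 + count_list (subst_word \<theta> r @ s) c"
      using U assms by simp
    ultimately show False using count_U[of c] by linarith
  qed
next
  assume "a \<in> set q"
  then show "c \<in> set (p @ subst_word \<theta> q)"
    using assms(3) by (auto simp: set_subst_word intro!: bexI[of _ a])
qed

end

context xtx_theory
begin

text \<open>By \<open>G4\<close> an adjacent pair of non-linear letters consists of one first and
  one second occurrence, and this passes to \<open>u\<close>. With the linear letters between the
  occurrences of each, the pair restricts to one side of \<open>sigma_mu\<close>.\<close>

lemma rigid_alternating:
  assumes "preimage U u p s \<theta> n"
    and G3: "\<And>q0 q1 q2 c. U = q0 @ c # q1 @ c # q2 \<Longrightarrow> separated U n q1"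
    and G4: "\<And>q c d r. U = q @ c # d # r \<Longrightarrow> count_list U c = 2 \<Longrightarrow> count_list U d = 2 \<Longrightarrow>
      c \<in> set q \<longleftrightarrow> d \<notin> set q"
    and rig: "\<And>x y t s. distinct [x, y, t, s] \<Longrightarrow> rigid E [x, t, x, y, s, y]"
      "\<And>x y t s. distinct [x, y, t, s] \<Longrightarrow> rigid E [x, t, y, x, s, y]"
  shows "rigid E u"
proof -
  interpret preimage U u p s \<theta> n by fact
  have cnt: "count_list u a \<le> 2" for a
    using count_u[of a] by (cases "a \<in> set u") (auto simp: count_list_0_iff[THEN iffD2])
  have sep: "\<exists>t\<in>set q1. count_list u t = 1" if "u = q0 @ a # q1 @ a # q2" for q0 q1 q2 a
    by (rule separated_occurrences[OF G3 that])
  show ?thesis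
  proof (rule rigid_separated[OF cnt sep])
    fix q a b r assume u: "u = q @ a # b # r" and ca: "count_list u a = 2" and cb: "count_list u b = 2"
      and ab: "a \<noteq> b"
    obtain c where c: "\<theta> a = [c]" "count_list U c = 2" using nonlinear_letter[of a] ca by auto
    obtain d where d: "\<theta> b = [d]" "count_list U d = 2" using nonlinear_letter[of b] cb by auto
    have U': "U = (p @ subst_word \<theta> q) @ c # d # (subst_word \<theta> r @ s)" using U u c d by simp
    have "c \<noteq> d"
    proof
      assume "c = d"
      then show False using G4[OF U' c(2) d(2)] by blast
    qed
    have ia: "c \<in> set (p @ subst_word \<theta> q) \<longleftrightarrow> a \<in> set q"
      by (rule occurs_before_iff[OF u _ c(1)]) (simp add: ca)
    have ub: "u = (q @ [a]) @ b # r" using u by simp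
    have "d \<in> set (p @ subst_word \<theta> (q @ [a])) \<longleftrightarrow> b \<in> set (q @ [a])"
      by (rule occurs_before_iff[OF ub _ d(1)]) (simp add: cb)
    then have ib: "d \<in> set (p @ subst_word \<theta> q) \<longleftrightarrow> b \<in> set q"
      using c(1) \<open>c \<noteq> d\<close> ab by auto
    have alt: "a \<in> set q \<longleftrightarrow> b \<notin> set q"
      using G4[OF U' c(2) d(2)] ia ib by blast
    \<comment> \<open>Here \<open>x\<close> is the letter of the pair at its second occurrence and
      \<open>y\<close> the one at its first; \<open>t\<close> separates the occurrences of
      \<open>x\<close> and \<open>s\<close> those of \<open>y\<close>.\<close>
    have main: "\<exists>t s q11 q12 q13 r11 r12 r13. distinct [x, y, t, s] \<and>
        q = q11 @ x # q12 @ t # q13 \<and> r = r11 @ s # r12 @ y # r13 \<and>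
        set (q11 @ q12 @ q13 @ r11 @ r12 @ r13) \<inter> {x, y, t, s} = {}"
      if xy: "{x, y} = {a, b}" and x: "x \<in> set q" and y: "y \<notin> set q" for x y
    proof -
      have neq: "x \<noteq> y" using x y by blast
      have c2: "count_list u x = 2" "count_list u y = 2" using xy ca cb by (metis insert_iff singletonD)+
      obtain q1 q2 where q: "q = q1 @ x # q2" using x by (meson split_list)
      have "count_list [a, b] y = 1" using xy neq ab by (auto simp: doubleton_eq_iff)
      moreover have "count_list q y = 0" using y by (simp add: count_list_0_iff)
      ultimately have "count_list r y = 1" using c2(2) u by (auto split: if_splits)
      then have "y \<in> set r" by (metis count_list_0_iff zero_neq_one)
      then obtain r1 r2 where r: "r = r1 @ y # r2" by (meson split_list)
      obtain w1 w2 where w: "[a, b] = w1 @ x # w2" "set w1 \<subseteq> {y}" "set w2 \<subseteq> {y}"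
        using xy ab neq by (cases "x = a") (auto simp: doubleton_eq_iff intro: that[of "[]" "[b]"] that[of "[a]" "[]"])
      obtain v1 v2 where v: "[a, b] = v1 @ y # v2" "set v1 \<subseteq> {x}" "set v2 \<subseteq> {x}"
        using xy ab neq by (cases "y = a") (auto simp: doubleton_eq_iff intro: that[of "[]" "[b]"] that[of "[a]" "[]"])
      have ux: "u = q1 @ x # (q2 @ w1) @ x # (w2 @ r)" and uy: "u = (q @ v1) @ y # (v2 @ r1) @ y # r2"
        using u q r w(1) v(1) by (metis append_Cons append_Nil append_assoc)+
      obtain t where "t \<in> set (q2 @ w1)" and t1: "count_list u t = 1" using sep[OF ux] by blast
      moreover have "t \<noteq> y" using t1 c2 by auto
      ultimately have "t \<in> set q2" using w(2) by auto
      then obtain q21 q22 where q2: "q2 = q21 @ t # q22" by (meson split_list)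
      obtain s where "s \<in> set (v2 @ r1)" and s1: "count_list u s = 1" using sep[OF uy] by blast
      moreover have "s \<noteq> x" using s1 c2 by auto
      ultimately have "s \<in> set r1" using v(3) by auto
      then obtain r11 r12 where r1: "r1 = r11 @ s # r12" by (meson split_list)
      have nx: "x \<notin> set (q1 @ (q2 @ w1) @ (w2 @ r))" by (rule count_list_le_twoD[OF ux cnt])
      have ny: "y \<notin> set ((q @ v1) @ (v2 @ r1) @ r2)" by (rule count_list_le_twoD[OF uy cnt])
      have ut: "u = (q1 @ x # q21) @ t # (q22 @ a # b # r)" using u q q2 by simp
      have us: "u = (q @ a # b # r11) @ s # (r12 @ y # r2)" using u r r1 by simp
      have nt: "t \<notin> set ((q1 @ x # q21) @ (q22 @ a # b # r))"
        by (rule count_list_le_oneD[OF ut]) (simp add: t1)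
      have ns: "s \<notin> set ((q @ a # b # r11) @ (r12 @ y # r2))"
        by (rule count_list_le_oneD[OF us]) (simp add: s1)
      have "distinct [x, y, t, s]"
        using neq nx ny nt ns unfolding q q2 r r1 by auto
      moreover have "set (q1 @ q21 @ q22 @ r11 @ r12 @ r2) \<inter> {x, y, t, s} = {}"
        using nx ny nt ns unfolding q q2 r r1 by auto
      ultimately show ?thesis using q q2 r r1 by (intro exI conjI) auto
    qed
    show "\<exists>A. a \<in> A \<and> b \<in> A \<and> rigid E (res A u)"
    proof (cases "a \<in> set q")
      case True
      then obtain t s q11 q12 q13 r11 r12 r13 where *: "distinct [a, b, t, s]"
          "q = q11 @ a # q12 @ t # q13" "r = r11 @ s # r12 @ b # r13"
          "set (q11 @ q12 @ q13 @ r11 @ r12 @ r13) \<inter> {a, b, t, s} = {}"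
        using main[of a b] alt by blast
      have "res {a, b, t, s} (q11 @ a # q12 @ t # q13 @ a # [] @ b # r11 @ s # r12 @ b # r13) = [a, t, a, b, s, b]"
        by (rule res_gap6) (use *(4) in auto)
      then have "rigid E (res {a, b, t, s} u)" using rig(1)[OF *(1)] u *(2,3) by simp
      then show ?thesis by (intro exI[of _ "{a, b, t, s}"]) simp
    next
      case False
      then obtain t s q11 q12 q13 r11 r12 r13 where *: "distinct [b, a, t, s]"
          "q = q11 @ b # q12 @ t # q13" "r = r11 @ s # r12 @ a # r13"
          "set (q11 @ q12 @ q13 @ r11 @ r12 @ r13) \<inter> {b, a, t, s} = {}"
        using main[of b a] alt by blast
      have "res {b, a, t, s} (q11 @ b # q12 @ t # q13 @ a # [] @ b # r11 @ s # r12 @ a # r13) = [b, t, a, b, s, a]"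
        by (rule res_gap6) (use *(4) in auto)
      then have "rigid E (res {b, a, t, s} u)" using rig(2)[OF *(1)] u *(2,3) by simp
      then show ?thesis by (intro exI[of _ "{b, a, t, s}"]) simp
    qed
  qed
qed

end

lemma finite_basis_bounded:
  assumes "finite \<Sigma>" shows "\<exists>n. \<forall>(u, v)\<in>\<Sigma>. card (set u) < n \<and> card (set v) < n"
  using assms
proof induction
  case (insert e \<Sigma>)
  then obtain n where n: "\<forall>(u, v)\<in>\<Sigma>. card (set u) < n \<and> card (set v) < n" by blast
  obtain u v where e: "e = (u, v)" by (cases e)
  show ?case
    using n e by (intro exI[of _ "n + card (set u) + card (set v) + 1"]) fastforce
qed simp

text \<open>Identities in fewer than \<open>n\<close> letters cannot change \<open>U\<close>: once
  the letters with empty image are deleted, the side applied to \<open>U\<close> is an isoterm, so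
  the other side has the same image. A finite basis uses boundedly many letters, hence it cannot
  prove \<open>U \<approx> V\<close> for large \<open>n\<close>.\<close>

lemma not_finitely_based_criterion:
  assumes "eq_theory E"
    and words: "\<And>n. \<exists>U V. (U, V) \<in> E \<and> U \<noteq> V \<and>
      (\<forall>p s \<theta> u. U = p @ subst_word \<theta> u @ s \<longrightarrow> (\<forall>a\<in>set u. \<theta> a \<noteq> []) \<longrightarrow>
        card (set u) < n \<longrightarrow> rigid E u)"
  shows "\<not> (\<exists>\<Sigma>. finite \<Sigma> \<and> \<Sigma> \<subseteq> E \<and> (\<forall>(u, v)\<in>E. deducible \<Sigma> u v))"
proof
  interpret eq_theory E by fact
  assume "\<exists>\<Sigma>. finite \<Sigma> \<and> \<Sigma> \<subseteq> E \<and> (\<forall>(u, v)\<in>E. deducible \<Sigma> u v)"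
  then obtain \<Sigma> where \<Sigma>: "finite \<Sigma>" "\<Sigma> \<subseteq> E" "\<forall>(u, v)\<in>E. deducible \<Sigma> u v" by blast
  obtain n where n: "\<forall>(u, v)\<in>\<Sigma>. card (set u) < n \<and> card (set v) < n"
    using finite_basis_bounded[OF \<Sigma>(1)] by blast
  obtain U V where UV: "(U, V) \<in> E" "U \<noteq> V"
    and rig: "\<And>p s \<theta> u. U = p @ subst_word \<theta> u @ s \<Longrightarrow> \<forall>a\<in>set u. \<theta> a \<noteq> [] \<Longrightarrow>
        card (set u) < n \<Longrightarrow> rigid E u"
    using words[of n] by blast
  have fixed: "p @ subst_word \<theta> v @ s = U" if "p @ subst_word \<theta> u @ s = U" "(u, v) \<in> E" "card (set u) < n" for u v p s \<theta>
  proof -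
    let ?A = "{a. \<theta> a \<noteq> []}"
    have eq: "subst_word \<theta> (res ?A w) = subst_word \<theta> w" for w
      by (induction w) auto
    have "card (set (res ?A u)) \<le> card (set u)" by (intro card_mono) auto
    then have "rigid E (res ?A u)"
      using that by (intro rig[of p \<theta> _ s]) (auto simp: eq[simplified])
    then have "res ?A v = res ?A u" by (rule rigidD) (rule res_mem[OF that(2)])
    then show ?thesis using that(1) eq by metis
  qed
  have "u = U \<longleftrightarrow> v = U" if "deducible \<Sigma> u v" for u v
    using that
  proof induction
    case (step u v p \<theta> s)
    have "(u, v) \<in> E" "card (set u) < n" "card (set v) < n" using step \<Sigma>(2) n by auto
    then show ?case
      using fixed[of p \<theta> u s v] fixed[of p \<theta> v s u] sym_mem by blast
  qed auto
  then show False using UV \<Sigma>(3) by blast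
qed

lemma split_list_two:
  assumes "a \<in> set q" "b \<in> set q" "a \<noteq> b"
  obtains q1 x q2 y q3 where "q = q1 @ x # q2 @ y # q3" "{x, y} = {a, b}"
proof -
  obtain p s where q: "q = p @ a # s" using assms(1) by (meson split_list)
  then consider "b \<in> set p" | "b \<in> set s" using assms by auto
  then show thesis
  proof cases
    case 1
    then obtain p1 p2 where "p = p1 @ b # p2" by (meson split_list)
    then show thesis using that[of p1 b p2 a s] q by auto
  next
    case 2
    then obtain s1 s2 where "s = s1 @ b # s2" by (meson split_list)
    then show thesis using that[of p a s1 b s2] q by auto
  qed
qed

context xtx_theory
begin

text \<open>By \<open>G4\<close> an adjacent pair of non-linear letters consists of two first or two
  second occurrences. One linear letter comes from \<open>sep\<close>; that the other two
  occurrences of these letters are also separated is what \<open>G5\<close> and \<open>G6\<close>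
  provide. The restriction is then a side of \<open>sigma_1\<close> or of
  \<open>sigma_2\<close>.\<close>

lemma rigid_parallel:
  assumes "preimage U u p s \<theta> n"
    and G3: "\<And>q0 q1 q2 c. U = q0 @ c # q1 @ c # q2 \<Longrightarrow> separated U n q1"
    and G4: "\<And>q c d r. U = q @ c # d # r \<Longrightarrow> count_list U c = 2 \<Longrightarrow> count_list U d = 2 \<Longrightarrow>
      c \<in> set q \<longleftrightarrow> d \<in> set q"
    and G5: "\<And>q c d r1 c' r2 d' r3. U = q @ c # d # r1 @ c' # r2 @ d' # r3 \<Longrightarrow> {c', d'} = {c, d} \<Longrightarrow>
      separated U n r2"
    and G6: "\<And>q1 c' q2 d' q3 c d r. U = q1 @ c' # q2 @ d' # q3 @ c # d # r \<Longrightarrow> {c', d'} = {c, d} \<Longrightarrow>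
      separated U n q2"
    and rig: "\<And>x y t s. distinct [x, y, t, s] \<Longrightarrow> rigid E [x, y, t, x, s, y]"
      "\<And>x y t s. distinct [x, y, t, s] \<Longrightarrow> rigid E [y, x, t, x, s, y]"
      "\<And>x y t s. distinct [x, y, t, s] \<Longrightarrow> rigid E [x, t, y, s, x, y]"
      "\<And>x y t s. distinct [x, y, t, s] \<Longrightarrow> rigid E [x, t, y, s, y, x]"
  shows "rigid E u"
proof -
  interpret preimage U u p s \<theta> n by fact
  have cnt: "count_list u a \<le> 2" for a
    using count_u[of a] by (cases "a \<in> set u") (auto simp: count_list_0_iff[THEN iffD2])
  have sep: "\<exists>t\<in>set q1. count_list u t = 1" if "u = q0 @ a # q1 @ a # q2" for q0 q1 q2 a
    by (rule separated_occurrences[OF G3 that])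
  show ?thesis
  proof (rule rigid_separated[OF cnt sep])
    fix q a b r assume u: "u = q @ a # b # r" and ca: "count_list u a = 2" and cb: "count_list u b = 2"
      and ab: "a \<noteq> b"
    define h where "h z = hd (\<theta> z)" for z
    have h: "\<theta> z = [h z]" "count_list U (h z) = 2" if "z \<in> {a, b}" for z
    proof -
      have "2 \<le> count_list u z" using that ca cb by auto
      then obtain c where "\<theta> z = [c]" "count_list U c = 2" by (rule nonlinear_letter)
      then show "\<theta> z = [h z]" "count_list U (h z) = 2" by (simp_all add: h_def)
    qed
    have U': "U = (p @ subst_word \<theta> q) @ h a # h b # (subst_word \<theta> r @ s)" using U u h by simp
    have ia: "h a \<in> set (p @ subst_word \<theta> q) \<longleftrightarrow> a \<in> set q"
      by (rule occurs_before_iff[OF u _ h(1)]) (simp_all add: ca)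
    have hab: "h a \<noteq> h b"
    proof
      assume eq: "h a = h b"
      have "separated U n []" using U' eq by (intro G3[of "p @ subst_word \<theta> q" "h a"]) simp
      then show False using card_less by (simp add: separated_def)
    qed
    have ub: "u = (q @ [a]) @ b # r" using u by simp
    have "h b \<in> set (p @ subst_word \<theta> (q @ [a])) \<longleftrightarrow> b \<in> set (q @ [a])"
      by (rule occurs_before_iff[OF ub _ h(1)]) (simp_all add: cb)
    then have ib: "h b \<in> set (p @ subst_word \<theta> q) \<longleftrightarrow> b \<in> set q"
      using h(1)[of a] hab ab by auto
    have par: "a \<in> set q \<longleftrightarrow> b \<in> set q"
      using G4[OF U' h(2) h(2)] ia ib by blast
    have zero: "z \<notin> set w" if "count_list w z = 0" for z and w :: "'a list"
      using that by (simp add: count_list_0_iff)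
    have h_img: "{h x, h y} = {h a, h b}" if "{x, y} = {a, b}" for x y
      using that by (auto simp: doubleton_eq_iff)
    show "\<exists>A. a \<in> A \<and> b \<in> A \<and> rigid E (res A u)"
    proof (cases "a \<in> set q")
      case True
      then obtain q1 x q2 y q3 where q: "q = q1 @ x # q2 @ y # q3" and xy: "{x, y} = {a, b}"
        using par ab by (metis split_list_two)
      have neq: "x \<noteq> y" using xy ab by (auto simp: doubleton_eq_iff)
      have mem: "x \<in> {a, b}" "y \<in> {a, b}" using xy by auto
      have mem': "a \<in> {x, y}" "b \<in> {x, y}" using xy by auto
      have ord: "a = x \<and> b = y \<or> a = y \<and> b = x" using xy by (auto simp: doubleton_eq_iff)
      have c2: "count_list u x = 2" "count_list u y = 2" using mem ca cb by auto
      have "U = (p @ subst_word \<theta> q1) @ h x # subst_word \<theta> q2 @ h y # subst_word \<theta> q3 @ h a # h b # (subst_word \<theta> r @ s)"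
        using U' q h(1)[OF mem(1)] h(1)[OF mem(2)] by simp
      then have "separated U n (subst_word \<theta> q2)" using h_img[OF xy] by (rule G6)
      then obtain t where "t \<in> set q2" and t1: "count_list u t = 1"
        using linear_letter[of q2] u q by auto
      then obtain q21 q22 where q2: "q2 = q21 @ t # q22" by (meson split_list)
      \<comment> \<open>The gap between the two occurrences of \<open>y\<close> is
        \<open>q3\<close>, possibly followed by \<open>a\<close>, which is not linear.\<close>
      have "\<exists>s\<in>set q3. count_list u s = 1"
      proof (cases "y = a")
        case True
        then have "u = (q1 @ x # q2) @ y # q3 @ y # (b # r)" using u q by simp
        then show ?thesis by (rule sep)
      next
        case False
        then have "u = (q1 @ x # q2) @ y # (q3 @ [a]) @ y # r" using u q mem by simp
        from sep[OF this] show ?thesis using ca by auto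
      qed
      then obtain s q31 q32 where q3: "q3 = q31 @ s # q32" and s1: "count_list u s = 1"
        by (meson split_list)
      have two: "count_list [a, b] x = 1" "count_list [a, b] y = 1"
        using mem ab by auto
      have ux: "count_list u z = count_list [x, y] z + count_list [a, b] z + count_list (q1 @ q2 @ q3 @ r) z" for z
        unfolding u q by simp
      have nx: "x \<notin> set (q1 @ q2 @ q3 @ r)" using ux[of x] c2 two neq by (intro zero) simp
      have ny: "y \<notin> set (q1 @ q2 @ q3 @ r)" using ux[of y] c2 two neq by (intro zero) simp
      have ut: "u = (q1 @ x # q21) @ t # (q22 @ y # q3 @ a # b # r)" using u q q2 by simp
      have us: "u = (q1 @ x # q2 @ y # q31) @ s # (q32 @ a # b # r)" using u q q3 by simp
      have nt: "t \<notin> set ((q1 @ x # q21) @ (q22 @ y # q3 @ a # b # r))"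
        by (rule count_list_le_oneD[OF ut]) (simp add: t1)
      have ns: "s \<notin> set ((q1 @ x # q2 @ y # q31) @ (q32 @ a # b # r))"
        by (rule count_list_le_oneD[OF us]) (simp add: s1)
      have dist: "distinct [x, y, t, s]"
        using neq nx ny nt ns unfolding q2 q3 by auto
      have "set (q1 @ q21 @ q22 @ q31 @ q32 @ [] @ r) \<inter> {x, y, t, s} = {}"
        using nx ny nt ns unfolding q2 q3 by auto
      then have R: "res {x, y, t, s} (q1 @ x # q21 @ t # q22 @ y # q31 @ s # q32 @ a # [] @ b # r) = [x, t, y, s, a, b]"
        using mem' by (intro res_gap6) auto
      have G: "rigid E [x, t, y, s, a, b]"
        using ord by (elim disjE conjE) (simp_all only: rig(3)[OF dist] rig(4)[OF dist])
      have u': "u = q1 @ x # q21 @ t # q22 @ y # q31 @ s # q32 @ a # [] @ b # r"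
        using u q q2 q3 by simp
      have "rigid E (res {x, y, t, s} u)" unfolding u' R by (rule G)
      then show ?thesis using mem' by (intro exI[of _ "{x, y, t, s}"] conjI) (assumption | blast)+
    next
      case False
      have "count_list q a = 0" "count_list q b = 0"
        using False par by (simp_all add: count_list_0_iff)
      then have "count_list r a = 1" "count_list r b = 1"
        using ca cb ab u by (auto split: if_splits)
      then have "a \<in> set r" "b \<in> set r" by (metis count_list_0_iff zero_neq_one)+
      then obtain r1 x r2 y r3 where r: "r = r1 @ x # r2 @ y # r3" and xy: "{x, y} = {a, b}"
        using ab by (metis split_list_two)
      have neq: "x \<noteq> y" using xy ab by (auto simp: doubleton_eq_iff)
      have mem: "x \<in> {a, b}" "y \<in> {a, b}" using xy by auto
      have mem': "a \<in> {x, y}" "b \<in> {x, y}" using xy by auto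
      have ord: "a = x \<and> b = y \<or> a = y \<and> b = x" using xy by (auto simp: doubleton_eq_iff)
      have c2: "count_list u x = 2" "count_list u y = 2" using mem ca cb by auto
      have "U = (p @ subst_word \<theta> q) @ h a # h b # subst_word \<theta> r1 @ h x # subst_word \<theta> r2 @ h y # (subst_word \<theta> r3 @ s)"
        using U' r h(1)[OF mem(1)] h(1)[OF mem(2)] by simp
      then have "separated U n (subst_word \<theta> r2)" using h_img[OF xy] by (rule G5)
      then obtain s where "s \<in> set r2" and s1: "count_list u s = 1"
        using linear_letter[of r2] u r by auto
      then obtain r21 r22 where r2: "r2 = r21 @ s # r22" by (meson split_list)
      have "\<exists>t\<in>set r1. count_list u t = 1"
      proof (cases "x = b")
        case True
        then have "u = (q @ [a]) @ x # r1 @ x # (r2 @ y # r3)" using u r by simp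
        then show ?thesis by (rule sep)
      next
        case False
        then have "u = q @ x # (b # r1) @ x # (r2 @ y # r3)" using u r mem by simp
        from sep[OF this] show ?thesis using cb by auto
      qed
      then obtain t r11 r12 where r1: "r1 = r11 @ t # r12" and t1: "count_list u t = 1"
        by (meson split_list)
      have two: "count_list [a, b] x = 1" "count_list [a, b] y = 1"
        using mem ab by auto
      have ux: "count_list u z = count_list [x, y] z + count_list [a, b] z + count_list (q @ r1 @ r2 @ r3) z" for z
        unfolding u r by simp
      have nx: "x \<notin> set (q @ r1 @ r2 @ r3)" using ux[of x] c2 two neq by (intro zero) simp
      have ny: "y \<notin> set (q @ r1 @ r2 @ r3)" using ux[of y] c2 two neq by (intro zero) simp
      have ut: "u = (q @ a # b # r11) @ t # (r12 @ x # r2 @ y # r3)" using u r r1 by simp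
      have us: "u = (q @ a # b # r1 @ x # r21) @ s # (r22 @ y # r3)" using u r r2 by simp
      have nt: "t \<notin> set ((q @ a # b # r11) @ (r12 @ x # r2 @ y # r3))"
        by (rule count_list_le_oneD[OF ut]) (simp add: t1)
      have ns: "s \<notin> set ((q @ a # b # r1 @ x # r21) @ (r22 @ y # r3))"
        by (rule count_list_le_oneD[OF us]) (simp add: s1)
      have dist: "distinct [x, y, t, s]"
        using neq nx ny nt ns unfolding r1 r2 by auto
      have "set (q @ [] @ r11 @ r12 @ r21 @ r22 @ r3) \<inter> {x, y, t, s} = {}"
        using nx ny nt ns unfolding r1 r2 by auto
      then have R: "res {x, y, t, s} (q @ a # [] @ b # r11 @ t # r12 @ x # r21 @ s # r22 @ y # r3) = [a, b, t, x, s, y]"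
        using mem' by (intro res_gap6) auto
      have G: "rigid E [a, b, t, x, s, y]"
        using ord by (elim disjE conjE) (simp_all only: rig(1)[OF dist] rig(2)[OF dist])
      have u': "u = q @ a # [] @ b # r11 @ t # r12 @ x # r21 @ s # r22 @ y # r3"
        using u r r1 r2 by simp
      have "rigid E (res {x, y, t, s} u)" unfolding u' R by (rule G)
      then show ?thesis using mem' by (intro exI[of _ "{x, y, t, s}"] conjI) (assumption | blast)+
    qed
  qed
qed

end


section \<open>Words given by functions on positions\<close>

lemma map_upt_eq_appendE:
  assumes "map F [i..<m] = q @ c # r"
  obtains k where "i \<le> k" "k < m" "c = F k" "q = map F [i..<k]" "r = map F [Suc k..<m]"
proof -
  define k where "k = i + length q"
  have len: "m - i = length q + Suc (length r)"
    using arg_cong[OF assms, of length] by simp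
  then have km: "i \<le> k" "k < m" by (auto simp: k_def)
  then have "[i..<m] = [i..<k] @ k # [Suc k..<m]"
    by (metis le_add_diff_inverse less_or_eq_imp_le upt_add_eq_append upt_conv_Cons)
  then have "q @ c # r = map F [i..<k] @ F k # map F [Suc k..<m]"
    using assms by simp
  moreover have "length q = length (map F [i..<k])" by (simp add: k_def)
  ultimately show thesis using that[OF km] by simp
qed

lemma count_list_map_upt: "count_list (map F [0..<m]) c = card {k. k < m \<and> F k = c}"
proof -
  have "{k. k < m \<and> F k = c} = {k. k < length (map F [0..<m]) \<and> c = map F [0..<m] ! k}" by auto
  then show ?thesis
    by (simp only: count_list_eq_length_filter length_filter_conv_card)
qed

lemma count_list_map_upt_eq_1:
  assumes "k < m" "\<And>j. j < m \<Longrightarrow> F j = F k \<Longrightarrow> j = k"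
  shows "count_list (map F [0..<m]) (F k) = 1"
proof -
  have "{j. j < m \<and> F j = F k} = {k}" using assms by auto
  then show ?thesis by (simp add: count_list_map_upt)
qed

lemma count_list_map_upt_ge_2:
  assumes "j < m" "k < m" "j \<noteq> k" "F j = F k"
  shows "2 \<le> count_list (map F [0..<m]) (F k)"
proof -
  have "card {j, k} \<le> card {i. i < m \<and> F i = F k}"
    using assms by (intro card_mono) auto
  then show ?thesis using assms(3) by (simp add: count_list_map_upt)
qed

lemma count_list_map_upt_le_2:
  assumes "\<And>i j k. i < j \<Longrightarrow> j < k \<Longrightarrow> k < m \<Longrightarrow> F i = F j \<Longrightarrow> F j \<noteq> F k"
  shows "count_list (map F [0..<m]) c \<le> 2"
proof (rule ccontr)
  define A where "A = {k. k < m \<and> F k = c}"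
  have fin: "finite A" by (simp add: A_def)
  assume "\<not> ?thesis"
  then have card: "2 < card A" by (simp add: count_list_map_upt A_def)
  then have ne: "A \<noteq> {}" by auto
  have "card (A - {Min A, Max A}) \<noteq> 0"
  proof -
    have "card A \<le> card (A - {Min A, Max A}) + card {Min A, Max A}"
      using fin by (metis card_Diff_subset_Int card_mono diff_le_self diff_card_le_card_Diff finite.emptyI finite_insert le_diff_conv)
    moreover have "card {Min A, Max A} \<le> 2" by (simp add: card_insert_if)
    ultimately show ?thesis using card by linarith
  qed
  then obtain j where j: "j \<in> A" "j \<noteq> Min A" "j \<noteq> Max A" by (metis Diff_iff card_eq_0_iff ex_in_conv insertI1 insert_iff)
  have "Min A < j" "j < Max A"
    using j fin by (metis Min_le nless_le, metis Max_ge nless_le)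
  moreover have "Min A \<in> A" "Max A \<in> A" using fin ne by simp_all
  ultimately show False
    using assms[of "Min A" j "Max A"] j(1) by (auto simp: A_def)
qed

lemma ex_other_index:
  assumes "count_list (map F [0..<m]) (F i) = 2" "i < m"
  shows "\<exists>j<m. j \<noteq> i \<and> F j = F i"
proof (rule ccontr)
  assume "\<not> ?thesis"
  then have "count_list (map F [0..<m]) (F i) = 1"
    using assms(2) by (intro count_list_map_upt_eq_1) blast+
  then show False using assms(1) by simp
qed

section \<open>Two sets of words that are not finitely based\<close>

lemma Cons_eq_map_upt:
  "c # r = map F [i..<m] \<longleftrightarrow> i < m \<and> c = F i \<and> r = map F [Suc i..<m]"
  by (cases "i < m") (auto simp: upt_conv_Cons)

text \<open>
  Position \<open>k\<close> of \<open>U\<^sub>n\<close> carries the letter whose index is its first position. The first word is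
  \<open>z\<^sub>1 s\<^sub>1 \<dots> z\<^sub>n s\<^sub>n x z\<^sub>1 w\<^sub>1 \<dots> z\<^sub>n w\<^sub>n x r\<^sub>1 w\<^sub>1 \<dots> r\<^sub>n w\<^sub>n\<close>, in which both occurrences of a non-linear letter
  are \<open>2 n + 1\<close> positions apart; only \<open>x\<close> has no linear letter between its occurrences.
\<close>

definition alternating_pos :: "nat \<Rightarrow> nat \<Rightarrow> nat" where
  "alternating_pos n k = (if k < 2 * n + 1 \<or> even k then k else k - (2 * n + 1))"

text \<open>The distance \<open>2 * n + 1\<close> is odd: first occurrences of repeated letters
  stand at even positions and second ones at odd positions. This makes neighbours alternate, as
  \<open>rigid_alternating\<close> requires.\<close>

lemma alternating_pos_eq:
  "j < k \<Longrightarrow> alternating_pos n j = alternating_pos n k \<Longrightarrow> even j \<and> k = j + (2 * n + 1)"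
  unfolding alternating_pos_def by (auto split: if_splits)

lemma alternating_pos_add: "even j \<Longrightarrow> alternating_pos n (j + (2 * n + 1)) = alternating_pos n j"
  by (auto simp: alternating_pos_def)

lemma (in xtx_theory) alternating_word_rigid:
  fixes f :: "nat \<Rightarrow> 'a"
  assumes "inj f" and F: "F = (\<lambda>k. f (alternating_pos n k))" and U: "U = map F [0..<6 * n + 2]"
    and pre: "U = p @ subst_word \<theta> u @ s" "\<forall>a\<in>set u. \<theta> a \<noteq> []" "card (set u) < n"
    and rig: "\<And>x y t s. distinct [x, y, t, s] \<Longrightarrow> rigid E [x, t, x, y, s, y]"
      "\<And>x y t s. distinct [x, y, t, s] \<Longrightarrow> rigid E [x, t, y, x, s, y]"
  shows "rigid E u"
proof (rule rigid_alternating[OF _ _ _ rig])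
  have n: "0 < n" using pre(3) by simp
  have eq: "even j \<and> k = j + (2 * n + 1)" if "j < k" "F j = F k" for j k
    using that injD[OF assms(1)] unfolding F by (intro alternating_pos_eq) auto
  have eq': "even (min j k) \<and> max j k = min j k + (2 * n + 1)" if "j \<noteq> k" "F j = F k" for j k
    using that eq[of j k] eq[of k j] by (cases "j < k") auto
  have lin: "count_list U (F k) = 1" if "k < 6 * n + 2" "odd k \<and> k < 2 * n \<or> even k \<and> 4 * n < k" for k
    unfolding U
  proof (rule count_list_map_upt_eq_1[OF that(1)])
    fix j assume j: "j < 6 * n + 2" "F j = F k"
    show "j = k"
    proof (rule ccontr)
      assume "j \<noteq> k"
      then consider "j < k" | "k < j" by linarith
      then show False
      proof cases
        case 1
        from eq[OF 1 j(2)] show False using that by presburger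
      next
        case 2
        from eq[OF 2 j(2)[symmetric]] show False using that j(1) by presburger
      qed
    qed
  qed
  show "preimage U u p s \<theta> n"
  proof
    show "U = p @ subst_word \<theta> u @ s" "card (set u) < n" by fact+
    show "\<theta> a \<noteq> []" if "a \<in> set u" for a using pre(2) that by blast
    show "count_list U c \<le> 2" for c
      unfolding U
    proof (rule count_list_map_upt_le_2)
      fix i j k :: nat assume "i < j" "j < k" "F i = F j"
      then show "F j \<noteq> F k" using eq[of i j] eq[of j k] by auto
    qed
    fix q q' c d r r'
    assume "U = q @ c # d # r" "U = q' @ c # d # r'"
    then obtain k k' where k: "c = F k" "q = map F [0..<k]" "d # r = map F [Suc k..<6 * n + 2]"
      and k': "c = F k'" "q' = map F [0..<k']" "d # r' = map F [Suc k'..<6 * n + 2]"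
      unfolding U by (elim map_upt_eq_appendE)
    have d: "d = F (Suc k)" "d = F (Suc k')"
      using k(3) k'(3) unfolding Cons_eq_map_upt by blast+
    \<comment> \<open>A two-letter factor at two positions would require both \<open>k\<close> and
      \<open>Suc k\<close>, for the smaller position, to be even.\<close>
    show "q = q'"
    proof (rule ccontr)
      assume "q \<noteq> q'"
      then have "k \<noteq> k'" using k k' by auto
      then show False
        using eq'[of k k'] eq'[of "Suc k" "Suc k'"] d k(1) k'(1) by (auto simp: min_def split: if_splits)
    qed
  qed
  show "separated U n q1" if U': "U = q0 @ c # q1 @ c # q2" for q0 q1 q2 c
  proof -
    obtain i where i: "c = F i" "q1 @ c # q2 = map F [Suc i..<6 * n + 2]"
      using U'[unfolded U] by (elim map_upt_eq_appendE) blast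
    then obtain j where j: "Suc i \<le> j" "j < 6 * n + 2" "c = F j" "q1 = map F [Suc i..<j]"
      by (elim map_upt_eq_appendE[OF HOL.sym])
    have ij: "even i" "j = i + (2 * n + 1)" using eq[of i j] i j by auto
    have q1: "set q1 = F ` {Suc i..<j}" using j by simp
    \<comment> \<open>The letter is a \<open>z\<close>, followed by its linear letter
      \<open>s\<close> at \<open>Suc i\<close>; or it is \<open>x\<close>, with \<open>2 * n\<close>
      different letters in between; or it is a \<open>w\<close>, and the linear letter
      \<open>r_1\<close> at \<open>4 * n + 2\<close> lies in between.\<close>
    consider "i < 2 * n" | "i = 2 * n" | "2 * n < i" by linarith
    then show ?thesis
    proof cases
      case 1
      then have "count_list U (F (Suc i)) = 1" using ij j by (intro lin) auto
      moreover have "F (Suc i) \<in> set q1" unfolding q1 using 1 ij n by auto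
      ultimately show ?thesis unfolding separated_def by blast
    next
      case 2
      have "inj_on F {Suc i..<j}"
      proof (rule inj_onI)
        fix a b assume "a \<in> {Suc i..<j}" "b \<in> {Suc i..<j}" "F a = F b"
        then show "a = b" using eq'[of a b] ij by (cases "a = b") (auto simp: min_def max_def split: if_splits)
      qed
      then have "card (set q1) = 2 * n" unfolding q1 using ij by (simp add: card_image)
      then show ?thesis unfolding separated_def by simp
    next
      case 3
      have "i \<le> 4 * n" using ij j(2) by presburger
      then have "count_list U (F (4 * n + 2)) = 1" using n by (intro lin) auto
      moreover have "4 * n + 2 \<in> {Suc i..<j}"
        using 3 ij \<open>i \<le> 4 * n\<close> unfolding atLeastLessThan_iff by presburger
      then have "F (4 * n + 2) \<in> set q1" unfolding q1 by (rule imageI)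
      ultimately show ?thesis unfolding separated_def by blast
    qed
  qed
  show "c \<in> set q \<longleftrightarrow> d \<notin> set q"
    if U': "U = q @ c # d # r" and c: "count_list U c = 2" and d: "count_list U d = 2" for q c d r
  proof -
    obtain i where i: "i < 6 * n + 2" "c = F i" "q = map F [0..<i]" "d # r = map F [Suc i..<6 * n + 2]"
      using U'[unfolded U] by (elim map_upt_eq_appendE)
    have d': "d = F (Suc i)" "Suc i < 6 * n + 2"
      using i(4) unfolding Cons_eq_map_upt by blast+
    have odd: "F k \<in> F ` {0..<k} \<longleftrightarrow> odd k" if k: "k < 6 * n + 2" "count_list U (F k) = 2" for k
    proof -
      obtain j where j: "j < 6 * n + 2" "j \<noteq> k" "F j = F k"
        using ex_other_index[of F "6 * n + 2" k] k unfolding U by blast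
      show ?thesis
      proof
        assume "F k \<in> F ` {0..<k}"
        then obtain l where "l < k" "F l = F k" by auto
        then show "odd k" using eq[of l k] by auto
      next
        assume "odd k"
        then have "j < k" using eq[of k j] j by (cases "k < j") auto
        then show "F k \<in> F ` {0..<k}" using j(3) by (metis atLeastLessThan_iff imageI le0)
      qed
    qed
    have "c \<in> set q \<longleftrightarrow> odd i" using odd[of i] i c by simp
    moreover have "d \<in> F ` {0..<Suc i} \<longleftrightarrow> odd (Suc i)" using odd[of "Suc i"] d' d by simp
    moreover have "F ` {0..<Suc i} = insert c (set q)" using i by (auto simp: less_Suc_eq)
    moreover have "c \<noteq> d"
    proof
      assume "c = d"
      then show False using eq[of i "Suc i"] i d' pre(3) by auto
    qed
    ultimately show ?thesis by auto
  qed
qed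

text \<open>The second word is \<open>z\<^sub>1 t\<^sub>1 \<dots> z\<^sub>n t\<^sub>n x y t x z\<^sub>1 \<dots> z\<^sub>n y\<close>.\<close>

definition parallel_pos :: "nat \<Rightarrow> nat \<Rightarrow> nat" where
  "parallel_pos n k = (if k < 2 * n + 3 then k else if k = 2 * n + 3 then 2 * n
    else if k < 3 * n + 4 then 2 * (k - (2 * n + 4)) else 2 * n + 1)"

lemma parallel_pos_simps:
  "k < 2 * n + 3 \<Longrightarrow> parallel_pos n k = k"
  "parallel_pos n (2 * n + 3) = 2 * n"
  "i < n \<Longrightarrow> parallel_pos n (2 * n + 4 + i) = 2 * i"
  "parallel_pos n (3 * n + 4) = 2 * n + 1"
  by (auto simp: parallel_pos_def)

lemma parallel_pos_cases:
  fixes k n :: nat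
  assumes "k < 3 * n + 5"
  obtains "k < 2 * n + 3" | "k = 2 * n + 3" | i where "i < n" "k = 2 * n + 4 + i" | "k = 3 * n + 4"
proof -
  consider "k < 2 * n + 3" | "k = 2 * n + 3" | "2 * n + 4 \<le> k" "k < 3 * n + 4" | "k = 3 * n + 4"
    using assms by linarith
  then show thesis
  proof cases
    case 3
    then have "k - (2 * n + 4) < n" "k = 2 * n + 4 + (k - (2 * n + 4))" by linarith+
    then show thesis by (rule that(3))
  qed (use that in blast)+
qed

text \<open>The alternatives are the two occurrences of \<open>x\<close>, of \<open>y\<close> and of
  a \<open>z\<close>. For even \<open>j\<close> the last equation says
  \<open>k = 2 * n + 4 + j div 2\<close>, written without division for linear arithmetic.\<close>

lemma parallel_pos_eq:
  assumes "j < k" "k < 3 * n + 5" "parallel_pos n j = parallel_pos n k"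
  shows "j = 2 * n \<and> k = 2 * n + 3 \<or> j = 2 * n + 1 \<and> k = 3 * n + 4 \<or>
    even j \<and> 2 * n + 4 \<le> k \<and> k < 3 * n + 4 \<and> j + (4 * n + 8) = 2 * k"
proof -
  have "j < 3 * n + 5" using assms(1,2) by linarith
  then show ?thesis
  proof (cases rule: parallel_pos_cases)
    case 1
    note j = this
    show ?thesis
      using assms(2)
    proof (cases rule: parallel_pos_cases)
      case 1
      then show ?thesis using assms j by (simp add: parallel_pos_simps)
    next
      case 2
      then show ?thesis using assms(3) j by (simp add: parallel_pos_simps)
    next
      case (3 i)
      then have "j = 2 * i" using assms(3) j by (simp add: parallel_pos_simps)
      then show ?thesis using 3 by simp
    next
      case 4
      then show ?thesis using assms(3) j by (simp add: parallel_pos_simps)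
    qed
  next
    case 2
    show ?thesis
      using assms(2)
    proof (cases rule: parallel_pos_cases)
      case (3 i)
      then show ?thesis using assms(3) 2 by (simp add: parallel_pos_simps)
    qed (use assms(1,3) 2 parallel_pos_simps(2,4)[of n] in auto)
  next
    case (3 i)
    show ?thesis
      using assms(2)
    proof (cases rule: parallel_pos_cases)
      case (3 l)
      then show ?thesis using assms(1,3) \<open>i < n\<close> \<open>j = 2 * n + 4 + i\<close> by (simp add: parallel_pos_simps)
    next
      case 4
      then have "2 * i = 2 * n + 1" using assms(3) 3 by (simp add: parallel_pos_simps)
      then show ?thesis by presburger
    qed (use assms(1) 3 in auto)
  next
    case 4
    then show ?thesis using assms(1,2) by linarith
  qed
qed

lemma (in xtx_theory) parallel_word_rigid:
  fixes f :: "nat \<Rightarrow> 'a"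
  assumes "inj f" and F: "F = (\<lambda>k. f (parallel_pos n k))" and U: "U = map F [0..<3 * n + 5]"
    and pre: "U = p @ subst_word \<theta> u @ s" "\<forall>a\<in>set u. \<theta> a \<noteq> []" "card (set u) < n"
    and rig: "\<And>x y t s. distinct [x, y, t, s] \<Longrightarrow> rigid E [x, y, t, x, s, y]"
      "\<And>x y t s. distinct [x, y, t, s] \<Longrightarrow> rigid E [y, x, t, x, s, y]"
      "\<And>x y t s. distinct [x, y, t, s] \<Longrightarrow> rigid E [x, t, y, s, x, y]"
      "\<And>x y t s. distinct [x, y, t, s] \<Longrightarrow> rigid E [x, t, y, s, y, x]"
  shows "rigid E u"
proof (rule rigid_parallel[OF _ _ _ _ _ rig])
  let ?m = "3 * n + 5"
  have n: "0 < n" using pre(3) by simp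
  have eq: "j = 2 * n \<and> k = 2 * n + 3 \<or> j = 2 * n + 1 \<and> k = 3 * n + 4 \<or>
      even j \<and> 2 * n + 4 \<le> k \<and> k < 3 * n + 4 \<and> j + (4 * n + 8) = 2 * k" if "j < k" "k < ?m" "F j = F k" for j k
    using that injD[OF assms(1)] unfolding F by (intro parallel_pos_eq) auto
  \<comment> \<open>All second occurrences stand at \<open>2 * n + 3\<close> or later, all first
    occurrences of repeated letters before that.\<close>
  have low: "j < 2 * n + 3 \<and> 2 * n + 3 \<le> k" if "j < k" "k < ?m" "F j = F k" for j k
    using eq[OF that] by auto
  have lin: "count_list U (F k) = 1" if "odd k \<and> k < 2 * n \<or> k = 2 * n + 2" for k
    unfolding U
  proof (rule count_list_map_upt_eq_1)
    show "k < ?m" using that by auto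
    fix j assume j: "j < ?m" "F j = F k"
    show "j = k"
    proof (rule ccontr)
      assume "j \<noteq> k"
      then consider "j < k" | "k < j" by linarith
      then show False
      proof cases
        case 1
        have "k < ?m" using that by auto
        from eq[OF 1 this j(2)] show False using that by - (elim disjE conjE; (linarith | presburger))
      next
        case 2
        from eq[OF 2 j(1) j(2)[symmetric]] show False using that by - (elim disjE conjE; (linarith | presburger))
      qed
    qed
  qed
  have sepI: "separated U n q1" if "q1 = map F [i..<j]" "i \<le> k" "k < j" "odd k \<and> k < 2 * n \<or> k = 2 * n + 2" for q1 i j k
  proof -
    have "F k \<in> set q1" using that by auto
    then show ?thesis using lin[OF that(4)] unfolding separated_def by blast
  qed
  show "preimage U u p s \<theta> n"
  proof
    show "U = p @ subst_word \<theta> u @ s" "card (set u) < n" by fact+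
    show "\<theta> a \<noteq> []" if "a \<in> set u" for a using pre(2) that by blast
    show "count_list U c \<le> 2" for c
      unfolding U
    proof (rule count_list_map_upt_le_2)
      fix i j k :: nat assume "i < j" "j < k" "k < ?m" "F i = F j"
      then show "F j \<noteq> F k" using low[of i j] low[of j k] by auto
    qed
    fix q q' c d r r'
    assume "U = q @ c # d # r" "U = q' @ c # d # r'"
    then obtain k k' where k: "c = F k" "q = map F [0..<k]" "d # r = map F [Suc k..<?m]"
      and k': "c = F k'" "q' = map F [0..<k']" "d # r' = map F [Suc k'..<?m]"
      unfolding U by (elim map_upt_eq_appendE)
    have d: "d = F (Suc k)" "d = F (Suc k')" "Suc k < ?m" "Suc k' < ?m"
      using k(3) k'(3) unfolding Cons_eq_map_upt by blast+
    have no: False if "i < j" "Suc j < ?m" "F i = F j" "F (Suc i) = F (Suc j)" for i j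
    proof -
      have i: "Suc i < Suc j" "j < ?m" using that by auto
      from eq[OF that(1) i(2) that(3)] eq[OF i(1) that(2,4)] show False using n by - (elim disjE conjE; (linarith | presburger))
    qed
    show "q = q'"
    proof (rule ccontr)
      assume "q \<noteq> q'"
      then have "k \<noteq> k'" using k(2) k'(2) by metis
      then have "k < k' \<or> k' < k" by linarith
      then show False
        using no[of k k'] no[of k' k] d k(1) k'(1) by auto
    qed
  qed
  show "separated U n q1" if U': "U = q0 @ c # q1 @ c # q2" for q0 q1 q2 c
  proof -
    obtain i where i: "c = F i" "q1 @ c # q2 = map F [Suc i..<?m]"
      using U'[unfolded U] by (elim map_upt_eq_appendE) blast
    then obtain j where j: "Suc i \<le> j" "j < ?m" "c = F j" "q1 = map F [Suc i..<j]"
      by (elim map_upt_eq_appendE[OF HOL.sym])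
    have "i < j" "F i = F j" using i(1) j(1,3) by auto
    from eq[OF this(1) j(2) this(2)]
    have "(i = 2 * n \<or> i = 2 * n + 1) \<and> 2 * n + 3 \<le> j \<or> odd (Suc i) \<and> Suc i < 2 * n \<and> 2 * n + 3 \<le> j"
      by - (elim disjE conjE; (linarith | presburger))
    then show ?thesis
    proof
      assume "(i = 2 * n \<or> i = 2 * n + 1) \<and> 2 * n + 3 \<le> j"
      then show ?thesis by (intro sepI[OF j(4), of "2 * n + 2"]) auto
    next
      assume "odd (Suc i) \<and> Suc i < 2 * n \<and> 2 * n + 3 \<le> j"
      then show ?thesis by (intro sepI[OF j(4), of "Suc i"]) auto
    qed
  qed
  show "c \<in> set q \<longleftrightarrow> d \<in> set q"
    if U': "U = q @ c # d # r" and c: "count_list U c = 2" and d: "count_list U d = 2" for q c d r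
  proof -
    obtain i where i: "i < ?m" "c = F i" "q = map F [0..<i]" "d # r = map F [Suc i..<?m]"
      using U'[unfolded U] by (elim map_upt_eq_appendE)
    have d': "d = F (Suc i)" "Suc i < ?m"
      using i(4) unfolding Cons_eq_map_upt by blast+
    have high: "F k \<in> F ` {0..<k} \<longleftrightarrow> 2 * n + 3 \<le> k" if k: "k < ?m" "count_list U (F k) = 2" for k
    proof -
      obtain j where j: "j < ?m" "j \<noteq> k" "F j = F k"
        using ex_other_index[of F ?m k] k unfolding U by blast
      show ?thesis
      proof
        assume "F k \<in> F ` {0..<k}"
        then obtain l where "l < k" "F l = F k" by auto
        then show "2 * n + 3 \<le> k" using low[of l k] k by auto
      next
        assume "2 * n + 3 \<le> k"
        then have "j < k" using low[of k j] j by (cases "k < j") auto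
        then show "F k \<in> F ` {0..<k}" using j(3) by (metis atLeastLessThan_iff imageI le0)
      qed
    qed
    \<comment> \<open>An adjacent pair could mix first and second occurrences only at this border,
      and there the linear letter \<open>t\<close> stands.\<close>
    have "i \<noteq> 2 * n + 2" using lin[of i] i(2) c by auto
    moreover have "c \<in> set q \<longleftrightarrow> 2 * n + 3 \<le> i" using high[of i] i c by simp
    moreover have "d \<in> F ` {0..<Suc i} \<longleftrightarrow> 2 * n + 3 \<le> Suc i" using high[of "Suc i"] d' d by simp
    moreover have "F ` {0..<Suc i} = insert c (set q)" using i by (auto simp: less_Suc_eq)
    moreover have "c \<noteq> d"
    proof
      assume "c = d"
      then show False using low[of i "Suc i"] eq[of i "Suc i"] i d' by auto
    qed
    ultimately show ?thesis by auto
  qed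
  show "separated U n r2"
    if U': "U = q @ c # d # r1 @ c' # r2 @ d' # r3" and cd: "{c', d'} = {c, d}" for q c d r1 c' r2 d' r3
  proof -
    obtain i where "0 \<le> i" "i < ?m" "q = map F [0..<i]"
      and i: "c = F i" "d # r1 @ c' # r2 @ d' # r3 = map F [Suc i..<?m]"
      by (rule map_upt_eq_appendE[OF U'[unfolded U]])
    then have d: "d = F (Suc i)" "r1 @ c' # r2 @ d' # r3 = map F [Suc (Suc i)..<?m]"
      unfolding Cons_eq_map_upt by blast+
    obtain j where "j < ?m" "r1 = map F [Suc (Suc i)..<j]"
      and j: "Suc (Suc i) \<le> j" "c' = F j" "r2 @ d' # r3 = map F [Suc j..<?m]"
      by (rule map_upt_eq_appendE[OF d(2)[symmetric]])
    obtain l where l: "Suc j \<le> l" "l < ?m" "d' = F l" "r2 = map F [Suc j..<l]"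
      and "r3 = map F [Suc l..<?m]"
      by (rule map_upt_eq_appendE[OF j(3)[symmetric]])
    from cd consider "F i = F j" "F (Suc i) = F l" | "F i = F l" "F (Suc i) = F j"
      unfolding i(1) d(1) j(2) l(3) by (auto simp: doubleton_eq_iff)
    \<comment> \<open>Among adjacent first occurrences only \<open>x y\<close> qualifies, and its
      second occurrences enclose exactly \<open>z_1 \<dots> z_n\<close>.\<close>
    then have jl: "j = 2 * n + 3 \<and> l = 3 * n + 4"
    proof cases
      case 1
      have "i < j" "j < ?m" "Suc i < l" using j(1) l(1,2) by auto
      from eq[OF this(1,2) 1(1)] eq[OF this(3) l(2) 1(2)] show ?thesis by - (elim disjE conjE; (linarith | presburger))
    next
      case 2
      have "i < l" "Suc i < j" "j < ?m" using j(1) l(1,2) by auto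
      from eq[OF this(1) l(2) 2(1)] eq[OF this(2,3) 2(2)] show ?thesis using l(1) by - (elim disjE conjE; (linarith | presburger))
    qed
    have "inj_on F {Suc j..<l}"
    proof (rule inj_onI)
      fix a b assume "a \<in> {Suc j..<l}" "b \<in> {Suc j..<l}" "F a = F b"
      then show "a = b" using low[of a b] low[of b a] jl by (cases a b rule: linorder_cases) auto
    qed
    then have "card (set r2) = n" using l(4) jl by (simp add: card_image)
    then show ?thesis unfolding separated_def by simp
  qed
  show "separated U n q2"
    if U': "U = q1 @ c' # q2 @ d' # q3 @ c # d # r" and cd: "{c', d'} = {c, d}" for q1 c' q2 d' q3 c d r
  proof -
    obtain i where "0 \<le> i" "i < ?m" "q1 = map F [0..<i]"
      and i: "c' = F i" "q2 @ d' # q3 @ c # d # r = map F [Suc i..<?m]"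
      by (rule map_upt_eq_appendE[OF U'[unfolded U]])
    obtain j where "j < ?m" and j: "Suc i \<le> j" "d' = F j" "q2 = map F [Suc i..<j]" "q3 @ c # d # r = map F [Suc j..<?m]"
      by (rule map_upt_eq_appendE[OF i(2)[symmetric]])
    obtain l where "q3 = map F [Suc j..<l]"
      and l: "Suc j \<le> l" "l < ?m" "c = F l" "d # r = map F [Suc l..<?m]"
      by (rule map_upt_eq_appendE[OF j(4)[symmetric]])
    then have d: "d = F (Suc l)" "Suc l < ?m"
      unfolding Cons_eq_map_upt by blast+
    from cd consider "F i = F l" "F j = F (Suc l)" | "F i = F (Suc l)" "F j = F l"
      unfolding i(1) j(2) l(3) d(1) by (auto simp: doubleton_eq_iff)
    \<comment> \<open>The pairs are \<open>x z_1\<close>, \<open>z_i z_(i+1)\<close> and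
      \<open>z_n y\<close>; the letter whose first occurrence comes earlier is always a
      \<open>z\<close>, followed immediately by its linear letter.\<close>
    then have "odd (Suc i) \<and> Suc i < 2 * n \<and> Suc i < j"
    proof cases
      case 1
      have "i < l" "j < Suc l" using j(1) l(1) by auto
      from eq[OF this(1) l(2) 1(1)] eq[OF this(2) d(2) 1(2)] show ?thesis
        using j(1) n by - (elim disjE conjE; (linarith | presburger))
    next
      case 2
      have "i < Suc l" "j < l" using j(1) l(1) by auto
      from eq[OF this(1) d(2) 2(1)] eq[OF this(2) l(2) 2(2)] show ?thesis
        using j(1) n by - (elim disjE conjE; (linarith | presburger))
    qed
    then show ?thesis by (intro sepI[OF j(3), of "Suc i"]) auto
  qed
qed

section \<open>Identities of S(W) and images inside the six-letter words\<close>

lemma mem_subst_word: "a \<in> set u \<Longrightarrow> c \<in> set (\<theta> a) \<Longrightarrow> c \<in> set (subst_word \<theta> u)"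
  by (auto simp: set_subst_word)

lemma word_cong_factor_ideal: "word_cong (rees_cong {u. \<not> (\<exists>w\<in>W. sublist u w)})"
proof -
  have "sublist u (p @ u @ s)" for u p s :: "'a list"
    by (auto simp: sublist_def)
  then show ?thesis
    by (intro word_cong_rees) (blast intro: sublist_order.order_trans)
qed

lemma satisfies_S_monoid:
  "satisfies (S_monoid W) (u, v) \<longleftrightarrow> (\<forall>\<theta>. subst_word \<theta> u = subst_word \<theta> v \<or>
    \<not> (\<exists>w\<in>W. sublist (subst_word \<theta> u) w) \<and> \<not> (\<exists>w\<in>W. sublist (subst_word \<theta> v) w))"
  unfolding S_monoid_def word_cong.satisfies_quotient[OF word_cong_factor_ideal]
  by (simp add: rees_cong_def)

lemma isoterm_S_monoid:
  assumes "w \<in> W" shows "isoterm (S_monoid W) w"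
  unfolding isoterm_def
proof (intro allI impI)
  fix v assume "satisfies (S_monoid W) (w, v)"
  then have "subst_word (\<lambda>a. [a]) w = subst_word (\<lambda>a. [a]) v \<or>
      \<not> (\<exists>w'\<in>W. sublist (subst_word (\<lambda>a. [a]) w) w')"
    unfolding satisfies_S_monoid by blast
  then show "v = w" using assms by (auto simp: subst_word_id)
qed

lemma rigid_identities: "rigid (identities {M}) w \<longleftrightarrow> isoterm M w"
  by (simp add: rigid_def isoterm_def identities_def)

lemma eq_theory_S_monoid: "eq_theory (identities {S_monoid W})"
  by (rule eq_theory_identities) (simp add: monoid_S_monoid)

lemma sigma_mu_word_split:
  assumes "distinct [x, y, t, s]" "[x, t, x, y, s, y] = A @ c # R" "c \<in> set R"
  shows "c = x \<and> hd R = t \<or> c = y \<and> hd R = s"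
proof -
  have "A = [] \<and> c = x \<and> R = [t, x, y, s, y] \<or> A = [x] \<and> c = t \<and> R = [x, y, s, y] \<or>
      A = [x, t] \<and> c = x \<and> R = [y, s, y] \<or> A = [x, t, x] \<and> c = y \<and> R = [s, y] \<or>
      A = [x, t, x, y] \<and> c = s \<and> R = [y] \<or> A = [x, t, x, y, s] \<and> c = y \<and> R = []"
    using assms(2) by (auto simp: Cons_eq_append_conv)
  then show ?thesis using assms(1,3) by (elim disjE) auto
qed

text \<open>In \<open>x t x y s y\<close> a repeated letter at its first occurrence is followed
  immediately by \<open>t\<close> or \<open>s\<close>. Applied to the first letter of
  \<open>\<theta> a\<close>, this puts a linear letter into the image of \<open>a\<close> or of the
  gap \<open>q1\<close>, all of whose letters occur at least twice.\<close>

lemma sigma_mu_word_avoids: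
  assumes d: "distinct [x, y, t, s]" and w: "w = q0 @ a # q1 @ a # q2" and a: "\<theta> a \<noteq> []"
    and two: "\<forall>e\<in>set q1. 2 \<le> count_list w e"
  shows "\<not> sublist (subst_word \<theta> w) [x, t, x, y, s, y]"
proof
  assume "sublist (subst_word \<theta> w) [x, t, x, y, s, y]"
  then obtain P R where PR: "[x, t, x, y, s, y] = P @ subst_word \<theta> w @ R" by (auto simp: sublist_def)
  obtain c cs where c: "\<theta> a = c # cs" using a by (cases "\<theta> a") auto
  define B where "B = cs @ subst_word \<theta> q1"
  have eq: "[x, t, x, y, s, y] = (P @ subst_word \<theta> q0) @ c # B @ c # (cs @ subst_word \<theta> q2 @ R)"
    using PR w c by (simp add: B_def)
  have "2 \<le> count_list [x, t, x, y, s, y] l" if "l \<in> set B" for l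
  proof -
    have "\<exists>e. l \<in> set (\<theta> e) \<and> 2 \<le> count_list w e"
    proof (cases "l \<in> set cs")
      case True
      then show ?thesis using c w by (intro exI[of _ a]) simp
    next
      case False
      then show ?thesis using that two by (auto simp: B_def set_subst_word)
    qed
    then obtain e where e: "l \<in> set (\<theta> e)" "2 \<le> count_list w e" by (elim exE conjE)
    have "count_list w e \<le> count_list (subst_word \<theta> w) l"
      by (rule count_list_subst_word_le) (rule e(1))
    moreover have "count_list [x, t, x, y, s, y] l =
        count_list P l + (count_list (subst_word \<theta> w) l + count_list R l)"
      unfolding PR by (simp only: count_list_append)
    ultimately show ?thesis using e(2) by linarith
  qed
  moreover have "count_list [x, t, x, y, s, y] t = 1" "count_list [x, t, x, y, s, y] s = 1"
    using d by auto
  ultimately have ts: "t \<notin> set B" "s \<notin> set B" by fastforce+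
  have "c = x \<and> hd (B @ c # (cs @ subst_word \<theta> q2 @ R)) = t \<or>
      c = y \<and> hd (B @ c # (cs @ subst_word \<theta> q2 @ R)) = s"
    by (rule sigma_mu_word_split[OF d eq]) simp
  then show False using ts d by (cases B) auto
qed

lemma six_letters_split:
  "[p1, p2, p3, p4, p5, p6] = A @ c # d # R \<Longrightarrow>
    c = p1 \<and> d = p2 \<and> R = [p3, p4, p5, p6] \<or> c = p2 \<and> d = p3 \<and> R = [p4, p5, p6] \<or>
    c = p3 \<and> d = p4 \<and> R = [p5, p6] \<or> c = p4 \<and> d = p5 \<and> R = [p6] \<or>
    c = p5 \<and> d = p6 \<and> R = []"
  by (auto simp: Cons_eq_append_conv)

lemma sigma_12_word_split:
  assumes d: "distinct [x, y, t, s]" and P: "P = [x, y, t, x, s, y] \<or> P = [x, t, y, s, x, y]"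
    and eq: "P = A @ c # e # R" and mem: "c \<in> set R" "e \<in> set R"
  shows "c = x \<and> e = y \<and> R = [t, x, s, y]"
  using P
proof
  assume "P = [x, y, t, x, s, y]"
  from six_letters_split[OF HOL.trans[OF this[symmetric] eq]] show ?thesis
    using mem d by (elim disjE) auto
next
  assume "P = [x, t, y, s, x, y]"
  from six_letters_split[OF HOL.trans[OF this[symmetric] eq]] show ?thesis
    using mem d by (elim disjE) auto
qed

text \<open>The last letter of \<open>\<theta> a\<close> and the first of \<open>\<theta> b\<close>
  are adjacent and both recur, so they are the initial \<open>x y\<close> of
  \<open>x y t x s y\<close>. The image of \<open>q2\<close> is then a suffix of
  \<open>t x s y\<close> of length at least two, hence contains the linear \<open>s\<close>,
  although all letters of \<open>q2\<close> occur twice.\<close>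

lemma sigma_12_word_avoids:
  assumes d: "distinct [x, y, t, s]" and P: "P = [x, y, t, x, s, y] \<or> P = [x, t, y, s, x, y]"
    and w: "w = q0 @ a # b # q1 @ q2" and ab: "\<theta> a \<noteq> []" "\<theta> b \<noteq> []" "a \<in> set q2" "b \<in> set q2" "a \<noteq> b"
    and two: "\<forall>e\<in>set q2. 2 \<le> count_list w e"
  shows "\<not> sublist (subst_word \<theta> w) P"
proof
  assume "sublist (subst_word \<theta> w) P"
  then obtain L R where LR: "P = L @ subst_word \<theta> w @ R" by (auto simp: sublist_def)
  obtain as c where c: "\<theta> a = as @ [c]" using ab(1) by (cases "\<theta> a" rule: rev_cases) auto
  obtain e es where e: "\<theta> b = e # es" using ab(2) by (cases "\<theta> b") auto
  define \<gamma> where "\<gamma> = subst_word \<theta> q2"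
  define \<beta> where "\<beta> = es @ subst_word \<theta> q1"
  have eq: "P = (L @ subst_word \<theta> q0 @ as) @ c # e # ((\<beta> @ \<gamma>) @ R)"
    using LR w c e by (simp add: \<gamma>_def \<beta>_def)
  have mem: "c \<in> set \<gamma>" "e \<in> set \<gamma>"
    using mem_subst_word[OF ab(3), of c \<theta>] mem_subst_word[OF ab(4), of e \<theta>] c e by (simp_all add: \<gamma>_def)
  have *: "c = x \<and> e = y \<and> (\<beta> @ \<gamma>) @ R = [t, x, s, y]"
    by (rule sigma_12_word_split[OF d P eq]) (use mem in auto)
  have "R = []"
  proof (rule ccontr)
    assume "R \<noteq> []"
    then obtain R' z where "R = R' @ [z]" by (cases R rule: rev_cases) auto
    then have "((\<beta> @ \<gamma>) @ R') @ [z] = [t, x, s] @ [y]" using * by simp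
    then have "(\<beta> @ \<gamma>) @ R' = [t, x, s]" by (simp only: append1_eq_conv)
    then have "set ((\<beta> @ \<gamma>) @ R') = set [t, x, s]" by (rule arg_cong)
    then have "y \<in> {t, x, s}" using mem(2) * by auto
    then show False using d by auto
  qed
  then have \<beta>\<gamma>: "\<beta> @ \<gamma> = [t, x, s, y]" using * by simp
  have "2 \<le> length \<gamma>"
  proof -
    obtain r1 z r2 z' r3 where q2: "q2 = r1 @ z # r2 @ z' # r3" "{z, z'} = {a, b}"
      using split_list_two[OF ab(3-5)] by blast
    then have "\<theta> z \<noteq> []" "\<theta> z' \<noteq> []" using ab by (auto simp: doubleton_eq_iff)
    then have "1 \<le> length (\<theta> z)" "1 \<le> length (\<theta> z')" by (simp_all add: Suc_leI)
    then show ?thesis unfolding \<gamma>_def q2(1) by simp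
  qed
  then have "s \<in> set \<gamma>" using \<beta>\<gamma> by (auto simp: append_eq_Cons_conv)
  then obtain z where "z \<in> set q2" "s \<in> set (\<theta> z)" by (auto simp: \<gamma>_def set_subst_word)
  then have "2 \<le> count_list w z" "count_list w z \<le> count_list (subst_word \<theta> w) s"
    using two count_list_subst_word_le[of s \<theta> z w] by blast+
  moreover have "count_list P s = 1" using P d by auto
  moreover have "count_list P s = count_list L s + (count_list (subst_word \<theta> w) s + count_list R s)"
    unfolding LR by (simp only: count_list_append)
  ultimately show False by linarith
qed

lemma map_upt_split:
  "i < m \<Longrightarrow> map F [0..<m] = map F [0..<i] @ F i # map F [Suc i..<m]"
  using upt_add_eq_append[of 0 i "m - i"] by (simp add: upt_conv_Cons)

lemma map_upt_split':
  "i \<le> j \<Longrightarrow> j \<le> m \<Longrightarrow> map F [i..<m] = map F [i..<j] @ map F [j..<m]"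
  using upt_add_eq_append[of i j "m - j"] by simp

lemma ex_rename_four:
  assumes "distinct [x, y, t, s]" "distinct [x', y', t', s']"
  shows "\<exists>p. p x = x' \<and> p y = y' \<and> p t = t' \<and> p s = s' \<and> inj_on p {x, y, t, s}"
proof -
  define p where "p = (\<lambda>_. x')(y := y', t := t', s := s')"
  have p: "p x = x'" "p y = y'" "p t = t'" "p s = s'"
    using assms(1) by (auto simp: p_def)
  then have "distinct (map p [x, y, t, s])" using assms(2) by (simp only: list.map)
  then have "inj_on p (set [x, y, t, s])" unfolding distinct_map by (rule conjunct2)
  then show ?thesis using p by (intro exI[of _ p]) simp
qed

context xtx_theory
begin

text \<open>The only possible partner of the second word is the first, which is an isoterm. The next
  two lemmas argue in the same way.\<close>

lemma rigid_sigma_mu_words: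
  assumes d: "distinct [x, y, t, s]" "distinct [x', y', t', s']" and r: "rigid E [x, t, x, y, s, y]"
  shows "rigid E [x', t', x', y', s', y']" "rigid E [x', t', y', x', s', y']"
proof -
  obtain p where "p x = x'" "p y = y'" "p t = t'" "p s = s'" "inj_on p {x, y, t, s}"
    using ex_rename_four[OF d] by blast
  moreover have "set [x, t, x, y, s, y] = {x, y, t, s}" by auto
  ultimately show p: "rigid E [x', t', x', y', s', y']"
    using rigid_map[OF r, of p] by (simp only: list.map)
  show "rigid E [x', t', y', x', s', y']"
    unfolding rigid_def
  proof (intro allI impI)
    fix v assume v: "([x', t', y', x', s', y'], v) \<in> E"
    from sigma_mu_partner[OF d(2) v] have "v = [x', t', x', y', s', y'] \<or> v = [x', t', y', x', s', y']"
      by simp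
    then show "v = [x', t', y', x', s', y']"
      using rigidD[OF p sym_mem] v by metis
  qed
qed

lemma rigid_sigma_1_words:
  assumes d: "distinct [x, y, t, s]" "distinct [x', y', t', s']" and r: "rigid E [x, y, t, x, s, y]"
  shows "rigid E [x', y', t', x', s', y']" "rigid E [y', x', t', x', s', y']"
proof -
  obtain p where "p x = x'" "p y = y'" "p t = t'" "p s = s'" "inj_on p {x, y, t, s}"
    using ex_rename_four[OF d] by blast
  moreover have "set [x, y, t, x, s, y] = {x, y, t, s}" by auto
  ultimately show p: "rigid E [x', y', t', x', s', y']"
    using rigid_map[OF r, of p] by (simp only: list.map)
  show "rigid E [y', x', t', x', s', y']"
    unfolding rigid_def
  proof (intro allI impI)
    fix v assume v: "([y', x', t', x', s', y'], v) \<in> E"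
    from sigma_1_partner[OF d(2) v] have "v = [x', y', t', x', s', y'] \<or> v = [y', x', t', x', s', y']"
      by simp
    then show "v = [y', x', t', x', s', y']"
      using rigidD[OF p sym_mem] v by metis
  qed
qed

lemma rigid_sigma_2_words:
  assumes d: "distinct [x, y, t, s]" "distinct [x', y', t', s']" and r: "rigid E [x, t, y, s, x, y]"
  shows "rigid E [x', t', y', s', x', y']" "rigid E [x', t', y', s', y', x']"
proof -
  obtain p where "p x = x'" "p y = y'" "p t = t'" "p s = s'" "inj_on p {x, y, t, s}"
    using ex_rename_four[OF d] by blast
  moreover have "set [x, t, y, s, x, y] = {x, y, t, s}" by auto
  ultimately show p: "rigid E [x', t', y', s', x', y']"
    using rigid_map[OF r, of p] by (simp only: list.map)
  show "rigid E [x', t', y', s', y', x']"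
    unfolding rigid_def
  proof (intro allI impI)
    fix v assume v: "([x', t', y', s', y', x'], v) \<in> E"
    from sigma_2_partner[OF d(2) v] have "v = [x', t', y', s', x', y'] \<or> v = [x', t', y', s', y', x']"
      by simp
    then show "v = [x', t', y', s', y', x']"
      using rigidD[OF p sym_mem] v by metis
  qed
qed

end

theorem sigma_mu_word_not_finitely_based:
  fixes x y t s :: "'a::infinite"
  assumes d: "distinct [x, y, t, s]"
  shows "\<not> word_set_finitely_based {[x, t, x, y, s, y]}"
proof -
  define E :: "'a identity set" where "E = identities {S_monoid {[x, t, x, y, s, y]}}"
  have E: "eq_theory E" unfolding E_def by (rule eq_theory_S_monoid)
  interpret E: eq_theory E by (rule E)
  have p: "rigid E [x, t, x, y, s, y]"
    unfolding E_def rigid_identities by (rule isoterm_S_monoid) simp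
  then have "rigid E [x, t, x]" using E.rigid_factor[of "[]" "[x, t, x]" "[y, s, y]"] by simp
  then interpret xtx_theory E x t
    using d by unfold_locales auto
  obtain f :: "nat \<Rightarrow> 'a" where f: "inj f"
    using infinite_countable_subset[OF infinite_UNIV] by blast
  have "\<exists>U V. (U, V) \<in> E \<and> U \<noteq> V \<and>
      (\<forall>p s \<theta> u. U = p @ subst_word \<theta> u @ s \<longrightarrow> (\<forall>a\<in>set u. \<theta> a \<noteq> []) \<longrightarrow>
        card (set u) < n \<longrightarrow> rigid E u)" for n
  proof -
    \<comment> \<open>A positive parameter guarantees that a letter \<open>z_1\<close> stands
      between the two occurrences of \<open>x\<close>.\<close>
    define N where "N = Suc n"
    define m where "m = 6 * N + 2"
    define F where "F k = f (alternating_pos N k)" for k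
    define U where "U = map F [0..<m]"
    define A B C where "A = map F [0..<2 * N]" and "B = map F [Suc (Suc (2 * N))..<4 * N + 1]"
      and "C = map F [Suc (4 * N + 1)..<m]"
    have pos: "F (2 * N) = f (2 * N)" "F (Suc (2 * N)) = f 0" "F (4 * N + 1) = f (2 * N)"
      by (auto simp: F_def alternating_pos_def N_def)
    have U: "U = A @ f (2 * N) # (f 0 # B) @ f (2 * N) # C"
    proof -
      have "map F [Suc (2 * N)..<m] = f 0 # map F [Suc (Suc (2 * N))..<m]"
        by (subst upt_conv_Cons) (simp_all add: pos m_def)
      moreover have "map F [Suc (Suc (2 * N))..<m] = B @ map F [4 * N + 1..<m]"
        unfolding B_def by (rule map_upt_split') (simp_all add: m_def N_def)
      moreover have "map F [4 * N + 1..<m] = f (2 * N) # C"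
        unfolding C_def by (subst upt_conv_Cons) (simp_all add: pos(3)[simplified] m_def)
      moreover have "U = A @ F (2 * N) # map F [Suc (2 * N)..<m]"
        unfolding U_def A_def by (rule map_upt_split) (simp add: m_def)
      ultimately show ?thesis using pos by simp
    qed
    \<comment> \<open>\<open>V\<close> exchanges the first \<open>x\<close> with the
      \<open>z_1\<close> next to it. All letters between the two occurrences of \<open>x\<close> are
      repeated, in \<open>U\<close> as well as in \<open>V\<close>.\<close>
    define V where "V = (A @ [f 0]) @ f (2 * N) # B @ f (2 * N) # C"
    have count: "2 \<le> count_list U e" if "e \<in> set (f 0 # B)" for e
    proof -
      have "f 0 \<in> F ` {2 * N<..<4 * N + 1}"
        unfolding pos(2)[symmetric] by (rule imageI) (simp add: N_def)
      moreover have "set B \<subseteq> F ` {2 * N<..<4 * N + 1}"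
        unfolding B_def set_map by (rule image_mono) auto
      ultimately have "e \<in> F ` {2 * N<..<4 * N + 1}" using \<open>e \<in> set (f 0 # B)\<close> by auto
      then obtain k where k: "2 * N < k" "k < 4 * N + 1" "e = F k" by auto
      show ?thesis
      proof (cases "even k")
        case True
        have "F (k + (2 * N + 1)) = F k" unfolding F_def using alternating_pos_add[OF True] by simp
        then show ?thesis unfolding U_def k(3)
          by (intro count_list_map_upt_ge_2[of "k + (2 * N + 1)"]) (use k in \<open>auto simp: m_def\<close>)
      next
        case False
        then obtain j where j: "k = j + (2 * N + 1)" "even j"
          using k(1) by (metis add.commute even_add even_mult_iff even_numeral less_eq_Suc_le odd_one plus_1_eq_Suc le_Suc_ex)
        have "F j = F k" unfolding F_def j(1) using alternating_pos_add[OF j(2)] by simp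
        then show ?thesis unfolding U_def k(3)
          by (intro count_list_map_upt_ge_2[of j]) (use k j in \<open>auto simp: m_def\<close>)
      qed
    qed
    have cUV: "count_list V e = count_list U e" for e
      unfolding U V_def by simp
    have "(U, V) \<in> E"
      unfolding E_def identities_def
    proof (simp only: mem_Collect_eq Set.ball_simps satisfies_S_monoid, intro conjI TrueI allI)
      fix \<theta> :: "'a \<Rightarrow> 'a list"
      show "subst_word \<theta> U = subst_word \<theta> V \<or>
        \<not> (\<exists>w\<in>{[x, t, x, y, s, y]}. sublist (subst_word \<theta> U) w) \<and>
        \<not> (\<exists>w\<in>{[x, t, x, y, s, y]}. sublist (subst_word \<theta> V) w)"
      \<comment> \<open>If \<open>x\<close> disappears, the two images coincide; otherwise neither
        of them is a factor of the six-letter word.\<close>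
      proof (cases "\<theta> (f (2 * N)) = []")
        case True
        then show ?thesis by (simp add: U V_def)
      next
        case False
        have "\<not> sublist (subst_word \<theta> U) [x, t, x, y, s, y]"
          by (rule sigma_mu_word_avoids[where \<theta> = \<theta>, OF d U False]) (use count in blast)
        moreover have "\<not> sublist (subst_word \<theta> V) [x, t, x, y, s, y]"
          by (rule sigma_mu_word_avoids[where \<theta> = \<theta>, OF d V_def False]) (use count cUV in auto)
        ultimately show ?thesis by blast
      qed
    qed
    moreover have "U \<noteq> V"
      using f by (auto simp: U V_def N_def dest: injD)
    moreover have "rigid E u" if "U = q @ subst_word \<theta> u @ r" "\<forall>a\<in>set u. \<theta> a \<noteq> []" "card (set u) < n"
      for q r \<theta> u
    proof (rule alternating_word_rigid[OF f _ _ that(1,2)])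
      show "F = (\<lambda>k. f (alternating_pos N k))" by (simp add: F_def fun_eq_iff)
      show "U = map F [0..<6 * N + 2]" by (simp only: U_def m_def)
      show "card (set u) < N" using that(3) by (simp add: N_def)
    qed (use rigid_sigma_mu_words[OF d _ p] in blast)+
    ultimately show ?thesis by blast
  qed
  from not_finitely_based_criterion[OF E this] show ?thesis
    unfolding word_set_finitely_based_def finitely_based_def E_def .
qed

theorem sigma_12_words_not_finitely_based:
  fixes x y t s :: "'a::infinite"
  assumes d: "distinct [x, y, t, s]"
  shows "\<not> word_set_finitely_based {[x, y, t, x, s, y], [x, t, y, s, x, y]}"
proof -
  let ?W = "{[x, y, t, x, s, y], [x, t, y, s, x, y]}"
  define E :: "'a identity set" where "E = identities {S_monoid ?W}"
  have E: "eq_theory E" unfolding E_def by (rule eq_theory_S_monoid)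
  interpret E: eq_theory E by (rule E)
  have p: "rigid E [x, y, t, x, s, y]" "rigid E [x, t, y, s, x, y]"
    unfolding E_def rigid_identities by (rule isoterm_S_monoid, simp)+
  \<comment> \<open>\<open>x t x\<close> is not a factor of either word. Substituting
    \<open>y t\<close> for \<open>t\<close> leads to the factor \<open>x y t x\<close>, and deleting
    \<open>y\<close> afterwards recovers \<open>v\<close>.\<close>
  have "rigid E [x, t, x]"
    unfolding rigid_def
  proof (intro allI impI)
    fix v assume v: "([x, t, x], v) \<in> E"
    define \<theta> where "\<theta> = (\<lambda>a. [a])(t := [y, t])"
    have "rigid E [x, y, t, x]"
      using p(1) E.rigid_factor[of "[]" "[x, y, t, x]" "[s, y]"] by simp
    moreover have "([x, y, t, x], subst_word \<theta> v) \<in> E"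
      using E.subst_mem[OF v, of \<theta>] d by (simp add: \<theta>_def)
    ultimately have eq: "subst_word \<theta> v = [x, y, t, x]" by (rule rigidD)
    have "set v \<subseteq> {x, t}" using E.rigid_set[OF p(1) v] by auto
    then have "res {x, t} (subst_word \<theta> v) = v"
      using d by (induction v) (auto simp: \<theta>_def)
    then show "v = [x, t, x]" using eq d by auto
  qed
  then interpret xtx_theory E x t
    using d by unfold_locales auto
  obtain f :: "nat \<Rightarrow> 'a" where f: "inj f"
    using infinite_countable_subset[OF infinite_UNIV] by blast
  have "\<exists>U V. (U, V) \<in> E \<and> U \<noteq> V \<and>
      (\<forall>p s \<theta> u. U = p @ subst_word \<theta> u @ s \<longrightarrow> (\<forall>a\<in>set u. \<theta> a \<noteq> []) \<longrightarrow>
        card (set u) < n \<longrightarrow> rigid E u)" for n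
  proof -
    define N where "N = Suc n"
    define m where "m = 3 * N + 5"
    define F where "F k = f (parallel_pos N k)" for k
    define U where "U = map F [0..<m]"
    define A B where "A = map F [0..<2 * N]" and "B = map F [2 * N + 3..<m]"
    define a b c where "a = f (2 * N)" and "b = f (2 * N + 1)" and "c = f (2 * N + 2)"
    have pos: "F (2 * N) = a" "F (2 * N + 1) = b" "F (2 * N + 2) = c" "F (2 * N + 3) = a" "F (3 * N + 4) = b"
      by (auto simp: F_def a_def b_def c_def parallel_pos_simps)
    have U: "U = A @ a # b # [c] @ B"
    proof -
      have "U = A @ map F [2 * N..<2 * N + 3] @ B"
        using map_upt_split'[of 0 "2 * N" m F] map_upt_split'[of "2 * N" "2 * N + 3" m F]
        by (simp add: U_def A_def B_def m_def)
      moreover have "[2 * N..<2 * N + 3] = [2 * N, 2 * N + 1, 2 * N + 2]"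
        by (simp add: upt_conv_Cons)
      ultimately show ?thesis using pos by simp
    qed
    \<comment> \<open>\<open>a\<close>, \<open>b\<close>, \<open>c\<close> are the letters
      \<open>x\<close>, \<open>y\<close>, \<open>t\<close> of the long word; \<open>V\<close>
      exchanges the first occurrences of \<open>x\<close> and \<open>y\<close>. The suffix
      \<open>B\<close> consists of second occurrences.\<close>
    define V where "V = A @ b # a # [c] @ B"
    have ab: "a \<noteq> b" using f by (auto simp: a_def b_def dest: injD)
    have "F (2 * N + 3) \<in> set B" "F (3 * N + 4) \<in> set B"
      by (auto simp: B_def m_def)
    then have mem: "a \<in> set B" "b \<in> set B" by (simp_all only: pos)
    have count: "2 \<le> count_list U e" if "e \<in> set B" for e
    proof -
      obtain k where k: "2 * N + 3 \<le> k" "k < m" "e = F k"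
        using \<open>e \<in> set B\<close> by (auto simp: B_def)
      have "k < 3 * N + 5" using k by (simp add: m_def)
      then obtain j where "j < 2 * N + 3" "F j = F k"
      proof (cases rule: parallel_pos_cases)
        case 2
        then show ?thesis using that[of "2 * N"] pos by simp
      next
        case (3 i)
        then show ?thesis using that[of "2 * i"] by (simp add: F_def parallel_pos_simps)
      next
        case 4
        then show ?thesis using that[of "2 * N + 1"] pos by simp
      qed (use k in simp)
      then show ?thesis unfolding U_def k(3)
        by (intro count_list_map_upt_ge_2[of j]) (use k in auto)
    qed
    have cUV: "count_list V e = count_list U e" for e
      unfolding U V_def by simp
    have avoid: "\<not> (\<exists>w\<in>?W. sublist (subst_word \<theta> Z) w)"
      if "\<theta> a \<noteq> []" "\<theta> b \<noteq> []" "Z = U \<or> Z = V" for Z \<theta>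
    proof -
      have "\<not> sublist (subst_word \<theta> Z) w" if w: "w = [x, y, t, x, s, y] \<or> w = [x, t, y, s, x, y]" for w
        using \<open>Z = U \<or> Z = V\<close>
      proof
        assume Z: "Z = U"
        show ?thesis unfolding Z
          by (rule sigma_12_word_avoids[OF d w U \<open>\<theta> a \<noteq> []\<close> \<open>\<theta> b \<noteq> []\<close> mem ab]) (use count in blast)
      next
        assume Z: "Z = V"
        show ?thesis unfolding Z
          by (rule sigma_12_word_avoids[OF d w V_def \<open>\<theta> b \<noteq> []\<close> \<open>\<theta> a \<noteq> []\<close> mem(2,1) ab[symmetric]])
            (use count cUV in auto)
      qed
      then show ?thesis by blast
    qed
    have "(U, V) \<in> E"
      unfolding E_def identities_def
    proof (simp only: mem_Collect_eq Set.ball_simps satisfies_S_monoid, intro conjI TrueI allI)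
      fix \<theta> :: "'a \<Rightarrow> 'a list"
      show "subst_word \<theta> U = subst_word \<theta> V \<or>
        \<not> (\<exists>w\<in>?W. sublist (subst_word \<theta> U) w) \<and> \<not> (\<exists>w\<in>?W. sublist (subst_word \<theta> V) w)"
      proof (cases "\<theta> a = [] \<or> \<theta> b = []")
        case True
        then show ?thesis by (auto simp: U V_def)
      next
        case False
        then show ?thesis using avoid by blast
      qed
    qed
    moreover have "U \<noteq> V"
      using ab by (simp add: U V_def)
    moreover have "rigid E u" if "U = q @ subst_word \<theta> u @ r" "\<forall>a\<in>set u. \<theta> a \<noteq> []" "card (set u) < n"
      for q r \<theta> u
    proof (rule parallel_word_rigid[OF f _ _ that(1,2)])
      show "F = (\<lambda>k. f (parallel_pos N k))" by (simp add: F_def fun_eq_iff)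
      show "U = map F [0..<3 * N + 5]" by (simp only: U_def m_def)
      show "card (set u) < N" using that(3) by (simp add: N_def)
    qed (use rigid_sigma_1_words[OF d _ p(1)] rigid_sigma_2_words[OF d _ p(2)] in blast)+
    ultimately show ?thesis by blast
  qed
  from not_finitely_based_criterion[OF E this] show ?thesis
    unfolding word_set_finitely_based_def finitely_based_def E_def .
qed

section \<open>The equivalences\<close>

lemma var_gen_subset: "M \<in> var_of \<Sigma> \<Longrightarrow> var_gen M \<subseteq> var_of \<Sigma>"
  by (auto simp: var_gen_def monoid_variety_def)

lemma finitely_based_sigma_1:
  fixes V :: "'a::infinite list set monoid set"
  assumes d: "distinct [x, y, t, s]" and V: "V \<subseteq> var_of {sigma_1 x y t s, sigma_mu x y t s}"
  shows "finitely_based V"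
proof -
  have "sigma_theory (identities V) x y t s"
    unfolding sigma_theory_def sigma_theory_axioms_def
    using d V by (intro conjI eq_theory_identities) (auto simp: var_of_def identities_def)
  from sigma_theory_finitely_based[OF this] show ?thesis
    unfolding finitely_based_def .
qed

lemma finitely_based_sigma_2:
  fixes V :: "'a::infinite list set monoid set"
  assumes d: "distinct [x, y, t, s]" and V: "V \<subseteq> var_of {sigma_2 x y t s, sigma_mu x y t s}"
  shows "finitely_based V"
proof -
  define E :: "'a identity set" where "E = identities V"
  define E' :: "'a identity set" where "E' = {(u, v). (rev u, rev v) \<in> E}"
  have E: "eq_theory E" unfolding E_def
    using V by (intro eq_theory_identities) (auto simp: var_of_def)
  have mem: "sigma_2 x y t s \<in> E" "sigma_mu x y t s \<in> E"
    using V by (auto simp: E_def identities_def var_of_def)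
  have "eq_theory E'" unfolding E'_def by (rule eq_theory_rev[OF E])
  \<comment> \<open>Reversal turns \<open>sigma_2\<close> into \<open>sigma_1\<close> and
    \<open>sigma_mu\<close> into itself once \<open>x, y\<close> and \<open>t, s\<close> are
    interchanged.\<close>
  then have "sigma_theory E' y x s t"
    unfolding sigma_theory_def sigma_theory_axioms_def
    using d mem by (auto simp: E'_def sigma_1_def sigma_2_def sigma_mu_def)
  from sigma_theory_finitely_based[OF this]
  obtain \<Sigma>' where \<Sigma>': "finite \<Sigma>'" "\<Sigma>' \<subseteq> E'" "\<forall>(u, v)\<in>E'. deducible \<Sigma>' u v" by blast
  define \<Sigma> where "\<Sigma> = (\<lambda>(u, v). (rev u, rev v)) ` \<Sigma>'"
  have "deducible \<Sigma> u v" if "(u, v) \<in> E" for u v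
  proof -
    have "(rev u, rev v) \<in> E'" using that by (simp add: E'_def)
    then have "deducible \<Sigma>' (rev u) (rev v)" using \<Sigma>'(3) by blast
    from deducible_rev[OF this \<Sigma>_def] show ?thesis by simp
  qed
  moreover have "finite \<Sigma>" "\<Sigma> \<subseteq> E" using \<Sigma>' by (auto simp: \<Sigma>_def E'_def)
  ultimately show ?thesis
    unfolding finitely_based_def E_def by blast
qed

text \<open>If an instance of one side is a factor of a word of \<open>W\<close>, replacing it by
  the other side yields an identity of \<open>M\<close> for that isoterm, so the two instances are
  equal. Hence \<open>S_monoid W\<close> lies in the variety generated by \<open>M\<close>.\<close>

lemma satisfies_S_monoid_of_isoterms:
  fixes M :: "('b, 'c) monoid_scheme" and W :: "'a list set" and u v :: "'a list"
  assumes M: "monoid M" and iso: "\<forall>w\<in>W. isoterm M w" and uv: "satisfies M (u, v)"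
  shows "satisfies (S_monoid W) (u, v)"
proof -
  interpret eq_theory "{e :: 'a identity. satisfies M e}" by (rule monoid.eq_theory_satisfies[OF M])
  have eq: "subst_word \<theta> v = subst_word \<theta> u"
    if "satisfies M (u, v)" "w \<in> W" and sub: "sublist (subst_word \<theta> u) w"
    for u v w and \<theta> :: "'a \<Rightarrow> 'a list"
  proof -
    obtain p s where w: "w = p @ subst_word \<theta> u @ s" using sub by (auto simp: sublist_def)
    have "satisfies M (p @ subst_word \<theta> u @ s, p @ subst_word \<theta> v @ s)"
      using context_mem[OF subst_mem, of u v p \<theta> s] that(1) by simp
    then have "p @ subst_word \<theta> v @ s = w"
      using iso that(2) unfolding w isoterm_def by blast
    then show ?thesis using w by simp
  qed
  have "satisfies M (v, u)" using sym_mem[of u v] uv by simp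
  then show ?thesis
    unfolding satisfies_S_monoid using eq[OF uv] eq[of v u] by metis
qed

lemma hereditary_imp_word_set_hereditary:
  fixes W :: "'a list set"
  assumes I: "hereditarily_finitely_based (S_monoid W)"
  shows "word_set_hereditarily_finitely_based W"
  unfolding word_set_hereditarily_finitely_based_def
proof (intro allI impI)
  fix W' :: "'a list set" assume "W \<preceq> W'"
  then have iso: "\<forall>w\<in>W'. isoterm (S_monoid W) w"
    using monoid_S_monoid isoterm_S_monoid unfolding word_set_le_def by blast
  define \<Sigma> :: "'a identity set" where "\<Sigma> = identities {S_monoid W'}"
  have ids: "satisfies (S_monoid W') e" if "satisfies (S_monoid W) e" for e :: "'a identity"
    using satisfies_S_monoid_of_isoterms[OF monoid_S_monoid iso, of "fst e" "snd e"] that by simp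
  \<comment> \<open>\<open>var_of \<Sigma>\<close> is the variety generated by
    \<open>S_monoid W'\<close>; it has the same identities as that monoid and therefore the same
    finite bases.\<close>
  have "var_of \<Sigma> \<subseteq> var_gen (S_monoid W)"
    unfolding var_gen_def
  proof (intro subsetI InterI)
    fix N V assume N: "N \<in> var_of \<Sigma>" and V: "V \<in> {V. monoid_variety V \<and> S_monoid W \<in> V}"
    then obtain \<Sigma>' where \<Sigma>': "V = var_of \<Sigma>'" "S_monoid W \<in> var_of \<Sigma>'"
      by (auto simp: monoid_variety_def)
    then have "e \<in> \<Sigma>" if "e \<in> \<Sigma>'" for e
      using ids[of e] that by (simp add: var_of_def \<Sigma>_def identities_def)
    then show "N \<in> V" using N by (simp add: \<Sigma>' var_of_def)
  qed
  moreover have "monoid_variety (var_of \<Sigma>)" unfolding monoid_variety_def by blast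
  ultimately have "finitely_based (var_of \<Sigma>)"
    using I by (simp add: hereditarily_finitely_based_def)
  moreover have "(identities (var_of \<Sigma>) :: 'a identity set) = identities {S_monoid W'}"
    by (auto simp: identities_def var_of_def \<Sigma>_def monoid_S_monoid)
  ultimately show "word_set_finitely_based W'"
    by (simp add: word_set_finitely_based_def finitely_based_def)
qed

lemma word_set_hereditary_imp_not_le:
  fixes W :: "'a::infinite list set"
  assumes d: "distinct [x, y, t, s]" and II: "word_set_hereditarily_finitely_based W"
  shows "\<not> W \<preceq> {[x, t, x, y, s, y]} \<and>
    (\<not> W \<preceq> {[x, y, t, x, s, y]} \<or> \<not> W \<preceq> {[x, t, y, s, x, y]})"
proof -
  have "\<not> W \<preceq> {[x, t, x, y, s, y]}"
    using II sigma_mu_word_not_finitely_based[OF d]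
    unfolding word_set_hereditarily_finitely_based_def by blast
  moreover have "\<not> W \<preceq> {[x, y, t, x, s, y], [x, t, y, s, x, y]}"
    using II sigma_12_words_not_finitely_based[OF d]
    unfolding word_set_hereditarily_finitely_based_def by blast
  then have "\<not> W \<preceq> {[x, y, t, x, s, y]} \<or> \<not> W \<preceq> {[x, t, y, s, x, y]}"
    unfolding word_set_le_def by auto
  ultimately show ?thesis by blast
qed

text \<open>The letter \<open>t\<close> stays linear, so a partner of \<open>x t x\<close> is
  \<open>x^i t x^j\<close>. Applied to factors \<open>a C a\<close> of the given isoterm, it gives
  \<open>i + j = 2\<close>, and \<open>a C = C a\<close> unless \<open>i = j = 1\<close>.
  Commutation contradicts the adjacency of different letters if \<open>c\<close> recurs on the right
  or \<open>d\<close> on the left.\<close>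

lemma (in eq_theory) xtx_rigid_of_adjacent:
  assumes r: "rigid E (P @ c # d # Q)" and cd: "c \<noteq> d"
    and c: "c \<in> set P \<union> set Q" and d: "d \<in> set P \<union> set Q" and xt: "x \<noteq> t"
  shows "rigid E [x, t, x]"
  unfolding rigid_def
proof (intro allI impI)
  fix v assume v: "([x, t, x], v) \<in> E"
  let ?\<theta> = "\<lambda>a C. (\<lambda>_. [])(x := [a], t := C)"
  have sub: "(a # C @ [a], subst_word (?\<theta> a C) v) \<in> E" for a C
    using subst_mem[OF v, of "?\<theta> a C"] xt by simp
  have fac: "rigid E f" if "P @ c # d # Q = p @ f @ s" for p f s
    using r that rigid_factor by metis
  have rigt: "rigid E [t]"
    using rigid_map[OF fac[of P "[c]" "d # Q"], of "\<lambda>_. t"] by simp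
  have sv: "set v \<subseteq> {x, t}" using rigid_set[OF r v] by auto
  have "([t], res {t} v) \<in> E" using res_mem[OF v, of "{t}"] xt by simp
  then have vt: "res {t} v = [t]" by (rule rigidD[OF rigt])
  then obtain v1 v2 where v12: "v = v1 @ t # v2" "set v1 \<inter> {t} = {}" "res {t} v2 = []"
    by (rule res_ConsE)
  have v1: "v1 = replicate (length v1) x"
    using sv v12 by (intro replicate_length_same[symmetric]) auto
  have v2: "v2 = replicate (length v2) x"
    using sv v12 by (intro replicate_length_same[symmetric]) (auto simp: filter_empty_conv)
  define i j where "i = length v1" and "j = length v2"
  have vij: "v = replicate i x @ t # replicate j x" using v12(1) v1 v2 by (simp add: i_def j_def)
  have img: "subst_word (?\<theta> a C) v = replicate i a @ C @ replicate j a" for a C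
  proof -
    have "subst_word (?\<theta> a C) (replicate k x) = replicate k a" for k
      using xt by (induction k) auto
    then show ?thesis by (simp add: vij)
  qed
  have key: "replicate i a @ C @ replicate j a = a # C @ [a]" if "rigid E (a # C @ [a])" for a C
    using rigidD[OF that sub] img by simp
  have key': "replicate i a @ C @ replicate j a = a # C @ [a]"
    if "rigid E (replicate i a @ C @ replicate j a)" for a C
    using rigidD[OF that] sym_mem[OF sub, of a C] img by fastforce
  have main: "i = 1 \<and> j = 1 \<or> (i = 2 \<and> j = 0 \<or> i = 0 \<and> j = 2) \<and> a # C = C @ [a]"
    if "rigid E (a # C @ [a])" for a C
  proof -
    have eq: "replicate i a @ C @ replicate j a = a # C @ [a]" by (rule key[OF that])
    from arg_cong[OF eq, of length] have "i + j = 2" by simp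
    then consider "i = 1" "j = 1" | "i = 2" "j = 0" | "i = 0" "j = 2" by linarith
    then show ?thesis using eq by cases (auto simp: numeral_2_eq_2)
  qed
  have "i = 1 \<and> j = 1"
  proof (rule ccontr)
    assume no: "\<not> (i = 1 \<and> j = 1)"
    consider "c \<in> set Q" | "d \<in> set P" | "c \<in> set P" "d \<in> set Q" using c d by blast
    then show False
    proof cases
      case 1
      then obtain Q1 Q2 where "Q = Q1 @ c # Q2" by (meson split_list)
      then have "rigid E (c # (d # Q1) @ [c])" by (intro fac[of P _ Q2]) simp
      from main[OF this] no cd show False by simp
    next
      case 2
      then obtain P1 P2 where "P = P1 @ d # P2" by (meson split_list)
      then have "rigid E (d # (P2 @ [c]) @ [d])" by (intro fac[of P1 _ Q]) simp
      from main[OF this] no have "d # (P2 @ [c]) = (P2 @ [c]) @ [d]" by blast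
      then have "last (d # (P2 @ [c])) = last ((P2 @ [c]) @ [d])" by (rule arg_cong)
      then show False using cd by simp
    next
      case 3
      obtain P1 P2 where P: "P = P1 @ c # P2" using 3(1) by (meson split_list)
      obtain Q1 Q2 where Q: "Q = Q1 @ d # Q2" using 3(2) by (meson split_list)
      have rc: "rigid E (c # P2 @ [c])" using P by (intro fac[of P1 _ "d # Q"]) simp
      have rd: "rigid E (d # Q1 @ [d])" using Q by (intro fac[of "P @ [c]" _ Q2]) simp
      \<comment> \<open>Here commutation is possible but shows that \<open>c c d\<close> and
        \<open>c d d\<close> are factors; one of them is an instance of \<open>x x t\<close> or of
        \<open>t x x\<close>, and the identity would alter it.\<close>
      from main[OF rc] no have ij: "i = 2 \<and> j = 0 \<or> i = 0 \<and> j = 2" and cP: "c # P2 = P2 @ [c]" by blast+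
      from main[OF rd] no have dQ: "d # Q1 = Q1 @ [d]" by blast
      from ij show False
      proof
        assume ij: "i = 2 \<and> j = 0"
        have "P @ c # d # Q = (P1 @ P2) @ [c, c, d] @ Q" using P cP by simp
        then have "rigid E [c, c, d]" by (rule fac)
        then have "rigid E (replicate i c @ [d] @ replicate j c)" using ij by (simp add: numeral_2_eq_2)
        from key'[OF this] show False using ij cd by (simp add: numeral_2_eq_2)
      next
        assume ij: "i = 0 \<and> j = 2"
        have "P @ c # d # Q = P @ [c, d, d] @ (Q1 @ Q2)" using Q dQ
          by (metis append.assoc append_Cons append_Nil)
        then have "rigid E [c, d, d]" by (rule fac)
        then have "rigid E (replicate i d @ [c] @ replicate j d)" using ij by (simp add: numeral_2_eq_2)
        from key'[OF this] show False using ij cd by (simp add: numeral_2_eq_2)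
      qed
    qed
  qed
  then show "v = [x, t, x]" using vij by simp
qed

text \<open>Since \<open>x t x\<close> is an isoterm, \<open>l\<close> has at most the one
  nontrivial partner \<open>r\<close>. The identity \<open>l \<approx> r\<close> fails because one
  of its instances would change a word of \<open>W\<close>.\<close>

lemma le_of_unsatisfied:
  assumes w: "P @ c # d # Q \<in> W" "c \<noteq> d" "c \<in> set P \<union> set Q" "d \<in> set P \<union> set Q"
    and xt: "x \<noteq> t"
    and partner: "\<And>E v. xtx_theory E x t \<Longrightarrow> (l, v) \<in> E \<Longrightarrow> v = l \<or> v = r"
    and \<theta>: "subst_word \<theta> l \<noteq> subst_word \<theta> r"
      "P @ c # d # Q = p @ subst_word \<theta> l @ s \<or> P @ c # d # Q = p @ subst_word \<theta> r @ s"
  shows "W \<preceq> {l}"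
  unfolding word_set_le_def
proof (intro allI impI ballI)
  fix M :: "'a list set monoid" and u
  assume M: "monoid M" and iso: "\<forall>u\<in>W. isoterm M u" and "u \<in> {l}"
  define E :: "'a identity set" where "E = identities {M}"
  interpret eq_theory E unfolding E_def by (rule eq_theory_identities) (simp add: M)
  have rw: "rigid E (P @ c # d # Q)" using iso w(1) by (simp add: E_def rigid_identities)
  have "rigid E [x, t, x]" by (rule xtx_rigid_of_adjacent[OF rw w(2-4) xt])
  then have X: "xtx_theory E x t" using xt by unfold_locales
  have not: "(l, r) \<notin> E"
  proof
    assume lr: "(l, r) \<in> E"
    have 1: "(p @ subst_word \<theta> l @ s, p @ subst_word \<theta> r @ s) \<in> E"
      by (rule context_mem[OF subst_mem[OF lr]])
    from \<theta>(2) show False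
    proof
      assume eq: "P @ c # d # Q = p @ subst_word \<theta> l @ s"
      from rigidD[OF rw[unfolded eq] 1] show False using \<theta>(1) by simp
    next
      assume eq: "P @ c # d # Q = p @ subst_word \<theta> r @ s"
      from rigidD[OF rw[unfolded eq] sym_mem[OF 1]] show False using \<theta>(1) by simp
    qed
  qed
  have "rigid E l"
    unfolding rigid_def using partner[OF X] not by blast
  then show "isoterm M u" using \<open>u \<in> {l}\<close> by (simp add: E_def rigid_identities)
qed

lemma le_sigma_mu_word:
  assumes d: "distinct [x, y, t, s]" and w: "P @ c # e # Q \<in> W" "c \<noteq> e"
    and "c \<in> set P \<and> e \<in> set Q \<or> e \<in> set P \<and> c \<in> set Q"
  shows "W \<preceq> {[x, t, x, y, s, y]}"
proof -
  have "\<exists>\<theta> p q. (subst_word \<theta> [x, t, x, y, s, y] \<noteq> subst_word \<theta> [x, t, y, x, s, y]) \<and>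
    (P @ c # e # Q = p @ subst_word \<theta> [x, t, x, y, s, y] @ q \<or>
     P @ c # e # Q = p @ subst_word \<theta> [x, t, y, x, s, y] @ q)"
    using assms(4)
  proof
    assume "c \<in> set P \<and> e \<in> set Q"
    then obtain P1 P2 Q1 Q2 where "P = P1 @ c # P2" "Q = Q1 @ e # Q2" by (meson split_list)
    then show ?thesis using d w(2)
      \<comment> \<open>The linear letters take up the words between the pair and the further
        occurrences of \<open>c\<close> and \<open>e\<close>.\<close>
      by (intro exI[of _ "(\<lambda>_. [])(x := [c], y := [e], t := P2, s := Q1)"] exI[of _ P1] exI[of _ Q2]) auto
  next
    assume "e \<in> set P \<and> c \<in> set Q"
    then obtain P1 P2 Q1 Q2 where "P = P1 @ e # P2" "Q = Q1 @ c # Q2" by (meson split_list)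
    then show ?thesis using d w(2)
      by (intro exI[of _ "(\<lambda>_. [])(x := [e], y := [c], t := P2, s := Q1)"] exI[of _ P1] exI[of _ Q2]) auto
  qed
  then obtain \<theta> p q where "subst_word \<theta> [x, t, x, y, s, y] \<noteq> subst_word \<theta> [x, t, y, x, s, y]"
    "P @ c # e # Q = p @ subst_word \<theta> [x, t, x, y, s, y] @ q \<or>
     P @ c # e # Q = p @ subst_word \<theta> [x, t, y, x, s, y] @ q" by blast
  moreover have "c \<in> set P \<union> set Q" "e \<in> set P \<union> set Q" using assms(4) by auto
  moreover have "x \<noteq> t" using d by auto
  moreover have "v = [x, t, x, y, s, y] \<or> v = [x, t, y, x, s, y]"
    if "xtx_theory E x t" "([x, t, x, y, s, y], v) \<in> E" for E v
    by (rule xtx_theory.sigma_mu_partner[OF that(1) d that(2)]) simp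
  ultimately show ?thesis by (intro le_of_unsatisfied[OF w])
qed

lemma le_sigma_2_word:
  assumes d: "distinct [x, y, t, s]" and w: "P @ c # e # Q \<in> W" "c \<noteq> e" and P: "c \<in> set P" "e \<in> set P"
  shows "W \<preceq> {[x, t, y, s, x, y]}"
proof -
  obtain P1 a P2 b P3 where s: "P = P1 @ a # P2 @ b # P3" "{a, b} = {c, e}"
    using split_list_two[OF P w(2)] by blast
  define \<theta> where "\<theta> = (\<lambda>_. [])(x := [a], y := [b], t := P2, s := P3)"
  have \<theta>: "\<theta> x = [a]" "\<theta> y = [b]" "\<theta> t = P2" "\<theta> s = P3" using d by (auto simp: \<theta>_def)
  have "a = c \<and> b = e \<or> a = e \<and> b = c" using s(2) by (auto simp: doubleton_eq_iff)
  then have "P @ c # e # Q = P1 @ subst_word \<theta> [x, t, y, s, x, y] @ Q \<or>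
     P @ c # e # Q = P1 @ subst_word \<theta> [x, t, y, s, y, x] @ Q"
    "subst_word \<theta> [x, t, y, s, x, y] \<noteq> subst_word \<theta> [x, t, y, s, y, x]"
    using s(1) \<theta> w(2) by auto
  moreover have "c \<in> set P \<union> set Q" "e \<in> set P \<union> set Q" using P by auto
  moreover have "x \<noteq> t" using d by auto
  moreover have "v = [x, t, y, s, x, y] \<or> v = [x, t, y, s, y, x]"
    if "xtx_theory E x t" "([x, t, y, s, x, y], v) \<in> E" for E v
    by (rule xtx_theory.sigma_2_partner[OF that(1) d that(2)]) simp
  ultimately show ?thesis by (intro le_of_unsatisfied[OF w])
qed

lemma le_sigma_1_word:
  assumes d: "distinct [x, y, t, s]" and w: "P @ c # e # Q \<in> W" "c \<noteq> e" and Q: "c \<in> set Q" "e \<in> set Q"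
  shows "W \<preceq> {[x, y, t, x, s, y]}"
proof -
  obtain Q1 a Q2 b Q3 where s: "Q = Q1 @ a # Q2 @ b # Q3" "{a, b} = {c, e}"
    using split_list_two[OF Q w(2)] by blast
  define \<theta> where "\<theta> = (\<lambda>_. [])(x := [a], y := [b], t := Q1, s := Q2)"
  have \<theta>: "\<theta> x = [a]" "\<theta> y = [b]" "\<theta> t = Q1" "\<theta> s = Q2" using d by (auto simp: \<theta>_def)
  have "a = c \<and> b = e \<or> a = e \<and> b = c" using s(2) by (auto simp: doubleton_eq_iff)
  then have "P @ c # e # Q = P @ subst_word \<theta> [x, y, t, x, s, y] @ Q3 \<or>
     P @ c # e # Q = P @ subst_word \<theta> [y, x, t, x, s, y] @ Q3"
    "subst_word \<theta> [x, y, t, x, s, y] \<noteq> subst_word \<theta> [y, x, t, x, s, y]"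
    using s(1) \<theta> w(2) by auto
  moreover have "c \<in> set P \<union> set Q" "e \<in> set P \<union> set Q" using Q by auto
  moreover have "x \<noteq> t" using d by auto
  moreover have "v = [x, y, t, x, s, y] \<or> v = [y, x, t, x, s, y]"
    if "xtx_theory E x t" "([x, y, t, x, s, y], v) \<in> E" for E v
    by (rule xtx_theory.sigma_1_partner[OF that(1) d that(2)]) simp
  ultimately show ?thesis by (intro le_of_unsatisfied[OF w])
qed

section \<open>Adjacent pairs and the identities of S(W)\<close>

lemma first_occurrence_append:
  "first_occurrence (P @ c # Q) (length P) \<longleftrightarrow> c \<notin> set P"
  by (auto simp: first_occurrence_def nth_append in_set_conv_nth)

lemma last_occurrence_append:
  "last_occurrence (P @ c # Q) (length P) \<longleftrightarrow> c \<notin> set Q"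
proof -
  have "c \<in> set Q \<longleftrightarrow> (\<exists>j. length P < j \<and> j < length (P @ c # Q) \<and> (P @ c # Q) ! j = c)"
  proof
    assume "c \<in> set Q"
    then obtain k where "k < length Q" "Q ! k = c" by (auto simp: in_set_conv_nth)
    then show "\<exists>j. length P < j \<and> j < length (P @ c # Q) \<and> (P @ c # Q) ! j = c"
      by (intro exI[of _ "length P + Suc k"]) (simp add: nth_append)
  next
    assume "\<exists>j. length P < j \<and> j < length (P @ c # Q) \<and> (P @ c # Q) ! j = c"
    then obtain j where j: "length P < j" "j < length (P @ c # Q)" "(P @ c # Q) ! j = c" by blast
    define k where "k = j - Suc (length P)"
    have "j = length P + Suc k" using j(1) by (simp add: k_def)
    then show "c \<in> set Q" using j by (auto simp: nth_append)
  qed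
  then show ?thesis by (auto simp: last_occurrence_def)
qed

lemma adjacent_nonlinear_pair_append:
  "adjacent_nonlinear_pair (P @ c # d # Q) (length P) \<longleftrightarrow>
    c \<noteq> d \<and> 2 \<le> count_list (P @ c # d # Q) c \<and> 2 \<le> count_list (P @ c # d # Q) d"
  by (auto simp: adjacent_nonlinear_pair_def nonlinear_in_def nth_append)

lemma adjacent_nonlinear_pairE:
  assumes "adjacent_nonlinear_pair u i"
  obtains P c d Q where "u = P @ c # d # Q" "i = length P"
proof -
  have i: "Suc i < length u" using assms by (simp add: adjacent_nonlinear_pair_def)
  then have "u = take i u @ u ! i # u ! Suc i # drop (Suc (Suc i)) u"
    by (metis Cons_nth_drop_Suc Suc_lessD append_take_drop_id)
  then show thesis using that i by (metis Suc_lessD length_take less_imp_le_nat min.absorb2)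
qed

text \<open>As the \<open>sigma_mu\<close> word is excluded, the further occurrences of an adjacent
  pair cannot lie on opposite sides. If one member is not a first occurrence, both letters therefore
  occur on the left and give the \<open>sigma_2\<close> word; if one is not a last occurrence, both
  occur on the right and give the \<open>sigma_1\<close> word.\<close>

lemma not_le_imp_adjacent_pairs:
  assumes d: "distinct [x, y, t, s]"
    and III: "\<not> W \<preceq> {[x, t, x, y, s, y]}"
      "\<not> W \<preceq> {[x, y, t, x, s, y]} \<or> \<not> W \<preceq> {[x, t, y, s, x, y]}"
  shows "adjacent_pairs_first W \<or> adjacent_pairs_last W"
proof (rule ccontr)
  assume no: "\<not> ?thesis"
  have mem: "c \<in> set P \<union> set Q \<and> e \<in> set P \<union> set Q"
    if "adjacent_nonlinear_pair (P @ c # e # Q) (length P)" for P Q and c e :: 'a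
  proof -
    have "c \<noteq> e" "2 \<le> count_list (P @ c # e # Q) c" "2 \<le> count_list (P @ c # e # Q) e"
      using that unfolding adjacent_nonlinear_pair_append by auto
    then have "count_list (P @ Q) c \<noteq> 0" "count_list (P @ Q) e \<noteq> 0" by auto
    then show ?thesis unfolding count_list_0_iff by simp
  qed
  from no obtain u i where u: "u \<in> W" "adjacent_nonlinear_pair u i"
      "\<not> (first_occurrence u i \<and> first_occurrence u (Suc i))"
    by (auto simp: adjacent_pairs_first_def)
  obtain P c e Q where ue: "u = P @ c # e # Q" "i = length P"
    using u(2) by (rule adjacent_nonlinear_pairE)
  have ce: "c \<noteq> e" "c \<in> set P \<union> set Q" "e \<in> set P \<union> set Q"
    using u(2) mem[of P c e Q] unfolding ue adjacent_nonlinear_pair_append by auto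
  have "\<not> (c \<notin> set P \<and> e \<notin> set (P @ [c]))"
    using u(3) first_occurrence_append[of P c "e # Q"] first_occurrence_append[of "P @ [c]" e Q]
    unfolding ue by simp
  then have 2: "W \<preceq> {[x, t, y, s, x, y]}"
    using ce III(1) le_sigma_mu_word[OF d, of P c e Q W] le_sigma_2_word[OF d, of P c e Q W] u(1)
    unfolding ue by auto
  from no obtain u' i' where u': "u' \<in> W" "adjacent_nonlinear_pair u' i'"
      "\<not> (last_occurrence u' i' \<and> last_occurrence u' (Suc i'))"
    by (auto simp: adjacent_pairs_last_def)
  obtain P' c' e' Q' where ue': "u' = P' @ c' # e' # Q'" "i' = length P'"
    using u'(2) by (rule adjacent_nonlinear_pairE)
  have ce': "c' \<noteq> e'" "c' \<in> set P' \<union> set Q'" "e' \<in> set P' \<union> set Q'"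
    using u'(2) mem[of P' c' e' Q'] unfolding ue' adjacent_nonlinear_pair_append by auto
  have "\<not> (c' \<notin> set (e' # Q') \<and> e' \<notin> set Q')"
    using u'(3) last_occurrence_append[of P' c' "e' # Q'"] last_occurrence_append[of "P' @ [c']" e' Q']
    unfolding ue' by simp
  then have 1: "W \<preceq> {[x, y, t, x, s, y]}"
    using ce' III(1) le_sigma_mu_word[OF d, of P' c' e' Q' W] le_sigma_1_word[OF d, of P' c' e' Q' W] u'(1)
    unfolding ue' by auto
  from 1 2 III(2) show False by blast
qed

text \<open>A run of \<open>z\<close> must end somewhere, next to a different letter.\<close>

lemma ex_adjacent_distinct:
  assumes "z \<in> set L" "y \<in> set L" "y \<noteq> z"
  shows "\<exists>P e f Q. L = P @ e # f # Q \<and> e \<noteq> f \<and> (e = z \<or> f = z)"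
  using assms
proof (induction L arbitrary: y)
  case (Cons a L)
  then have "L \<noteq> []" by auto
  then obtain b L' where L: "L = b # L'" by (cases L) auto
  show ?case
  proof (cases "a \<noteq> b \<and> (a = z \<or> b = z)")
    case True
    then show ?thesis using L by (intro exI[of _ "[]"] exI[of _ a] exI[of _ b] exI[of _ L']) simp
  next
    case False
    have "\<exists>y'. z \<in> set L \<and> y' \<in> set L \<and> y' \<noteq> z"
    proof (cases "a = z")
      case True
      then show ?thesis using False L Cons.prems by auto
    next
      case a: False
      then show ?thesis using False L Cons.prems by auto
    qed
    then obtain P e f Q where "L = P @ e # f # Q \<and> e \<noteq> f \<and> (e = z \<or> f = z)"
      using Cons.IH by blast
    then show ?thesis by (intro exI[of _ "a # P"] exI[of _ e] exI[of _ f] exI[of _ Q]) simp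
  qed
qed simp

lemma noncommuting_words:
  assumes "A @ B \<noteq> B @ A" shows "\<exists>y\<in>set (A @ B). y \<noteq> z"
proof (rule ccontr)
  assume "\<not> ?thesis"
  then have "A = replicate (length A) z" "B = replicate (length B) z"
    by (auto intro!: replicate_length_same[symmetric])
  then show False using assms by (metis add.commute replicate_add)
qed

text \<open>Shared by the identities of both kinds: \<open>x y\<close> and \<open>y x\<close> become \<open>A B\<close> and \<open>B A\<close>, and a letter
  of \<open>A\<close> (or \<open>B\<close>) lies in an adjacent pair inside them although it also occurs before (or after).\<close>

lemma satisfies_swap:
  fixes W :: "'a list set" and x y :: 'a
  assumes ends: "x \<in> set p \<and> adjacent_pairs_first W \<or> y \<in> set s \<and> adjacent_pairs_last W"
    and cnt: "2 \<le> count_list (p @ [x, y] @ s) x" "2 \<le> count_list (p @ [x, y] @ s) y"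
  shows "satisfies (S_monoid W) (p @ [x, y] @ s, p @ [y, x] @ s)"
proof -
  have False
    if ne: "\<theta> x @ \<theta> y \<noteq> \<theta> y @ \<theta> x" and w: "w \<in> W" and uv: "{u, v} = {x, y}"
      and sub: "sublist (subst_word \<theta> (p @ [u, v] @ s)) w"
    for \<theta> :: "'a \<Rightarrow> 'a list" and w u v
  proof -
    obtain w1 w2 where w12: "w = w1 @ subst_word \<theta> (p @ [u, v] @ s) @ w2"
      using sub by (auto simp: sublist_def)
    define L where "L = \<theta> u @ \<theta> v"
    have setL: "set L = set (\<theta> x) \<union> set (\<theta> y)" using uv by (auto simp: L_def doubleton_eq_iff)
    have weq: "w = (w1 @ subst_word \<theta> p) @ L @ (subst_word \<theta> s @ w2)"
      using w12 by (simp add: L_def)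
    have cnt_eq: "count_list (p @ [u, v] @ s) a = count_list (p @ [x, y] @ s) a" for a
      using uv by (auto simp: doubleton_eq_iff)
    have c2: "2 \<le> count_list w l" if "l \<in> set L" for l
    proof -
      obtain a where a: "a = x \<or> a = y" "l \<in> set (\<theta> a)" using \<open>l \<in> set L\<close> setL by auto
      have "2 \<le> count_list (p @ [u, v] @ s) a"
        unfolding cnt_eq using a(1) cnt by (elim disjE) (simp_all only:)
      moreover have "count_list (p @ [u, v] @ s) a \<le> count_list (subst_word \<theta> (p @ [u, v] @ s)) l"
        by (rule count_list_subst_word_le) (rule a(2))
      moreover have "count_list w l =
          count_list w1 l + (count_list (subst_word \<theta> (p @ [u, v] @ s)) l + count_list w2 l)"
        unfolding w12 by (simp only: count_list_append)
      ultimately show ?thesis by linarith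
    qed
    have nonempty: "\<theta> x \<noteq> []" "\<theta> y \<noteq> []" using ne by auto
    have pair: "\<exists>P e f Q. w = P @ e # f # Q \<and> e \<noteq> f \<and> (e = z \<or> f = z) \<and>
        set (w1 @ subst_word \<theta> p) \<subseteq> set P \<and> set (subst_word \<theta> s @ w2) \<subseteq> set Q \<and>
        adjacent_nonlinear_pair w (length P)" if "z \<in> set L" for z
    proof -
      obtain z' where "z' \<in> set L" "z' \<noteq> z" using noncommuting_words[OF ne, of z] setL by auto
      then obtain P e f Q where L: "L = P @ e # f # Q" "e \<noteq> f" "e = z \<or> f = z"
        using ex_adjacent_distinct[OF \<open>z \<in> set L\<close>] by blast
      define P' Q' where "P' = (w1 @ subst_word \<theta> p) @ P" and "Q' = Q @ (subst_word \<theta> s @ w2)"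
      have w': "w = P' @ e # f # Q'" using weq L by (simp add: P'_def Q'_def)
      moreover have "adjacent_nonlinear_pair w (length P')"
        unfolding w' adjacent_nonlinear_pair_append using L c2[of e] c2[of f] w' by auto
      ultimately show ?thesis using L
        by (intro exI[of _ P'] exI[of _ e] exI[of _ f] exI[of _ Q'] conjI) (auto simp: P'_def Q'_def)
    qed
    from ends show False
    proof
      assume x: "x \<in> set p \<and> adjacent_pairs_first W"
      obtain z where z: "z \<in> set (\<theta> x)" using nonempty(1) by (cases "\<theta> x") auto
      obtain P e f Q where *: "w = P @ e # f # Q" "e \<noteq> f" "e = z \<or> f = z"
          "set (w1 @ subst_word \<theta> p) \<subseteq> set P" "adjacent_nonlinear_pair w (length P)"
        using pair[of z] z setL by auto
      have "z \<in> set P" using *(4) mem_subst_word[of x p z \<theta>] x z by auto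
      moreover have "first_occurrence w (length P)" "first_occurrence w (Suc (length P))"
        using x w *(5) by (auto simp: adjacent_pairs_first_def)
      then have "e \<notin> set P" "f \<notin> set P"
        using first_occurrence_append[of P e "f # Q"] first_occurrence_append[of "P @ [e]" f Q] *(1) by auto
      ultimately show False using *(3) by blast
    next
      assume y: "y \<in> set s \<and> adjacent_pairs_last W"
      obtain z where z: "z \<in> set (\<theta> y)" using nonempty(2) by (cases "\<theta> y") auto
      obtain P e f Q where *: "w = P @ e # f # Q" "e \<noteq> f" "e = z \<or> f = z"
          "set (subst_word \<theta> s @ w2) \<subseteq> set Q" "adjacent_nonlinear_pair w (length P)"
        using pair[of z] z setL by auto
      have "z \<in> set Q" using *(4) mem_subst_word[of y s z \<theta>] y z by auto
      moreover have "last_occurrence w (length P)" "last_occurrence w (Suc (length P))"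
        using y w *(5) by (auto simp: adjacent_pairs_last_def)
      then have "e \<notin> set Q" "f \<notin> set Q"
        using last_occurrence_append[of P e "f # Q"] last_occurrence_append[of "P @ [e]" f Q] *(1) by auto
      ultimately show False using *(3) by blast
    qed
  qed
  note no = this
  show ?thesis
    unfolding satisfies_S_monoid
  proof
    fix \<theta> :: "'a \<Rightarrow> 'a list"
    show "subst_word \<theta> (p @ [x, y] @ s) = subst_word \<theta> (p @ [y, x] @ s) \<or>
      \<not> (\<exists>w\<in>W. sublist (subst_word \<theta> (p @ [x, y] @ s)) w) \<and>
      \<not> (\<exists>w\<in>W. sublist (subst_word \<theta> (p @ [y, x] @ s)) w)"
    proof (cases "\<theta> x @ \<theta> y = \<theta> y @ \<theta> x")
      case True
      then have "subst_word \<theta> [x, y] = subst_word \<theta> [y, x]" by simp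
      then have "subst_word \<theta> (p @ [x, y] @ s) = subst_word \<theta> (p @ [y, x] @ s)"
        by (simp only: subst_word_simps(3))
      then show ?thesis by (rule disjI1)
    next
      case False
      then show ?thesis using no[OF False _ HOL.refl] no[OF False _ insert_commute] by blast
    qed
  qed
qed

text \<open>The conditions and the identities match crosswise: if adjacent pairs are first
  occurrences, the exchange of second occurrences in \<open>sigma_2\<close> is harmless, and dually
  for \<open>sigma_1\<close>. In \<open>sigma_mu\<close> the pair offers an earlier \<open>x\<close>
  and a later \<open>y\<close>, so either condition suffices.\<close>

lemma adjacent_pairs_imp_var:
  assumes d: "distinct [x, y, t, s]" and IV: "adjacent_pairs_first W \<or> adjacent_pairs_last W"
  shows "S_monoid W \<in> var_of {sigma_1 x y t s, sigma_mu x y t s} \<or>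
    S_monoid W \<in> var_of {sigma_2 x y t s, sigma_mu x y t s}"
proof -
  have mu: "satisfies (S_monoid W) (sigma_mu x y t s)"
    using satisfies_swap[of x "[x, t]" W y "[s, y]"] IV by (auto simp: sigma_mu_def)
  from IV show ?thesis
  proof
    assume "adjacent_pairs_first W"
    then have "satisfies (S_monoid W) (sigma_2 x y t s)"
      using satisfies_swap[of x "[x, t, y, s]" W y "[]"] by (auto simp: sigma_2_def)
    then show ?thesis using mu by (simp add: var_of_def monoid_S_monoid)
  next
    assume "adjacent_pairs_last W"
    then have "satisfies (S_monoid W) (sigma_1 x y t s)"
      using satisfies_swap[of x "[]" W y "[t, x, s, y]"] by (auto simp: sigma_1_def)
    then show ?thesis using mu by (simp add: var_of_def monoid_S_monoid)
  qed
qed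

lemma var_imp_hereditary:
  fixes W :: "'a::infinite list set"
  assumes d: "distinct [x, y, t, s]"
    and V: "S_monoid W \<in> var_of {sigma_1 x y t s, sigma_mu x y t s} \<or>
      S_monoid W \<in> var_of {sigma_2 x y t s, sigma_mu x y t s}"
  shows "hereditarily_finitely_based (S_monoid W)"
  unfolding hereditarily_finitely_based_def
proof (intro allI impI)
  fix V assume "monoid_variety V \<and> V \<subseteq> var_gen (S_monoid W)"
  then show "finitely_based V"
    using assms(2) var_gen_subset finitely_based_sigma_1[OF d] finitely_based_sigma_2[OF d]
    by (meson order_trans)
qed

theorem corollary3p7:
  fixes W :: "'a::{countable,infinite} list set" and x y t\<^sub>1 t\<^sub>2 :: 'a
  assumes "distinct [x, y, t\<^sub>1, t\<^sub>2]"
  shows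
    "let
       I = hereditarily_finitely_based (S_monoid W);
       II = word_set_hereditarily_finitely_based W;
       III = (\<not> W \<preceq> {[x, t\<^sub>1, x, y, t\<^sub>2, y]} \<and>
         (\<not> W \<preceq> {[x, y, t\<^sub>1, x, t\<^sub>2, y]} \<or> \<not> W \<preceq> {[x, t\<^sub>1, y, t\<^sub>2, x, y]}));
       IV = (adjacent_pairs_first W \<or> adjacent_pairs_last W);
       V = (S_monoid W \<in> var_of {sigma_1 x y t\<^sub>1 t\<^sub>2, sigma_mu x y t\<^sub>1 t\<^sub>2} \<or>
         S_monoid W \<in> var_of {sigma_2 x y t\<^sub>1 t\<^sub>2, sigma_mu x y t\<^sub>1 t\<^sub>2})
     in (I \<longleftrightarrow> II) \<and> (II \<longleftrightarrow> III) \<and> (III \<longleftrightarrow> IV) \<and> (IV \<longleftrightarrow> V)"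
  unfolding Let_def
  \<comment> \<open>The implications form the cycle I, II, III, IV, V, I.\<close>
  using hereditary_imp_word_set_hereditary[of W] word_set_hereditary_imp_not_le[OF assms, of W]
    not_le_imp_adjacent_pairs[OF assms, of W] adjacent_pairs_imp_var[OF assms, of W]
    var_imp_hereditary[OF assms, of W]
  by argo

end
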